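(* Let $G_n$ be the number of unicycle digraphs on the labeled vertex set $\{1,\dots,n\}$ and $K_n$ the number of those which have at least one kernel (equivalently, admit a well-coloring). Then, as $n\to\infty$, $$\frac{K_n}{G_n}=1-\frac{2\sqrt2\,\lambda^3}{(1+\lambda)^2(1-\lambda)\sqrt{\pi}}\,\frac{1}{\sqrt n}+o\!\left(\frac1{\sqrt n}\right),$$ where $\lambda\approx0.351733$ is the unique real root of $2\lambda=\exp(-\lambda)$.
   Context: All digraphs are finite, without loops and without multiple arcs (two opposite arcs $(u,v)$ and $(v,u)$ may both be present, forming a cycle of length 2). A unicycle digraph is a connected digraph whose underlying undirected multigraph (a pair of opposite arcs counting as a cycle of length 2) has at most one cycle (not necessarily directed). A kernel of a digraph $(V,E)$ is a nonempty set $K\subseteq V$ with no arc between vertices of $K$ such that every vertex outside $K$ has an arc to a vertex of $K$; a well-coloring colors vertices red/green so that every green vertex has a red out-neighbour and no red vertex has a red out-neighbour (the red set being a kernel). *)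

theory Defs
  imports Complex_Main "HOL-Library.Landau_Symbols" "Graph_Theory.Graph_Theory"
begin

text \<open>
  A cycle of the underlying undirected multigraph, in which every arc is an edge of its own: a cyclic
  sequence of at least two distinct vertices \<open>vs\<close> whose consecutive members are joined by distinct
  arcs \<open>es\<close>, each traversed in either direction. For length 2 this forces the two arcs to be
  opposite.
\<close>

definition underlying_cycle :: "'a pair_pre_digraph \<Rightarrow> 'a list \<Rightarrow> ('a \<times> 'a) list \<Rightarrow> bool" where
  "underlying_cycle G vs es \<longleftrightarrow>
     2 \<le> length vs \<and> length es = length vs \<and> distinct vs \<and> distinct es \<and> set es \<subseteq> parcs G \<and>
     (\<forall>i < length vs. {fst (es ! i), snd (es ! i)} = {vs ! i, vs ! (Suc i mod length vs)})"

text \<open>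
  Cycles are counted as subgraphs, that is, up to the choice of the starting vertex and of the
  direction of traversal; as such they are determined by their sets of arcs.
\<close>

definition underlying_cycles :: "'a pair_pre_digraph \<Rightarrow> ('a \<times> 'a) set set" where
  "underlying_cycles G = {set es |vs es. underlying_cycle G vs es}"

text \<open>
  The qualified name is needed since \<open>connected\<close> is also a notion of topology; the one
  used here is connectedness of the symmetric closure.
\<close>

definition unicycle_digraph :: "'a pair_pre_digraph \<Rightarrow> bool" where
  "unicycle_digraph G \<longleftrightarrow>
     pair_digraph G \<and> Digraph_Component.connected (with_proj G) \<and>
     (\<forall>C \<in> underlying_cycles G. \<forall>D \<in> underlying_cycles G. C = D)"

definition kernel :: "'a pair_pre_digraph \<Rightarrow> 'a set \<Rightarrow> bool" where
  "kernel G K \<longleftrightarrow>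
     K \<noteq> {} \<and> K \<subseteq> pverts G \<and>
     (\<forall>u \<in> K. \<forall>v \<in> K. (u, v) \<notin> parcs G) \<and>
     (\<forall>u \<in> pverts G - K. \<exists>v \<in> K. (u, v) \<in> parcs G)"

datatype colour = Red | Green

definition well_coloring :: "'a pair_pre_digraph \<Rightarrow> ('a \<Rightarrow> colour) \<Rightarrow> bool" where
  "well_coloring G c \<longleftrightarrow>
     (\<forall>u \<in> pverts G. c u = Green \<longrightarrow> (\<exists>v \<in> pverts G. (u, v) \<in> parcs G \<and> c v = Red)) \<and>
     (\<forall>u \<in> pverts G. c u = Red \<longrightarrow> \<not> (\<exists>v \<in> pverts G. (u, v) \<in> parcs G \<and> c v = Red))"

lemma ex_kernel_iff_ex_well_coloring:
  assumes "pverts G \<noteq> {}"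
  shows "(\<exists>K. kernel G K) \<longleftrightarrow> (\<exists>c. well_coloring G c)"
proof
  assume "\<exists>K. kernel G K"
  then obtain K where K: "kernel G K" by blast
  have "well_coloring G (\<lambda>v. if v \<in> K then Red else Green)"
    using K unfolding kernel_def well_coloring_def by (auto split: if_splits) (meson DiffI subsetD)
  then show "\<exists>c. well_coloring G c" by blast
next
  assume "\<exists>c. well_coloring G c"
  then obtain c where c: "well_coloring G c" by blast
  have "c u = Green" if "c u \<noteq> Red" for u using that by (cases "c u") auto
  then have "kernel G {v \<in> pverts G. c v = Red}"
    using c assms unfolding kernel_def well_coloring_def by blast
  then show "\<exists>K. kernel G K" by blast
qed

definition unicycle_digraphs :: "nat \<Rightarrow> nat pair_pre_digraph set" where
  "unicycle_digraphs n = {G. pverts G = {1..n} \<and> unicycle_digraph G}"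

definition num_unicycle :: "nat \<Rightarrow> nat" where
  "num_unicycle n = card (unicycle_digraphs n)"

definition num_unicycle_kernel :: "nat \<Rightarrow> nat" where
  "num_unicycle_kernel n = card {G \<in> unicycle_digraphs n. \<exists>K. kernel G K}"

end

theory Submission
  imports Defs "HOL-Probability.Probability" "HOL-Real_Asymp.Real_Asymp"
begin

text \<open>
  On \<open>n\<close> vertices, a unicycle digraph is a connected loopless digraph with at most \<open>n\<close> arcs. Peeling off
  a unique cycle of length \<open>k\<close> leaves a forest whose roots are the cycle vertices. Counting forests by
  removing a root gives \<open>T = z exp(2T)\<close> for rooted oriented trees, and \<open>R = z exp(2T - R)\<close> for those whose
  root is red when the tree is coloured by itself; equivalently \<open>R exp(R) = T\<close>. An acyclic digraph has
  exactly one well-coloring, so a unicycle digraph has none iff its cycle is directed, of odd length,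
  and all its vertices are red as roots of their trees. Hence the kernelless digraphs have the
  exponential generating function \<open>N = \<Sum>(k \<ge> 3 odd) R^k / k\<close>, while
  \<open>G\<^sub>n \<sim> 2^(n-1) n^(n-1) Q(n)\<close> with Ramanujan's function \<open>Q(n) \<sim> \<surd>(\<pi> n / 2)\<close>.

  For the coefficients of \<open>N\<close> no singularity analysis is needed: \<open>N' = T' S\<close>, where
  \<open>S = R\<^sup>2 exp(-R) / ((1 - R\<^sup>2) (1 + R))\<close> is a power series in \<open>R\<close> that converges absolutely at the
  singularity \<open>\<rho> = 1 / (2e)\<close> of \<open>T\<close>, where \<open>T = 1/2\<close> and \<open>R = \<lambda>\<close>. As the coefficients of
  \<open>T'\<close> vary slowly after rescaling by \<open>\<rho>\<close>, those of \<open>T' S\<close> are asymptotic to \<open>S(\<rho>)\<close> times them.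
\<close>

unbundle no vec_syntax
unbundle fps_syntax

section \<open>Connectivity and forests\<close>

text \<open>A forest is encoded by two conditions on a set of arcs: every vertex is connected to a
  root, and there are only as many arcs as vertices to attach. All structural facts then follow by
  counting. Peeling off one root yields the recursions: the in-neighbours of a red root are
  arbitrary (series T) while its out-neighbours must be green (series T - R), whence the exponent 2T
  - R. Green roots are counted as all minus red. Cycles are counted through vertex lists: a directed
  cycle of length k has k of them, an undirected one of length at least 3 has 2k. Length 2 is
  exceptional but contributes to lower order only. Normalised by 2^(n-1) n^(n-1), the number of
  kernelless digraphs is exactly a convolution of the rescaled coefficients of S with q(n) = n^n
  exp(-n) / n!, divided by q(n). Only quotients q(n-j) / q(n) matter, so Stirling's constant never
  enters. The final constant is the value of S at the singularity divided by sqrt(pi/2).\<close>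

definition conn :: "('a \<times> 'a) set \<Rightarrow> ('a \<times> 'a) set" where
  "conn P = (P \<union> P\<inverse>)\<^sup>*"

lemma conn_refl [simp]: "(x, x) \<in> conn P"
  by (simp add: conn_def)

lemma conn_sym: "(x, y) \<in> conn P \<Longrightarrow> (y, x) \<in> conn P"
  unfolding conn_def by (meson sym_Un_converse sym_rtrancl symE)

lemma conn_trans: "(x, y) \<in> conn P \<Longrightarrow> (y, z) \<in> conn P \<Longrightarrow> (x, z) \<in> conn P"
  unfolding conn_def by (rule rtrancl_trans)

lemma conn_mono: "P \<subseteq> Q \<Longrightarrow> conn P \<subseteq> conn Q"
  unfolding conn_def by (intro rtrancl_mono) auto

lemma arc_conn: "(x, y) \<in> P \<Longrightarrow> (x, y) \<in> conn P" "(x, y) \<in> P \<Longrightarrow> (y, x) \<in> conn P"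
  unfolding conn_def by auto

lemma conn_subset: "P \<subseteq> conn Q \<Longrightarrow> conn P \<subseteq> conn Q"
proof -
  assume a: "P \<subseteq> conn Q"
  have "P \<union> P\<inverse> \<subseteq> conn Q" using a conn_sym by fastforce
  then show ?thesis unfolding conn_def by (rule rtrancl_subset_rtrancl)
qed

lemma conn_remove_arc:
  assumes "(x, y) \<in> conn (P - {(x, y)})"
  shows "conn (P - {(x, y)}) = conn P"
proof
  show "conn P \<subseteq> conn (P - {(x, y)})"
    using assms arc_conn(1)[of _ _ "P - {(x, y)}"] by (intro conn_subset subrelI) blast
qed (rule conn_mono, auto)

lemma conn_crossing:
  assumes "(x, y) \<in> conn P" "x \<in> A" "y \<notin> A"
  shows "\<exists>u v. u \<in> A \<and> v \<notin> A \<and> ((u, v) \<in> P \<or> (v, u) \<in> P)"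
  using assms(1,3) unfolding conn_def
proof (induction rule: rtrancl_induct)
  case base
  then show ?case using assms(2) by simp
next
  case (step y z)
  then show ?case by (cases "y \<in> A") auto
qed

lemma conn_closed:
  assumes "(x, y) \<in> conn P" "x \<in> A" "\<And>u v. (u, v) \<in> P \<Longrightarrow> u \<in> A \<longleftrightarrow> v \<in> A"
  shows "y \<in> A"
  using conn_crossing[OF assms(1,2)] assms(3) by blast

text \<open>Follow the path from \<open>x\<close> only up to its first element of \<open>B\<close>:
  every arc used until then has an end outside \<open>B\<close>, so arcs inside \<open>B\<close> are
  dispensable.\<close>

lemma conn_first_hit:
  assumes "(x, b) \<in> conn P" "b \<in> B"
  shows "\<exists>b'\<in>B. (x, b') \<in> conn (P - B \<times> B)"
  using assms(1) unfolding conn_def[of P]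
proof (induction rule: converse_rtrancl_induct)
  case base
  then show ?case using assms(2) by (intro bexI[of _ b]) auto
next
  case (step x y)
  show ?case
  proof (cases "x \<in> B")
    case False
    from step(3) obtain b' where b': "b' \<in> B" "(y, b') \<in> conn (P - B \<times> B)" by blast
    have "(x, y) \<in> conn (P - B \<times> B)"
      using step(1) False arc_conn[of x y "P - B \<times> B"] arc_conn[of y x "P - B \<times> B"] by auto
    then show ?thesis using b'(1) conn_trans[OF _ b'(2)] by blast
  qed (auto intro: bexI[of _ x])
qed

definition spans :: "'a set \<Rightarrow> 'a set \<Rightarrow> ('a \<times> 'a) set \<Rightarrow> bool" where
  "spans B M P \<longleftrightarrow> (\<forall>x\<in>M. \<exists>b\<in>B. (x, b) \<in> conn P)"

lemma spans_conn_mono: "spans B M P \<Longrightarrow> conn P \<subseteq> conn Q \<Longrightarrow> spans B M Q"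
  unfolding spans_def by blast

lemma spans_first_hit: "spans B M P \<Longrightarrow> spans B M (P - B \<times> B)"
  unfolding spans_def using conn_first_hit[of _ _ P B] by blast

text \<open>A greedy spanning forest in the manner of Prim: some arc of \<open>P\<close> joins a
  vertex \<open>u\<close> of \<open>M\<close> to \<open>B\<close>; \<open>u\<close> becomes a root,
  one vertex fewer remains to be attached, and the arc is added to what the induction hypothesis
  returns.\<close>

lemma spans_minimal:
  assumes "finite M" "B \<inter> M = {}" "P \<subseteq> (B \<union> M) \<times> (B \<union> M)" "spans B M P"
  shows "\<exists>Q\<subseteq>P. finite Q \<and> card Q = card M \<and> spans B M Q"
  using assms
proof (induction "card M" arbitrary: B M P)
  case 0
  then show ?case by (intro exI[of _ "{}"]) (auto simp: spans_def)
next
  case (Suc k)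
  then have "M \<noteq> {}" by auto
  then obtain x where x: "x \<in> M" by blast
  with Suc.prems(4) obtain b where b: "b \<in> B" "(x, b) \<in> conn P" unfolding spans_def by blast
  have xB: "x \<in> - B" using x Suc by auto
  obtain u v where uv: "u \<in> - B" "v \<notin> - B" "(u, v) \<in> P \<or> (v, u) \<in> P"
    using conn_crossing[OF b(2) xB] b(1) by blast
  have u: "u \<in> M" using uv Suc by auto
  have cM: "card M = Suc (card (M - {u}))" by (rule card.remove[OF Suc.prems(1) u])
  define B' where "B' = insert u B"
  \<comment> \<open>Discarding the arcs between roots keeps the joining arc \<open>e\<close> out of
    \<open>Q\<close>, so that adding it later raises the cardinality.\<close>
  define P' where "P' = P - B' \<times> B'"
  have sp: "spans B' (M - {u}) P'"
    unfolding P'_def by (rule spans_first_hit) (use Suc in \<open>auto simp: spans_def B'_def\<close>)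
  have "\<exists>Q\<subseteq>P'. finite Q \<and> card Q = card (M - {u}) \<and> spans B' (M - {u}) Q"
  proof (rule Suc(1)[OF _ _ _ _ sp])
    show "k = card (M - {u})" using cM Suc.hyps(2) by linarith
    show "finite (M - {u})" "B' \<inter> (M - {u}) = {}"
      using Suc.prems(1,2) by (auto simp: B'_def)
    show "P' \<subseteq> (B' \<union> (M - {u})) \<times> (B' \<union> (M - {u}))"
      using Suc.prems(3) by (auto simp: B'_def P'_def)
  qed
  then obtain Q where Q: "Q \<subseteq> P'" "finite Q" "card Q = card (M - {u})" "spans B' (M - {u}) Q"
    by blast
  obtain e where e: "e \<in> P" "e \<in> B' \<times> B'" "e = (u, v) \<or> e = (v, u)"
    using uv unfolding B'_def by auto
  have eQ: "e \<notin> Q" using Q e P'_def by auto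
  have uv': "(u, v) \<in> conn (insert e Q)" using e arc_conn[of _ _ "insert e Q"] by auto
  have "spans B M (insert e Q)"
    unfolding spans_def
  proof
    fix y assume y: "y \<in> M"
    show "\<exists>b\<in>B. (y, b) \<in> conn (insert e Q)"
    proof (cases "y = u")
      case False
      then obtain b' where b': "b' \<in> B'" "(y, b') \<in> conn Q"
        using Q(4) y unfolding spans_def by auto
      then have "(y, b') \<in> conn (insert e Q)" using conn_mono by blast
      then show ?thesis using b'(1) uv' uv conn_trans[of y u _ v] unfolding B'_def by auto
    qed (use uv uv' in auto)
  qed
  moreover have "card (insert e Q) = card M" 
    using eQ Q(2,3) cM by (metis card_insert_disjoint)
  moreover have "insert e Q \<subseteq> P" "finite (insert e Q)" using Q(1,2) e(1) unfolding P'_def by auto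
  ultimately show ?case by blast
qed

lemma card_le_spans:
  assumes "finite B" "finite M" "B \<inter> M = {}" "P \<subseteq> (B \<union> M) \<times> (B \<union> M)" "spans B M P"
  shows "card M \<le> card P"
proof -
  obtain Q where "Q \<subseteq> P" "card Q = card M" using spans_minimal[OF assms(2-5)] by blast
  moreover have "finite P" using assms by (meson finite_SigmaI finite_UnI finite_subset)
  ultimately show ?thesis by (metis card_mono)
qed

text \<open>
  With only \<open>card M\<close> arcs available to attach \<open>card M\<close> vertices to the roots \<open>B\<close>, there is no
  room for cycles, loops, double arcs or connections between roots.
\<close>

definition forests :: "'a set \<Rightarrow> 'a set \<Rightarrow> ('a \<times> 'a) set set" where
  "forests B M = {P. P \<subseteq> (B \<union> M) \<times> (B \<union> M) \<and> card P = card M \<and> spans B M P}"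

context
  fixes B M :: "'a set" and P
  assumes fin: "finite B" "finite M" and disj: "B \<inter> M = {}" and P: "P \<in> forests B M"
begin

lemma forest_finite: "finite P"
  using P fin unfolding forests_def by (auto intro: finite_subset[of _ "(B \<union> M) \<times> (B \<union> M)"])

lemma forest_minimal: "Q \<subset> P \<Longrightarrow> \<not> spans B M Q"
proof
  assume Q: "Q \<subset> P" "spans B M Q"
  have "card M \<le> card Q" using Q P by (intro card_le_spans[OF fin disj]) (auto simp: forests_def)
  moreover have "card Q < card P" using Q forest_finite psubset_card_mono by blast
  ultimately show False using P by (simp add: forests_def)
qed

text \<open>If the ends stayed connected, the arc could be dropped without losing the spanning
  property, against minimality.\<close>

lemma forest_bridge:
  assumes "(x, y) \<in> P" shows "(x, y) \<notin> conn (P - {(x, y)})"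
proof
  assume "(x, y) \<in> conn (P - {(x, y)})"
  then have "spans B M (P - {(x, y)})" using P unfolding forests_def spans_def by (simp add: conn_remove_arc[OF \<open>(x, y) \<in> conn (P - {(x, y)})\<close>])
  then show False using forest_minimal[of "P - {(x, y)}"] assms by blast
qed

lemma forest_no_root_arcs: "P \<inter> B \<times> B = {}"
  using forest_minimal[of "P - B \<times> B"] spans_first_hit[of B M P] P by (auto simp: forests_def)

lemma forest_no_loop: "(x, x) \<notin> P"
  using forest_bridge[of x x] by auto

lemma forest_no_two_cycle: "(x, y) \<in> P \<Longrightarrow> (y, x) \<notin> P"
proof
  assume a: "(x, y) \<in> P" "(y, x) \<in> P"
  then have "x \<noteq> y" using forest_no_loop by auto
  then have "(y, x) \<in> P - {(x, y)}" using a by auto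
  then show False using forest_bridge[OF a(1)] arc_conn(2) by metis
qed

text \<open>If two roots were connected, one could be demoted to an ordinary vertex: the same
  \<open>card M\<close> arcs would then attach \<open>card M + 1\<close> vertices to the remaining
  roots.\<close>

lemma forest_roots_separated:
  assumes b: "b \<in> B" "b' \<in> B" "(b, b') \<in> conn P" shows "b = b'"
proof (rule ccontr)
  assume ne: "b \<noteq> b'"
  have b1: "(b', b) \<in> conn P" by (rule conn_sym) (rule b(3))
  have "spans (B - {b'}) (insert b' M) P"
    unfolding spans_def
  proof
    fix x assume "x \<in> insert b' M"
    then obtain c where c: "c \<in> B" "(x, c) \<in> conn P"
      using P b(2) conn_refl[of b' P] by (auto simp: forests_def spans_def)
    then have "(x, if c = b' then b else c) \<in> conn P" using b1 conn_trans[of x b' P b] by auto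
    then show "\<exists>c\<in>B - {b'}. (x, c) \<in> conn P"
      using c(1) b(1) ne by (intro bexI[of _ "if c = b' then b else c"]) simp_all
  qed
  then have "card (insert b' M) \<le> card P"
    using P fin disj by (intro card_le_spans[of "B - {b'}"]) (auto simp: forests_def)
  moreover have "card (insert b' M) = Suc (card M)" using fin disj b(2) by (subst card_insert_disjoint) auto
  ultimately show False using P by (simp add: forests_def)
qed

end

section \<open>Cycles and the number of arcs\<close>

text \<open>A vertex that recurs is handled by cutting the path back to its earlier visit, so
  distinctness is maintained along the induction.\<close>

lemma rtrancl_simple_path:
  assumes "(a, b) \<in> S\<^sup>*"
  shows "\<exists>vs. vs \<noteq> [] \<and> distinct vs \<and> hd vs = a \<and> last vs = b \<and>
    (\<forall>i. Suc i < length vs \<longrightarrow> (vs ! i, vs ! Suc i) \<in> S)"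
  using assms
proof (induction rule: rtrancl_induct)
  case base
  show ?case by (rule exI[of _ "[a]"]) simp
next
  case (step y z)
  then obtain vs where vs: "vs \<noteq> []" "distinct vs" "hd vs = a" "last vs = y"
    "\<forall>i. Suc i < length vs \<longrightarrow> (vs ! i, vs ! Suc i) \<in> S" by blast
  show ?case
  proof (cases "z \<in> set vs")
    case True
    then obtain i where i: "i < length vs" "vs ! i = z" by (auto simp: in_set_conv_nth)
    let ?ws = "take (Suc i) vs"
    have "last ?ws = z" using i by (simp add: take_Suc_conv_app_nth)
    then show ?thesis using vs i by (intro exI[of _ ?ws]) auto
  next
    case False
    have "(vs ! i, (vs @ [z]) ! Suc i) \<in> S" if "i < length vs" for i
    proof (cases "Suc i < length vs")
      case True
      then show ?thesis using vs(5) by (simp add: nth_append)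
    next
      case False
      then have "i = length vs - 1" "Suc i = length vs" using that by auto
      then show ?thesis using vs(1,4) step(2) by (simp add: last_conv_nth nth_append)
    qed
    then show ?thesis using vs False by (intro exI[of _ "vs @ [z]"]) (auto simp: nth_append)
  qed
qed

text \<open>Being a cycle depends on the arc set alone; this form applies directly to subsets of
  arcs and to the arcs of a single cycle.\<close>

definition ucycle :: "('a \<times> 'a) set \<Rightarrow> 'a list \<Rightarrow> ('a \<times> 'a) list \<Rightarrow> bool" where
  "ucycle E vs es \<longleftrightarrow>
     2 \<le> length vs \<and> length es = length vs \<and> distinct vs \<and> distinct es \<and> set es \<subseteq> E \<and>
     (\<forall>i < length vs. {fst (es ! i), snd (es ! i)} = {vs ! i, vs ! (Suc i mod length vs)})"

lemma underlying_cycle_ucycle: "underlying_cycle G vs es \<longleftrightarrow> ucycle (parcs G) vs es"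
  by (simp add: underlying_cycle_def ucycle_def)

lemma ucycle_arc:
  assumes "ucycle E vs es" "i < length vs"
  shows "es ! i = (vs ! i, vs ! (Suc i mod length vs)) \<or> es ! i = (vs ! (Suc i mod length vs), vs ! i)"
proof -
  have "{fst (es ! i), snd (es ! i)} = {vs ! i, vs ! (Suc i mod length vs)}"
    using assms unfolding ucycle_def by blast
  then show ?thesis by (cases "es ! i") (auto simp: doubleton_eq_iff)
qed

lemma ucycle_nonempty: "ucycle E vs es \<Longrightarrow> es ! 0 \<in> set es"
  unfolding ucycle_def by (intro nth_mem) linarith

lemma ucycle_step_conn:
  assumes "ucycle E vs es" "i < length vs" "es ! i \<in> P"
  shows "(vs ! i, vs ! (Suc i mod length vs)) \<in> conn P"
  using ucycle_arc[OF assms(1,2)] assms(3) arc_conn by fastforce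

text \<open>Walking on from the end of arc \<open>i\<close> for fewer than \<open>length vs\<close>
  steps never crosses arc \<open>i\<close>, which is why \<open>P\<close> may lack it.\<close>

lemma ucycle_around:
  assumes c: "ucycle E vs es" and i: "i < length vs" and d: "d < length vs"
    and P: "\<And>j. j < length vs \<Longrightarrow> j \<noteq> i \<Longrightarrow> es ! j \<in> P"
  shows "(vs ! (Suc i mod length vs), vs ! ((Suc i + d) mod length vs)) \<in> conn P"
  using d
proof (induction d)
  case (Suc d)
  define k where "k = length vs"
  let ?j = "(Suc i + d) mod k"
  have k: "0 < k" using i by (auto simp: k_def)
  \<comment> \<open>A return to \<open>i\<close> takes \<open>length vs - 1\<close> steps from
    \<open>Suc i\<close>, while here \<open>Suc d\<close> is still below
    \<open>length vs\<close>.\<close>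
  have "?j \<noteq> i"
  proof (cases "Suc i + d < k")
    case False
    then have "?j = (Suc i + d - k) mod k" by (intro le_mod_geq) simp
    also have "\<dots> = Suc i + d - k" using Suc.prems i by (intro mod_less) (simp add: k_def)
    finally have "?j = Suc i + d - k" .
    then show ?thesis using Suc.prems k_def False by linarith
  qed simp
  then have "(vs ! ?j, vs ! (Suc ?j mod k)) \<in> conn P"
    using ucycle_step_conn[OF c _ P] k unfolding k_def by simp
  moreover have "Suc ?j mod k = (Suc i + Suc d) mod k" by (simp add: mod_Suc_eq)
  ultimately show ?case using Suc conn_trans unfolding k_def by fastforce
qed simp

lemma ucycle_remove_conn:
  assumes c: "ucycle E vs es" and e: "(x, y) \<in> set es"
  shows "(x, y) \<in> conn (set es - {(x, y)})"
proof -
  obtain i where i: "i < length vs" "es ! i = (x, y)"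
    using c e by (auto simp: ucycle_def in_set_conv_nth)
  have "es ! j \<in> set es - {(x, y)}" if "j < length vs" "j \<noteq> i" for j
  proof -
    have "j < length es" "i < length es" "distinct es" using c i that by (auto simp: ucycle_def)
    then show ?thesis using i(2) that(2) nth_eq_iff_index_eq[of es j i] by auto
  qed
  \<comment> \<open>With \<open>length vs - 1\<close> steps the walk ends at \<open>i\<close>: it is
    the whole rest of the cycle.\<close>
  then have "(vs ! (Suc i mod length vs), vs ! ((Suc i + (length vs - 1)) mod length vs)) \<in> conn (set es - {(x, y)})"
    using i(1) by (intro ucycle_around[OF c i(1)]) auto
  moreover have "(Suc i + (length vs - 1)) mod length vs = i"
    using i(1) by (metis Nat.add_diff_assoc2 Suc_leI add_Suc_shift add_diff_inverse_nat diff_Suc_1 gr_implies_not0 less_one mod_add_self2 mod_less plus_1_eq_Suc)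
  ultimately have "(vs ! (Suc i mod length vs), vs ! i) \<in> conn (set es - {(x, y)})" by simp
  then show ?thesis using ucycle_arc[OF c i(1)] i(2) conn_sym by fastforce
qed

lemma ucycle_mono: "ucycle E vs es \<Longrightarrow> set es \<subseteq> F \<Longrightarrow> ucycle F vs es"
  unfolding ucycle_def by blast

text \<open>A simple path from \<open>x\<close> to \<open>y\<close> that avoids the arc is closed by
  the arc itself. If the path is a single edge this produces a 2-cycle, since only the opposite arc
  can then join \<open>x\<close> and \<open>y\<close>.\<close>

lemma ucycle_exists:
  assumes e: "(x, y) \<in> E" and ne: "x \<noteq> y" and con: "(x, y) \<in> conn (E - {(x, y)})"
  shows "\<exists>vs es. ucycle E vs es \<and> (x, y) \<in> set es"
proof -
  let ?F = "E - {(x, y)}"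
  obtain vs where vs: "vs \<noteq> []" "distinct vs" "hd vs = x" "last vs = y"
    "\<And>i. Suc i < length vs \<Longrightarrow> (vs ! i, vs ! Suc i) \<in> ?F \<union> ?F\<inverse>"
    using rtrancl_simple_path[OF con[unfolded conn_def]] by blast
  define k where "k = length vs"
  have k: "2 \<le> k"
  proof (rule ccontr)
    assume "\<not> 2 \<le> k"
    then have "k = 1" using vs(1) by (cases k) (auto simp: k_def)
    then obtain a where "vs = [a]" by (auto simp: k_def length_Suc_conv)
    then show False using vs(3,4) ne by simp
  qed
  \<comment> \<open>Neighbours on the path may be joined in either direction; \<open>g\<close>
    selects an arc that is really present. Distinct positions have distinct vertex pairs, hence
    distinct arcs.\<close>
  define g where "g i = (if (vs ! i, vs ! Suc i) \<in> ?F then (vs ! i, vs ! Suc i) else (vs ! Suc i, vs ! i))" for i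
  have gF: "g i \<in> ?F" if "Suc i < k" for i
    using vs(5)[of i] that by (auto simp: g_def k_def)
  have gset: "{fst (g i), snd (g i)} = {vs ! i, vs ! Suc i}" for i by (auto simp: g_def)
  define es where "es = map g [0..<k - 1] @ [(x, y)]"
  have len: "length es = k" using k by (simp add: es_def)
  have inj: "inj_on g {0..<k - 1}"
  proof (rule inj_onI)
    fix i j assume ij: "i \<in> {0..<k - 1}" "j \<in> {0..<k - 1}" "g i = g j"
    then have "{vs ! i, vs ! Suc i} = {vs ! j, vs ! Suc j}" using gset by metis
    moreover have "vs ! a = vs ! b \<longleftrightarrow> a = b" if "a < k" "b < k" for a b
      using vs(2) that by (simp add: k_def nth_eq_iff_index_eq)
    ultimately show "i = j" using ij by (auto simp: doubleton_eq_iff)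
  qed
  have nth: "es ! i = (if i = k - 1 then (x, y) else g i)" if "i < k" for i
    using that by (auto simp: es_def nth_append)
  have "(x, y) \<notin> g ` {0..<k - 1}"
  proof
    assume "(x, y) \<in> g ` {0..<k - 1}"
    then obtain i where "i < k - 1" "g i = (x, y)" by auto
    then have "Suc i < k" "g i = (x, y)" by auto
    then show False using gF[of i] by simp
  qed
  then have "distinct es" using inj by (simp add: es_def distinct_map)
  moreover have "set es \<subseteq> E" using gF e by (fastforce simp: es_def)
  moreover have "{fst (es ! i), snd (es ! i)} = {vs ! i, vs ! (Suc i mod k)}" if i: "i < k" for i
  proof (cases "i = k - 1")
    case True
    then show ?thesis using vs k
      by (auto simp: nth hd_conv_nth last_conv_nth k_def)
  next
    case False
    then show ?thesis using i gset by (simp add: nth)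
  qed
  ultimately have "ucycle E vs es" using k len vs(2) by (simp add: ucycle_def k_def)
  moreover have "(x, y) \<in> set es" by (simp add: es_def)
  ultimately show ?thesis by blast
qed

lemma ucycle_remove_arc_conn:
  assumes "ucycle E vs es" "e \<in> set es"
  shows "conn (E - {e}) = conn E"
proof (cases e)
  case (Pair x y)
  have "(x, y) \<in> conn (set es - {(x, y)})" using ucycle_remove_conn assms Pair by fast
  moreover have "conn (set es - {(x, y)}) \<subseteq> conn (E - {(x, y)})"
    using assms by (intro conn_mono) (auto simp: ucycle_def)
  ultimately show ?thesis unfolding Pair by (intro conn_remove_arc) blast
qed

lemma forest_acyclic_undirected:
  assumes "finite B" "finite M" "B \<inter> M = {}" "P \<in> forests B M"
  shows "\<not> ucycle P vs es"
proof
  assume c: "ucycle P vs es"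
  then obtain x y where xy: "(x, y) \<in> set es" using ucycle_nonempty by (metis surj_pair)
  have "(x, y) \<in> P" using c xy by (auto simp: ucycle_def)
  moreover have "(x, y) \<in> conn P" using \<open>(x, y) \<in> P\<close> by (rule arc_conn)
  ultimately show False using forest_bridge[OF assms \<open>(x, y) \<in> P\<close>] ucycle_remove_arc_conn[OF c xy] by simp
qed

definition conn_digraph :: "'a set \<Rightarrow> ('a \<times> 'a) set \<Rightarrow> bool" where
  "conn_digraph V E \<longleftrightarrow> V \<noteq> {} \<and> E \<subseteq> V \<times> V \<and> V \<times> V \<subseteq> conn E"

context
  fixes V :: "'a set" and E
  assumes fin: "finite V" and con: "conn_digraph V E"
begin

lemma conn_digraph_finite: "finite E"
  using fin con by (auto simp: conn_digraph_def intro: finite_subset[of _ "V \<times> V"])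

lemma conn_digraph_spans: "B \<subseteq> V \<Longrightarrow> B \<noteq> {} \<Longrightarrow> spans B (V - B) E"
  using con unfolding spans_def conn_digraph_def by blast

lemma card_conn:
  assumes "F \<subseteq> E" "conn F = conn E"
  shows "card V \<le> Suc (card F)"
proof -
  obtain r where r: "r \<in> V" using con by (auto simp: conn_digraph_def)
  have "spans {r} (V - {r}) F" using conn_digraph_spans[of "{r}"] r assms(2) by (auto simp: spans_def)
  then have "card (V - {r}) \<le> card F"
    using fin r assms(1) con by (intro card_le_spans[of "{r}"]) (auto simp: conn_digraph_def)
  then show ?thesis using fin r by simp
qed

text \<open>Suppose some arc \<open>e\<close> of one cycle is missing from the other. Deleting
  \<open>e\<close>, and then any arc of the other cycle, which is still intact, preserves
  connectedness; but this leaves at most \<open>card V - 2\<close> arcs, one too few.\<close>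

lemma ucycle_unique:
  assumes "card E \<le> card V" "ucycle E vs es" "ucycle E vs' es'"
  shows "set es = set es'"
proof -
  have *: "set ds \<subseteq> set cs" if c: "ucycle E us cs" and d: "ucycle E ws ds" for us cs ws ds
  proof (rule ccontr)
    assume "\<not> set ds \<subseteq> set cs"
    then obtain e where e: "e \<in> set ds" "e \<notin> set cs" by blast
    have c': "ucycle (E - {e}) us cs" using c e by (intro ucycle_mono[OF c]) (auto simp: ucycle_def)
    obtain e' where e': "e' \<in> set cs" using ucycle_nonempty[OF c] by blast
    have "conn (E - {e} - {e'}) = conn E"
      using ucycle_remove_arc_conn[OF c' e'] ucycle_remove_arc_conn[OF d e(1)] by simp
    then have "card V \<le> Suc (card (E - {e} - {e'}))" by (intro card_conn) auto
    moreover have "e \<in> E" "e' \<in> E - {e}" using c' d e e' by (auto simp: ucycle_def)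
    then have "Suc (Suc (card (E - {e} - {e'}))) = card E"
      using conn_digraph_finite by (metis card_Suc_Diff1 finite_Diff)
    ultimately show False using assms(1) by simp
  qed
  show ?thesis using *[OF assms(2,3)] *[OF assms(3,2)] by blast
qed

lemma conn_digraph_spanning_tree:
  "\<exists>Q\<subseteq>E. Suc (card Q) = card V \<and> conn Q = conn E"
proof -
  obtain r where r: "r \<in> V" using con by (auto simp: conn_digraph_def)
  have "\<exists>Q\<subseteq>E. finite Q \<and> card Q = card (V - {r}) \<and> spans {r} (V - {r}) Q"
    using fin con r by (intro spans_minimal conn_digraph_spans) (auto simp: conn_digraph_def)
  then obtain Q where Q: "Q \<subseteq> E" "card Q = card (V - {r})" "spans {r} (V - {r}) Q" by blast
  have cr: "(v, r) \<in> conn Q" if "v \<in> V" for v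
    using Q(3) that by (cases "v = r") (auto simp: spans_def)
  have "E \<subseteq> conn Q"
  proof
    fix e assume "e \<in> E"
    then obtain u v where "e = (u, v)" "u \<in> V" "v \<in> V" using con by (auto simp: conn_digraph_def)
    then show "e \<in> conn Q" using cr[of u] conn_sym[OF cr[of v]] conn_trans by metis
  qed
  then have "conn Q = conn E" using conn_subset conn_mono Q(1) by blast
  moreover have "Suc (card Q) = card V" using Q(2) fin r by (metis card.remove)
  ultimately show ?thesis using Q(1) by blast
qed

text \<open>The fundamental cycle of \<open>e\<close> with respect to the connecting set
  \<open>Q\<close>; the bound on \<open>set es\<close> serves to tell the cycles of two different
  arcs apart.\<close>

lemma extra_arc_ucycle:
  assumes irr: "irrefl E" and Q: "Q \<subseteq> E" "conn Q = conn E" and e: "e \<in> E - Q"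
  shows "\<exists>vs es. ucycle E vs es \<and> e \<in> set es \<and> set es \<subseteq> insert e Q"
proof (cases e)
  case (Pair x y)
  then have xy: "x \<in> V" "y \<in> V" "x \<noteq> y" using e con irr by (auto simp: conn_digraph_def irrefl_def)
  have "(x, y) \<in> conn Q" using xy con Q(2) by (auto simp: conn_digraph_def)
  then have "(x, y) \<in> conn (insert e Q - {(x, y)})" using e Pair by simp
  then obtain vs es where c: "ucycle (insert e Q) vs es" "(x, y) \<in> set es"
    using ucycle_exists[of x y "insert e Q"] xy Pair by auto
  then have "set es \<subseteq> insert e Q" by (simp add: ucycle_def)
  then show ?thesis using ucycle_mono[OF c(1), of E] c(2) e Q(1) Pair by blast
qed

text \<open>For the forward direction: with more than \<open>card V\<close> arcs at least two lie
  outside a spanning tree; the fundamental cycle of the first contains this first arc, that of the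
  second does not.\<close>

lemma ucycle_unique_iff:
  assumes irr: "irrefl E"
  shows "(\<forall>vs es vs' es'. ucycle E vs es \<longrightarrow> ucycle E vs' es' \<longrightarrow> set es = set es') \<longleftrightarrow> card E \<le> card V"
proof
  assume u: "\<forall>vs es vs' es'. ucycle E vs es \<longrightarrow> ucycle E vs' es' \<longrightarrow> set es = set es'"
  show "card E \<le> card V"
  proof (rule ccontr)
    assume gt: "\<not> card E \<le> card V"
    obtain Q where Q: "Q \<subseteq> E" "Suc (card Q) = card V" "conn Q = conn E"
      using conn_digraph_spanning_tree by blast
    have "card (E - Q) = card E - card Q"
      using Q(1) conn_digraph_finite finite_subset by (intro card_Diff_subset) auto
    then have "2 \<le> card (E - Q)" using gt Q(2) by simp
    then obtain a b where ab: "a \<in> E - Q" "b \<in> E - Q" "a \<noteq> b"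
      by (metis card_le_Suc0_iff_eq conn_digraph_finite finite_Diff not_less_eq_eq numeral_2_eq_2)
    obtain vs es where 1: "ucycle E vs es" "a \<in> set es" using extra_arc_ucycle[OF irr Q(1,3) ab(1)] by blast
    obtain vs' es' where 2: "ucycle E vs' es'" "set es' \<subseteq> insert b Q"
      using extra_arc_ucycle[OF irr Q(1,3) ab(2)] by blast
    show False using u 1 2 ab by blast
  qed
qed (use ucycle_unique in blast)

lemma ucycle_card_eq:
  assumes "card E \<le> card V" "ucycle E vs es"
  shows "card E = card V"
proof -
  note e = ucycle_nonempty[OF assms(2)]
  have "card V \<le> Suc (card (E - {es ! 0}))"
    by (rule card_conn) (use ucycle_remove_arc_conn[OF assms(2) e] in auto)
  moreover have "es ! 0 \<in> E" using e assms(2) by (auto simp: ucycle_def)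
  ultimately have "card V \<le> Suc (card (E - {es ! 0}))" "es ! 0 \<in> E" by auto
  then show ?thesis using assms(1) conn_digraph_finite by (metis card_Suc_Diff1 le_antisym)
qed

lemma ucycle_exists_if_card:
  assumes "irrefl E" "card E = card V"
  shows "\<exists>vs es. ucycle E vs es"
proof -
  obtain Q where Q: "Q \<subseteq> E" "Suc (card Q) = card V" "conn Q = conn E"
    using conn_digraph_spanning_tree by blast
  then have "Q \<noteq> E" using assms(2) by auto
  then obtain e where "e \<in> E - Q" using Q(1) by blast
  then show ?thesis using extra_arc_ucycle[OF assms(1) Q(1,3)] by blast
qed

end

section \<open>Unicycle digraphs and well-colorings\<close>

text \<open>The condition on cycles is replaced by a bound on the number of arcs, equivalent to it
  for finite connected loopless digraphs by \<open>ucycle_unique_iff\<close> and easy to combine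
  with forests.\<close>

definition unicycles :: "'a set \<Rightarrow> ('a \<times> 'a) set set" where
  "unicycles V = {E. irrefl E \<and> conn_digraph V E \<and> card E \<le> card V}"

lemma finite_unicycles: "finite V \<Longrightarrow> finite (unicycles V)"
  by (rule finite_subset[of _ "Pow (V \<times> V)"]) (auto simp: unicycles_def conn_digraph_def)

section \<open>Translation of the given notions into statements about arc sets\<close>

lemma connected_iff_conn_digraph:
  assumes "parcs G \<subseteq> pverts G \<times> pverts G"
  shows "Digraph_Component.connected (with_proj G) \<longleftrightarrow> conn_digraph (pverts G) (parcs G)"
proof -
  let ?S = "parcs G \<union> (parcs G)\<inverse>"
  have S: "parcs (mk_symmetric (with_proj G)) = ?S" by (auto simp: parcs_mk_symmetric)
  have "(u, v) \<in> rtrancl_on (pverts G) ?S \<longleftrightarrow> (u, v) \<in> ?S\<^sup>*" if "u \<in> pverts G" "v \<in> pverts G" for u v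
    using that rtrancl_consistent_rtrancl_on[of u v ?S "pverts G"] rtrancl_on_rtranclI[of u v "pverts G" ?S]
      assms by blast
  then show ?thesis
    unfolding Digraph_Component.connected_def strongly_connected_def reachable_def with_proj_simps S
    using assms by (auto simp: conn_digraph_def conn_def)
qed

lemma unicycle_digraph_iff:
  assumes fin: "finite (pverts G)"
  shows "unicycle_digraph G \<longleftrightarrow> parcs G \<in> unicycles (pverts G)"
proof -
  let ?V = "pverts G" and ?E = "parcs G"
  have dig: "pair_digraph G \<longleftrightarrow> ?E \<subseteq> ?V \<times> ?V \<and> irrefl ?E"
  proof
    assume "pair_digraph G"
    then interpret pair_digraph G .
    show "?E \<subseteq> ?V \<times> ?V \<and> irrefl ?E"
      using arc_fst_in_verts arc_snd_in_verts pair_no_loops by (force simp: irrefl_def)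
  next
    assume a: "?E \<subseteq> ?V \<times> ?V \<and> irrefl ?E"
    then have "finite ?E" using fin by (meson finite_SigmaI finite_subset)
    then show "pair_digraph G" using a fin by unfold_locales (auto simp: irrefl_def)
  qed
  have cyc: "(\<forall>C \<in> underlying_cycles G. \<forall>D \<in> underlying_cycles G. C = D) \<longleftrightarrow>
    (\<forall>vs es vs' es'. ucycle ?E vs es \<longrightarrow> ucycle ?E vs' es' \<longrightarrow> set es = set es')"
    unfolding underlying_cycles_def underlying_cycle_ucycle by blast
  show ?thesis
  proof (cases "?E \<subseteq> ?V \<times> ?V \<and> irrefl ?E \<and> conn_digraph ?V ?E")
    case True
    then show ?thesis
      using ucycle_unique_iff[OF fin] connected_iff_conn_digraph[of G] dig
      unfolding unicycle_digraph_def cyc by (simp add: unicycles_def)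
  next
    case False
    then show ?thesis using connected_iff_conn_digraph[of G] dig
      unfolding unicycle_digraph_def unicycles_def by (auto simp: conn_digraph_def)
  qed
qed

text \<open>
  \<open>K\<close> is the set of red vertices. Elements of the type that are not vertices have no out-neighbours
  and hence are red, which makes the colouring of an acyclic digraph unique on the whole type.
\<close>

definition red_coloring :: "('a \<times> 'a) set \<Rightarrow> 'a set \<Rightarrow> bool" where
  "red_coloring E K \<longleftrightarrow> (\<forall>x. x \<in> K \<longleftrightarrow> (\<forall>y. (x, y) \<in> E \<longrightarrow> y \<notin> K))"

lemma ex_kernel_iff_red_coloring:
  assumes E: "parcs G \<subseteq> pverts G \<times> pverts G" and ne: "pverts G \<noteq> {}"
  shows "(\<exists>K. kernel G K) \<longleftrightarrow> (\<exists>K. red_coloring (parcs G) K)"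
proof
  assume "\<exists>K. kernel G K"
  then obtain K where K: "kernel G K" by blast
  have "red_coloring (parcs G) (K \<union> - pverts G)"
    unfolding red_coloring_def
  proof
    fix x
    show "x \<in> K \<union> - pverts G \<longleftrightarrow> (\<forall>y. (x, y) \<in> parcs G \<longrightarrow> y \<notin> K \<union> - pverts G)"
      using K E unfolding kernel_def by (cases "x \<in> pverts G"; cases "x \<in> K") blast+
  qed
  then show "\<exists>K. red_coloring (parcs G) K" by blast
next
  assume "\<exists>K. red_coloring (parcs G) K"
  then obtain K where K: "red_coloring (parcs G) K" by blast
  have 1: "\<exists>v\<in>K \<inter> pverts G. (u, v) \<in> parcs G" if "u \<in> pverts G" "u \<notin> K" for u
    using K that E unfolding red_coloring_def by blast
  then have "K \<inter> pverts G \<noteq> {}" using ne by blast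
  moreover have "(u, v) \<notin> parcs G" if "u \<in> K" "v \<in> K" for u v
    using K that unfolding red_coloring_def by blast
  ultimately have "kernel G (K \<inter> pverts G)" using 1 unfolding kernel_def by blast
  then show "\<exists>K. kernel G K" by blast
qed

lemma bij_parcs_unicycle:
  "bij_betw parcs (unicycle_digraphs n) (unicycles {1..n})"
proof (rule bij_betwI[where g = "\<lambda>E. \<lparr>pverts = {1..n}, parcs = E\<rparr>"])
  show "parcs \<in> unicycle_digraphs n \<rightarrow> unicycles {1..n}"
  proof
    fix G assume "G \<in> unicycle_digraphs n"
    then show "parcs G \<in> unicycles {1..n}" using unicycle_digraph_iff[of G] by (simp add: unicycle_digraphs_def)
  qed
  show "(\<lambda>E. \<lparr>pverts = {1..n}, parcs = E\<rparr>) \<in> unicycles {1..n} \<rightarrow> unicycle_digraphs n"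
    unfolding unicycle_digraphs_def by (auto simp: unicycle_digraph_iff)
qed (auto simp: unicycle_digraphs_def)

lemma num_unicycle_eq: "num_unicycle n = card (unicycles {1..n})"
  unfolding num_unicycle_def using bij_parcs_unicycle by (rule bij_betw_same_card)

definition kernelless :: "'a set \<Rightarrow> ('a \<times> 'a) set set" where
  "kernelless V = {E \<in> unicycles V. \<nexists>K. red_coloring E K}"

lemma num_unicycle_kernel_eq: "num_unicycle_kernel n + card (kernelless {1..n}) = num_unicycle n"
proof -
  have "{G \<in> unicycle_digraphs n. \<exists>K. kernel G K} = {G \<in> unicycle_digraphs n. \<exists>K. red_coloring (parcs G) K}"
  proof (intro Collect_cong conj_cong refl)
    fix G assume G: "G \<in> unicycle_digraphs n"
    then have "parcs G \<in> unicycles (pverts G)" using unicycle_digraph_iff[of G]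
      by (auto simp: unicycle_digraphs_def)
    then show "(\<exists>K. kernel G K) \<longleftrightarrow> (\<exists>K. red_coloring (parcs G) K)"
      by (intro ex_kernel_iff_red_coloring) (auto simp: unicycles_def conn_digraph_def)
  qed
  moreover have "bij_betw parcs {G \<in> unicycle_digraphs n. \<exists>K. red_coloring (parcs G) K} {E \<in> unicycles {1..n}. \<exists>K. red_coloring E K}"
  proof (rule bij_betw_imageI)
    show "inj_on parcs {G \<in> unicycle_digraphs n. \<exists>K. red_coloring (parcs G) K}"
      using bij_parcs_unicycle[of n] unfolding bij_betw_def by (auto simp: inj_on_def)
    have "unicycles {1..n} = parcs ` unicycle_digraphs n"
      using bij_parcs_unicycle[of n] unfolding bij_betw_def by blast
    then show "parcs ` {G \<in> unicycle_digraphs n. \<exists>K. red_coloring (parcs G) K} = {E \<in> unicycles {1..n}. \<exists>K. red_coloring E K}"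
      by (simp only:) auto
  qed
  ultimately have "num_unicycle_kernel n = card {E \<in> unicycles {1..n}. \<exists>K. red_coloring E K}"
    unfolding num_unicycle_kernel_def by (simp add: bij_betw_same_card)
  moreover have "card {E \<in> unicycles {1..n}. \<exists>K. red_coloring E K} + card (kernelless {1..n}) = card (unicycles {1..n})"
    unfolding kernelless_def using finite_unicycles[of "{1..n}"]
    by (subst card_Un_disjoint[symmetric]) (auto intro!: arg_cong[where f = card])
  ultimately show ?thesis by (simp add: num_unicycle_eq)
qed

text \<open>The colour of a vertex is defined by recursion along its out-arcs, which is well-founded
  in a finite acyclic digraph.\<close>

lemma red_coloring_exists:
  assumes "finite E" "acyclic E"
  shows "\<exists>K. red_coloring E K"
proof -
  have wf: "wf (E\<inverse>)" using assms by (rule finite_acyclic_wf_converse)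
  define f where "f = wfrec (E\<inverse>) (\<lambda>f x. \<forall>y. (x, y) \<in> E \<longrightarrow> \<not> f y)"
  have f: "f x \<longleftrightarrow> (\<forall>y. (x, y) \<in> E \<longrightarrow> \<not> f y)" for x
    using wfrec[OF wf, of "\<lambda>f x. \<forall>y. (x, y) \<in> E \<longrightarrow> \<not> f y" x]
    unfolding f_def[symmetric] by (simp add: cut_apply)
  have "red_coloring E {x. f x}" unfolding red_coloring_def mem_Collect_eq by (intro allI f)
  then show ?thesis by blast
qed

text \<open>A colour is determined by what is reachable from the vertex, so only the out-closed part
  \<open>S\<close> has to be common to both digraphs. \<open>E'\<close> may contain cycles
  elsewhere, as is needed when it is a whole unicycle digraph.\<close>

lemma red_coloring_agree:
  assumes "finite E" "acyclic E" "red_coloring E K" "red_coloring E' K'"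
    and cl: "\<And>x y. x \<in> S \<Longrightarrow> (x, y) \<in> E \<Longrightarrow> y \<in> S"
    and eq: "\<And>x y. x \<in> S \<Longrightarrow> (x, y) \<in> E \<longleftrightarrow> (x, y) \<in> E'"
    and "x \<in> S"
  shows "x \<in> K \<longleftrightarrow> x \<in> K'"
  using finite_acyclic_wf_converse[OF assms(1,2)] \<open>x \<in> S\<close>
proof (induction x rule: wf_induct_rule)
  case (less x)
  then have "y \<in> K \<longleftrightarrow> y \<in> K'" if "(x, y) \<in> E" for y using cl that by blast
  moreover have "x \<in> K \<longleftrightarrow> (\<forall>y. (x, y) \<in> E \<longrightarrow> y \<notin> K)" "x \<in> K' \<longleftrightarrow> (\<forall>y. (x, y) \<in> E' \<longrightarrow> y \<notin> K')"
    using assms(3,4) unfolding red_coloring_def by blast+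
  ultimately show ?case using eq[OF less(2)] by blast
qed

text \<open>Meaningful only for finite acyclic digraphs, which have exactly one colouring.\<close>

definition red_set :: "('a \<times> 'a) set \<Rightarrow> 'a set" where
  "red_set E = (SOME K. red_coloring E K)"

lemma red_coloring_red_set: "finite E \<Longrightarrow> acyclic E \<Longrightarrow> red_coloring E (red_set E)"
  unfolding red_set_def by (rule someI_ex) (rule red_coloring_exists)

section \<open>Directed cycles, and the forest that remains when a cycle is removed\<close>

definition dicycle :: "'a list \<Rightarrow> ('a \<times> 'a) set" where
  "dicycle vs = set (zip vs (rotate1 vs))"

lemma dicycle_eq: "dicycle vs = {(vs ! i, vs ! (Suc i mod length vs)) |i. i < length vs}"
  unfolding dicycle_def by (auto simp: set_zip nth_rotate1)

lemma dicycle_ucycle: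
  assumes "2 \<le> length vs" "distinct vs" "dicycle vs \<subseteq> E"
  shows "ucycle E vs (zip vs (rotate1 vs))"
  using assms unfolding ucycle_def dicycle_def by (simp add: nth_rotate1 distinct_zipI1)

lemma not_acyclic_dicycle:
  assumes "irrefl E" "\<not> acyclic E"
  shows "\<exists>vs. 2 \<le> length vs \<and> distinct vs \<and> dicycle vs \<subseteq> E"
proof -
  obtain x where "(x, x) \<in> E\<^sup>+" using assms(2) by (auto simp: acyclic_def)
  then obtain y where y: "(x, y) \<in> E" "(y, x) \<in> E\<^sup>*" by (metis tranclD)
  obtain vs where vs: "vs \<noteq> []" "distinct vs" "hd vs = y" "last vs = x"
    "\<And>i. Suc i < length vs \<Longrightarrow> (vs ! i, vs ! Suc i) \<in> E"
    using rtrancl_simple_path[OF y(2)] by blast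
  have "length vs \<noteq> 1"
  proof
    assume "length vs = 1"
    then obtain a where "vs = [a]" by (auto simp: length_Suc_conv)
    then show False using vs(3,4) y(1) assms(1) by (auto simp: irrefl_def)
  qed
  moreover have "length vs \<noteq> 0" using vs(1) by simp
  ultimately have "2 \<le> length vs" by linarith
  moreover have "(vs ! i, vs ! (Suc i mod length vs)) \<in> E" if i: "i < length vs" for i
  proof (cases "Suc i < length vs")
    case False
    then have "Suc i = length vs" "i = length vs - 1" using i by auto
    then show ?thesis using vs(1,3,4) y(1) by (simp add: hd_conv_nth last_conv_nth)
  qed (use vs(5) in simp)
  ultimately show ?thesis using vs(2) unfolding dicycle_eq by blast
qed

lemma forest_acyclic:
  assumes "finite B" "finite M" "B \<inter> M = {}" "P \<in> forests B M"
  shows "acyclic P"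
proof (rule ccontr)
  assume "\<not> acyclic P"
  moreover have "irrefl P" using forest_no_loop[OF assms] by (auto simp: irrefl_def)
  ultimately obtain vs where "2 \<le> length vs" "distinct vs" "dicycle vs \<subseteq> P"
    using not_acyclic_dicycle by blast
  then show False using dicycle_ucycle forest_acyclic_undirected[OF assms] by blast
qed

lemma ucycle_conn:
  assumes c: "ucycle E vs es" and "u \<in> set vs" "v \<in> set vs"
  shows "(u, v) \<in> conn (set es)"
proof -
  have *: "(vs ! 0, vs ! j) \<in> conn (set es)" if "j < length vs" for j
    using that
  proof (induction j)
    case (Suc j)
    have "j < length es" using Suc.prems c by (simp add: ucycle_def)
    then have "(vs ! j, vs ! Suc j) \<in> conn (set es)"
      using ucycle_step_conn[OF c, of j "set es"] Suc.prems by simp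
    then show ?case using Suc conn_trans[of "vs ! 0" "vs ! j"] by simp
  qed simp
  obtain i j where ij: "i < length vs" "u = vs ! i" "j < length vs" "v = vs ! j"
    using assms(2,3) by (metis in_set_conv_nth)
  show ?thesis using conn_trans[OF conn_sym[OF *[OF ij(1)]] *[OF ij(3)]] ij by simp
qed

lemma ucycle_arcs_subset: 
  assumes c: "ucycle E vs es" shows "set es \<subseteq> set vs \<times> set vs"
proof
  fix e assume "e \<in> set es"
  then obtain i where i: "i < length vs" "e = es ! i" using c by (auto simp: in_set_conv_nth ucycle_def)
  then have "Suc i mod length vs < length vs" by (intro mod_less_divisor) linarith
  then show "e \<in> set vs \<times> set vs" using ucycle_arc[OF c i(1)] i by auto
qed

lemma ucycle_irrefl:
  assumes c: "ucycle E vs es" shows "(x, x) \<notin> set es"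
proof
  assume "(x, x) \<in> set es"
  then obtain i where i: "i < length vs" "(x, x) = es ! i" using c by (auto simp: in_set_conv_nth ucycle_def)
  have l: "2 \<le> length vs" "distinct vs" using c by (auto simp: ucycle_def)
  have "Suc i mod length vs \<noteq> i" using i(1) l(1) by (cases "Suc i = length vs") auto
  moreover have "Suc i mod length vs < length vs" using i(1) by (intro mod_less_divisor) linarith
  ultimately have "vs ! (Suc i mod length vs) \<noteq> vs ! i" using l(2) i(1) nth_eq_iff_index_eq by blast
  then show False using ucycle_arc[OF c i(1)] i(2) by auto
qed

lemma ucycle_vertex:
  assumes "ucycle E vs es" "E \<subseteq> V \<times> V" shows "set vs \<subseteq> V"
proof
  fix v assume "v \<in> set vs"
  then obtain i where i: "i < length vs" "v = vs ! i" by (auto simp: in_set_conv_nth)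
  have "es ! i \<in> E" using assms(1) i(1) by (auto simp: ucycle_def)
  then show "v \<in> V" using ucycle_arc[OF assms(1) i(1)] assms(2) i(2) by auto
qed

lemma ucycle_card: "ucycle E vs es \<Longrightarrow> card (set es) = length vs \<and> card (set vs) = length vs"
  by (auto simp: ucycle_def distinct_card)

text \<open>Cutting paths at their first cycle vertex shows that no arc of the cycle is needed to
  reach the cycle. The arc count is right as well: a cycle has as many arcs as vertices, and so has
  the whole digraph.\<close>

lemma cycle_decompose:
  assumes V: "finite V" and E: "E \<in> unicycles V" and c: "ucycle E vs es"
  shows "E - set es \<in> forests (set vs) (V - set vs)" "set vs \<subseteq> V" "card E = card V"
proof -
  have cd: "conn_digraph V E" "card E \<le> card V" using E by (auto simp: unicycles_def)
  show eq: "card E = card V" using ucycle_card_eq[OF V cd c] .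
  show vs: "set vs \<subseteq> V" using ucycle_vertex[OF c] cd(1) by (auto simp: conn_digraph_def)
  have es: "set es \<subseteq> E" using c by (auto simp: ucycle_def)
  have "vs \<noteq> []" using c by (auto simp: ucycle_def)
  then have "spans (set vs) (V - set vs) E" by (intro conn_digraph_spans[OF V cd(1) vs]) simp
  then have "spans (set vs) (V - set vs) (E - set vs \<times> set vs)" by (rule spans_first_hit)
  moreover have "conn (E - set vs \<times> set vs) \<subseteq> conn (E - set es)"
    using ucycle_arcs_subset[OF c] by (intro conn_mono) auto
  ultimately have "spans (set vs) (V - set vs) (E - set es)" by (rule spans_conn_mono)
  moreover have "card (E - set es) = card (V - set vs)"
    using eq es vs ucycle_card[OF c] by (simp add: card_Diff_subset)
  ultimately show "E - set es \<in> forests (set vs) (V - set vs)"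
    using cd(1) vs unfolding forests_def conn_digraph_def by auto
qed

text \<open>Converse of \<open>cycle_decompose\<close>. \<open>C\<close> may be oriented
  arbitrarily, so this serves directed cycles as well as all orientations of an undirected
  one.\<close>

lemma cycle_compose:
  assumes V: "finite V" and vs: "set vs \<subseteq> V" and c: "ucycle C vs es" "set es = C"
    and P: "P \<in> forests (set vs) (V - set vs)"
  shows "C \<union> P \<in> unicycles V" "C \<inter> P = {}" "ucycle (C \<union> P) vs es"
proof -
  let ?B = "set vs"
  have fin: "finite (V - ?B)" "finite ?B" "?B \<inter> (V - ?B) = {}" using V by auto
  show disj: "C \<inter> P = {}"
    using forest_no_root_arcs[OF fin(2,1,3) P] ucycle_arcs_subset[OF c(1)] c(2) by auto
  have "vs \<noteq> []" using c by (auto simp: ucycle_def)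
  have Psub: "P \<subseteq> V \<times> V" "card P = card (V - ?B)" "spans ?B (V - ?B) P"
    using P vs by (auto simp: forests_def)
  have hit: "\<exists>b\<in>?B. (v, b) \<in> conn (C \<union> P)" if "v \<in> V" for v
  proof (cases "v \<in> ?B")
    case False
    then have "v \<in> V - ?B" using that by simp
    then obtain b where "b \<in> ?B" "(v, b) \<in> conn P" using Psub(3) unfolding spans_def by blast
    then show ?thesis using conn_mono[of P "C \<union> P"] by blast
  qed (auto intro: bexI[of _ v])
  have BB: "(b, b') \<in> conn (C \<union> P)" if "b \<in> ?B" "b' \<in> ?B" for b b'
    using ucycle_conn[OF c(1) that] c(2) conn_mono[of C "C \<union> P"] by blast
  have "(u, v) \<in> conn (C \<union> P)" if uv: "u \<in> V" "v \<in> V" for u v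
  proof -
    obtain b where b: "b \<in> ?B" "(u, b) \<in> conn (C \<union> P)" using hit[OF uv(1)] by blast
    obtain b' where b': "b' \<in> ?B" "(v, b') \<in> conn (C \<union> P)" using hit[OF uv(2)] by blast
    show ?thesis using conn_trans[OF conn_trans[OF b(2) BB[OF b(1) b'(1)]] conn_sym[OF b'(2)]] .
  qed
  moreover have "C \<subseteq> V \<times> V" using ucycle_arcs_subset[OF c(1)] c(2) vs by auto
  moreover have "V \<noteq> {}" using \<open>vs \<noteq> []\<close> vs by auto
  ultimately have "conn_digraph V (C \<union> P)" using Psub(1) by (auto simp: conn_digraph_def)
  moreover have "length vs \<le> card V" using ucycle_card[OF c(1)] card_mono[OF V vs] by simp
  then have "card (C \<union> P) = card V"
    using disj Psub(2) ucycle_card[OF c(1)] c(2) forest_finite[OF fin(2,1,3) P] vs V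
    by (subst card_Un_disjoint) (auto simp: card_Diff_subset card_mono)
  moreover have "irrefl (C \<union> P)"
    using ucycle_irrefl[OF c(1)] c(2) forest_no_loop[OF fin(2,1,3) P] by (auto simp: irrefl_def)
  ultimately show "C \<union> P \<in> unicycles V" by (simp add: unicycles_def)
  show "ucycle (C \<union> P) vs es" using c by (intro ucycle_mono[OF c(1)]) auto
qed

lemma dicycle_arc: "i < length vs \<Longrightarrow> (vs ! i, vs ! (Suc i mod length vs)) \<in> dicycle vs"
  unfolding dicycle_eq by blast

lemma dicycle_next:
  assumes "distinct vs" "i < length vs" "(vs ! i, y) \<in> dicycle vs"
  shows "y = vs ! (Suc i mod length vs)"
  using assms nth_eq_iff_index_eq unfolding dicycle_eq by fastforce

context
  fixes V :: "'a set" and E vs P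
  assumes V: "finite V" and E: "E \<in> unicycles V"
    and vs: "2 \<le> length vs" "distinct vs" "dicycle vs \<subseteq> E"
    and P_def: "P = E - dicycle vs"
begin

lemma unicycle_forest: "P \<in> forests (set vs) (V - set vs)" and cycle_in: "set vs \<subseteq> V"
  using cycle_decompose[OF V E dicycle_ucycle[OF vs]] by (simp_all add: P_def dicycle_def)

lemma fin_unicycle: "finite E" "finite P"
  using conn_digraph_finite[OF V] E by (auto simp: unicycles_def P_def)

lemma acyclic_forest_part: "acyclic P"
  by (rule forest_acyclic[OF _ _ _ unicycle_forest]) (use V in auto)

text \<open>Any directed cycle that survived would have the same arcs as the cycle \<open>vs\<close>
  by uniqueness, but one of these has been deleted.\<close>

lemma acyclic_remove_cycle_arc:
  assumes "e \<in> dicycle vs" shows "acyclic (E - {e})"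
proof (rule ccontr)
  assume a: "\<not> acyclic (E - {e})"
  have "irrefl (E - {e})" using E by (auto simp: unicycles_def irrefl_def)
  then obtain ws where ws: "2 \<le> length ws" "distinct ws" "dicycle ws \<subseteq> E - {e}"
    using not_acyclic_dicycle a by blast
  then have "dicycle ws \<subseteq> E" by blast
  then have "dicycle ws = dicycle vs"
    using ucycle_unique[OF V _ _ dicycle_ucycle[OF ws(1,2)] dicycle_ucycle[OF vs]] E
    by (simp add: unicycles_def dicycle_def)
  then show False using ws(3) assms by blast
qed

text \<open>\<open>E'\<close> will be \<open>E\<close> itself or \<open>E\<close> without one cycle
  arc. From a tree out-neighbour of a cycle vertex \<open>b\<close> there is no way back to the
  cycle inside \<open>P\<close>: another cycle vertex would connect two roots of the forest, and
  \<open>b\<close> would close a directed cycle. Hence \<open>P\<close> and \<open>E'\<close> have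
  the same arcs below \<open>y\<close>.\<close>

lemma color_below_cycle:
  assumes E': "P \<subseteq> E'" "E' \<subseteq> E" and K': "red_coloring E' K'" and b: "b \<in> set vs" "(b, y) \<in> P"
  shows "y \<in> red_set P \<longleftrightarrow> y \<in> K'"
proof -
  define S where "S = {z. (y, z) \<in> P\<^sup>*}"
  have S: "z \<notin> set vs" if "z \<in> S" for z
  proof
    assume z: "z \<in> set vs"
    have yz: "(y, z) \<in> P\<^sup>*" using that by (simp add: S_def)
    then have "(b, z) \<in> P\<^sup>*" using b(2) by (meson converse_rtrancl_into_rtrancl)
    moreover have "P\<^sup>* \<subseteq> conn P" unfolding conn_def by (intro rtrancl_mono) auto
    ultimately have "(b, z) \<in> conn P" by blast
    then have "b = z"
      using forest_roots_separated[OF _ _ _ unicycle_forest b(1) z] V by auto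
    then have "(b, b) \<in> P\<^sup>+" using b(2) yz by auto
    then show False using acyclic_forest_part by (auto simp: acyclic_def)
  qed
  have "y \<in> S" by (simp add: S_def)
  show ?thesis
  proof (rule red_coloring_agree[OF fin_unicycle(2) acyclic_forest_part red_coloring_red_set[OF fin_unicycle(2) acyclic_forest_part] K' _ _ \<open>y \<in> S\<close>])
    show "x \<in> S \<Longrightarrow> (x, y) \<in> P \<Longrightarrow> y \<in> S" for x y
      unfolding S_def by (auto intro: rtrancl_into_rtrancl)
    fix x z assume "x \<in> S"
    then have "x \<notin> set vs" by (rule S)
    then have "(x, z) \<notin> dicycle vs" unfolding dicycle_eq by auto
    then show "(x, z) \<in> P \<longleftrightarrow> (x, z) \<in> E'" using E' unfolding P_def by blast
  qed
qed

lemma red_set_root: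
  assumes E': "P \<subseteq> E'" "E' \<subseteq> E" and K': "red_coloring E' K'" and b: "b \<in> set vs"
  shows "b \<in> red_set P \<longleftrightarrow> (\<forall>y. (b, y) \<in> P \<longrightarrow> y \<notin> K')"
  using red_coloring_red_set[OF fin_unicycle(2) acyclic_forest_part] color_below_cycle[OF E' K' b]
  unfolding red_coloring_def by blast

text \<open>A root that is red on its own has only green tree out-neighbours, so its colour is
  decided by the successor on the cycle alone.\<close>

lemma cycle_color:
  assumes K': "red_coloring E' K'" and E': "P \<subseteq> E'" "E' \<subseteq> E" and i: "i < length vs"
    and a: "(vs ! i, vs ! (Suc i mod length vs)) \<in> E'" and red: "vs ! i \<in> red_set P"
  shows "vs ! i \<in> K' \<longleftrightarrow> vs ! (Suc i mod length vs) \<notin> K'"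
proof -
  have b: "vs ! i \<in> set vs" using i by simp
  have 1: "\<forall>y. (vs ! i, y) \<in> P \<longrightarrow> y \<notin> K'" using red_set_root[OF E' K' b] red by blast
  have "y = vs ! (Suc i mod length vs)" if "(vs ! i, y) \<in> E' - P" for y
    using dicycle_next[OF vs(2) i, of y] that E' P_def by blast
  then show ?thesis using 1 a K' unfolding red_coloring_def by blast
qed

text \<open>If every root is red on its own, colours must alternate around the cycle, which fails
  exactly for odd length. A root that is green on its own stays green whatever its cycle successor,
  so the cycle may be opened there, coloured, and closed again.\<close>

lemma no_coloring_iff:
  "(\<nexists>K. red_coloring E K) \<longleftrightarrow> odd (length vs) \<and> set vs \<subseteq> red_set P"
proof
  assume r: "odd (length vs) \<and> set vs \<subseteq> red_set P"
  show "\<nexists>K. red_coloring E K"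
  proof
    assume "\<exists>K. red_coloring E K"
    then obtain K where K: "red_coloring E K" by blast
    have st: "vs ! i \<in> K \<longleftrightarrow> vs ! (Suc i mod length vs) \<notin> K" if i: "i < length vs" for i
    proof (rule cycle_color[OF K _ _ i])
      show "P \<subseteq> E" by (simp add: P_def)
      show "(vs ! i, vs ! (Suc i mod length vs)) \<in> E" using vs(3) dicycle_arc[OF i] by blast
      show "vs ! i \<in> red_set P" using r i by (meson nth_mem subsetD)
    qed simp
    have "vs ! i \<in> K \<longleftrightarrow> (vs ! 0 \<in> K \<longleftrightarrow> even i)" if "i < length vs" for i
      using that
    proof (induction i)
      case (Suc i)
      then show ?case using st[of i] by auto
    qed simp
    moreover have "length vs - 1 < length vs" "Suc (length vs - 1) = length vs" using vs(1) by auto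
    ultimately show False using st[of "length vs - 1"] r by (metis even_Suc mod_self)
  qed
next
  assume none: "\<nexists>K. red_coloring E K"
  have red: "set vs \<subseteq> red_set P"
  proof
    fix b assume b: "b \<in> set vs"
    then obtain i where i: "i < length vs" "vs ! i = b" by (auto simp: in_set_conv_nth)
    let ?e = "(vs ! i, vs ! (Suc i mod length vs))"
    let ?E = "E - {?e}"
    have e: "?e \<in> dicycle vs" using i(1) by (rule dicycle_arc)
    then have sub: "P \<subseteq> ?E" "?E \<subseteq> E" unfolding P_def by auto
    obtain K where K: "red_coloring ?E K"
      using red_coloring_exists[OF _ acyclic_remove_cycle_arc[OF e]] fin_unicycle by auto
    show "b \<in> red_set P"
    proof (rule ccontr)
      assume "b \<notin> red_set P"
      then obtain y where y: "(b, y) \<in> P" "y \<in> K" using red_set_root[OF sub K b] by blast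
      \<comment> \<open>The red tree out-neighbour \<open>y\<close> keeps \<open>b\<close> green, so
        restoring the deleted arc disturbs nothing.\<close>
      have "red_coloring E K"
        unfolding red_coloring_def
      proof
        fix x
        have Kx: "x \<in> K \<longleftrightarrow> (\<forall>y. (x, y) \<in> ?E \<longrightarrow> y \<notin> K)" using K unfolding red_coloring_def by blast
        show "x \<in> K \<longleftrightarrow> (\<forall>y. (x, y) \<in> E \<longrightarrow> y \<notin> K)"
        proof (cases "x = b")
          case True
          then show ?thesis using y sub Kx by blast
        next
          case False
          then have "(x, y) \<in> ?E \<longleftrightarrow> (x, y) \<in> E" for y using i(2) by auto
          then show ?thesis using Kx by simp
        qed
      qed
      then show False using none by blast
    qed
  qed
  moreover have "odd (length vs)"
  proof
    assume ev: "even (length vs)"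
    define k where "k = length vs"
    have k: "2 \<le> k" "even k" using vs(1) ev by (auto simp: k_def)
    have k1: "k - 1 < length vs" "Suc (k - 1) mod length vs = 0" using k by (auto simp: k_def)
    \<comment> \<open>The cycle is opened at its closing arc. The last vertex then becomes red and,
      the length being even, the first one green, so the closing arc can be restored.\<close>
    let ?e = "(vs ! (k - 1), vs ! 0)"
    let ?E = "E - {?e}"
    have e: "?e \<in> dicycle vs" using dicycle_arc[OF k1(1)] k1(2) by simp
    then have sub: "P \<subseteq> ?E" "?E \<subseteq> E" unfolding P_def by auto
    obtain K where K: "red_coloring ?E K"
      using red_coloring_exists[OF _ acyclic_remove_cycle_arc[OF e]] fin_unicycle by auto
    have nth: "vs ! i = vs ! j \<longleftrightarrow> i = j" if "i < k" "j < k" for i j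
      using vs(2) that by (simp add: nth_eq_iff_index_eq k_def)
    have st: "vs ! i \<in> K \<longleftrightarrow> vs ! Suc i \<notin> K" if i: "Suc i < k" for i
    proof -
      have "(vs ! i, vs ! Suc i) \<in> dicycle vs" using dicycle_arc[of i vs] i by (simp add: k_def)
      then have "(vs ! i, vs ! (Suc i mod length vs)) \<in> ?E" using vs(3) nth[of i "k - 1"] i by (auto simp: k_def)
      moreover have "vs ! i \<in> red_set P" using red i by (auto simp: k_def)
      ultimately show ?thesis using cycle_color[OF K sub, of i] i by (simp add: k_def)
    qed
    have *: "vs ! i \<in> K \<longleftrightarrow> (vs ! 0 \<in> K \<longleftrightarrow> even i)" if "i < k" for i
      using that
    proof (induction i)
      case (Suc i)
      then show ?case using st[of i] by auto
    qed simp
    have lastP: "(vs ! (k - 1), y) \<in> P" if "(vs ! (k - 1), y) \<in> ?E" for y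
    proof (rule ccontr)
      assume "(vs ! (k - 1), y) \<notin> P"
      then have "(vs ! (k - 1), y) \<in> dicycle vs" using that P_def by blast
      then have "y = vs ! 0" using dicycle_next[OF vs(2) k1(1)] k1(2) by simp
      then show False using that by simp
    qed
    have "vs ! (k - 1) \<in> red_set P" using red k1(1) by auto
    then have "\<forall>y. (vs ! (k - 1), y) \<in> P \<longrightarrow> y \<notin> K" using red_set_root[OF sub K] k1(1) by auto
    then have last: "vs ! (k - 1) \<in> K" using lastP K unfolding red_coloring_def by blast
    have "odd (k - 1)" using k by simp
    then have first: "vs ! 0 \<notin> K" using *[of "k - 1"] last k(1) by auto
    have "red_coloring E K"
      unfolding red_coloring_def
    proof
      fix x
      have Kx: "x \<in> K \<longleftrightarrow> (\<forall>y. (x, y) \<in> ?E \<longrightarrow> y \<notin> K)" using K unfolding red_coloring_def by blast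
      show "x \<in> K \<longleftrightarrow> (\<forall>y. (x, y) \<in> E \<longrightarrow> y \<notin> K)" using Kx first by blast
    qed
    then show False using none by blast
  qed
  ultimately show "odd (length vs) \<and> set vs \<subseteq> red_set P" by blast
qed

end

lemma kernelless_has_dicycle:
  assumes "finite V" "E \<in> kernelless V"
  shows "\<exists>vs. 2 \<le> length vs \<and> distinct vs \<and> dicycle vs \<subseteq> E"
proof (rule not_acyclic_dicycle)
  have "conn_digraph V E" using assms by (auto simp: kernelless_def unicycles_def)
  then show "\<not> acyclic E" using assms red_coloring_exists[of E] conn_digraph_finite[of V E] by (auto simp: kernelless_def)
  show "irrefl E" using assms by (auto simp: kernelless_def unicycles_def)
qed

section \<open>Counting forests\<close>

text \<open>Inverse of removing a root: \<open>J1\<close> are to be the out-neighbours of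
  \<open>r\<close>, \<open>J2\<close> its in-neighbours. They are kept apart because only
  \<open>J1\<close> influences the colour of \<open>r\<close>.\<close>

definition graft :: "'a \<Rightarrow> 'a set \<Rightarrow> 'a set \<Rightarrow> ('a \<times> 'a) set \<Rightarrow> ('a \<times> 'a) set" where
  "graft r J1 J2 Q = Q \<union> {r} \<times> J1 \<union> J2 \<times> {r}"

definition outs :: "'a \<Rightarrow> ('a \<times> 'a) set \<Rightarrow> 'a set" where "outs r P = {y. (r, y) \<in> P}"
definition ins :: "'a \<Rightarrow> ('a \<times> 'a) set \<Rightarrow> 'a set" where "ins r P = {y. (y, r) \<in> P}"
definition cut_root :: "'a \<Rightarrow> ('a \<times> 'a) set \<Rightarrow> ('a \<times> 'a) set" where
  "cut_root r P = {e \<in> P. fst e \<noteq> r \<and> snd e \<noteq> r}"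

context
  fixes B M :: "'a set" and r
  assumes fin: "finite B" "finite M" and disj: "B \<inter> M = {}" and r: "r \<notin> B" "r \<notin> M"
begin

lemma root_props:
  assumes P: "P \<in> forests (insert r B) M"
  shows "outs r P \<subseteq> M" "ins r P \<subseteq> M" "outs r P \<inter> ins r P = {}"
    "graft r (outs r P) (ins r P) (cut_root r P) = P"
proof -
  have f: "finite (insert r B)" "finite M" "insert r B \<inter> M = {}" using fin disj r by auto
  have sub: "P \<subseteq> (insert r B \<union> M) \<times> (insert r B \<union> M)" using P by (simp add: forests_def)
  show "outs r P \<subseteq> M" "ins r P \<subseteq> M"
    using forest_no_root_arcs[OF f P] sub unfolding outs_def ins_def by blast+
  show "outs r P \<inter> ins r P = {}"
    using forest_no_two_cycle[OF f P] unfolding outs_def ins_def by blast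
  show "graft r (outs r P) (ins r P) (cut_root r P) = P"
    unfolding graft_def outs_def ins_def cut_root_def by auto
qed

lemma card_graft:
  assumes "finite Q" "finite J1" "finite J2" "r \<notin> J1" "r \<notin> J2" "\<And>e. e \<in> Q \<Longrightarrow> fst e \<noteq> r \<and> snd e \<noteq> r"
  shows "card (graft r J1 J2 Q) = card Q + card J1 + card J2"
proof -
  have d1: "Q \<inter> ({r} \<times> J1) = {}" "(Q \<union> {r} \<times> J1) \<inter> (J2 \<times> {r}) = {}" using assms by force+
  show ?thesis
    unfolding graft_def using d1 assms
    by (simp add: card_Un_disjoint card_cartesian_product)
qed

lemma graft_forest:
  assumes J: "J1 \<subseteq> M" "J2 \<subseteq> M" "J1 \<inter> J2 = {}"
    and Q: "Q \<in> forests (B \<union> J1 \<union> J2) (M - (J1 \<union> J2))"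
  shows "graft r J1 J2 Q \<in> forests (insert r B) M"
    "outs r (graft r J1 J2 Q) = J1" "ins r (graft r J1 J2 Q) = J2" "cut_root r (graft r J1 J2 Q) = Q"
proof -
  let ?P = "graft r J1 J2 Q"
  have QBM: "Q \<subseteq> (B \<union> M) \<times> (B \<union> M)" using Q J unfolding forests_def by auto
  then have Qr: "fst e \<noteq> r \<and> snd e \<noteq> r" if "e \<in> Q" for e using that r by auto
  have rJ: "r \<notin> J1" "r \<notin> J2" using J r by auto
  have finJ: "finite J1" "finite J2" using J fin by (auto intro: finite_subset)
  have finQ: "finite Q" using QBM fin by (auto intro: finite_subset[of _ "(B \<union> M) \<times> (B \<union> M)"])
  have "card (M - (J1 \<union> J2)) + card (J1 \<union> J2) = card M"
    using J fin by (metis Un_least card_Diff_subset card_mono finite_subset le_add_diff_inverse2)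
  then have "card ?P = card M"
    using card_graft[OF finQ finJ rJ Qr] Q J finJ by (simp add: forests_def card_Un_disjoint)
  moreover have "spans (insert r B) M ?P"
    unfolding spans_def
  proof
    fix x assume x: "x \<in> M"
    have jr: "(j, r) \<in> conn ?P" if "j \<in> J1 \<union> J2" for j
      using that arc_conn(2)[of r j ?P] arc_conn(1)[of j r ?P] unfolding graft_def by auto
    show "\<exists>b\<in>insert r B. (x, b) \<in> conn ?P"
    proof (cases "x \<in> J1 \<union> J2")
      case False
      then have "x \<in> M - (J1 \<union> J2)" using x by simp
      then obtain b where b: "b \<in> B \<union> J1 \<union> J2" "(x, b) \<in> conn Q"
        using Q unfolding forests_def spans_def by blast
      have xb: "(x, b) \<in> conn ?P" using b(2) conn_mono[of Q ?P] unfolding graft_def by blast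
      show ?thesis
      proof (cases "b \<in> B")
        case False
        then have "(b, r) \<in> conn ?P" using b(1) jr by blast
        then show ?thesis using conn_trans[OF xb] by blast
      qed (use xb in blast)
    qed (use jr in blast)
  qed
  ultimately show "?P \<in> forests (insert r B) M"
    using QBM J unfolding forests_def graft_def by auto
  show "outs r ?P = J1" "ins r ?P = J2"
    using rJ r QBM unfolding outs_def ins_def graft_def by auto
  show "cut_root r ?P = Q" using Qr unfolding cut_root_def graft_def by auto
qed

lemma cut_root_forest:
  assumes P: "P \<in> forests (insert r B) M"
  defines "J \<equiv> outs r P \<union> ins r P"
  shows "cut_root r P \<in> forests (B \<union> outs r P \<union> ins r P) (M - J)"
proof -
  let ?Q = "cut_root r P"
  note rp = root_props[OF P]
  have JM: "J \<subseteq> M" using rp by (auto simp: J_def)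
  have sub: "P \<subseteq> (insert r B \<union> M) \<times> (insert r B \<union> M)" "card P = card M" "spans (insert r B) M P"
    using P by (simp_all add: forests_def)
  have Qsub: "?Q \<subseteq> (B \<union> M) \<times> (B \<union> M)" using sub(1) unfolding cut_root_def by auto
  have finQ: "finite ?Q" using Qsub fin by (auto intro: finite_subset[of _ "(B \<union> M) \<times> (B \<union> M)"])
  have finJ: "finite (outs r P)" "finite (ins r P)" using rp fin by (auto intro: finite_subset)
  have rJ: "r \<notin> outs r P" "r \<notin> ins r P" using rp r by auto
  have "card M = card ?Q + card (outs r P) + card (ins r P)"
    using card_graft[OF finQ finJ rJ] rp(4) sub(2) by (auto simp: cut_root_def)
  then have "card M = card ?Q + card J"
    using finJ rp(3) by (simp add: J_def card_Un_disjoint)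
  then have "card ?Q = card (M - J)" using JM fin by (simp add: card_Diff_subset finite_subset)
  moreover have "spans (B \<union> J) (M - J) ?Q"
    unfolding spans_def
  proof
    fix x assume x: "x \<in> M - J"
    let ?B = "insert r (B \<union> J)"
    obtain b where "b \<in> insert r B" "(x, b) \<in> conn P" using sub(3) x unfolding spans_def by blast
    then obtain b' where b': "b' \<in> ?B" "(x, b') \<in> conn (P - ?B \<times> ?B)"
      using conn_first_hit[of x b P ?B] by blast
    \<comment> \<open>Every arc at \<open>r\<close> has its other end in \<open>J\<close> and so
      lies inside \<open>?B\<close>; after this restriction nothing touches
      \<open>r\<close>.\<close>
    have "P - ?B \<times> ?B \<subseteq> ?Q" unfolding cut_root_def J_def outs_def ins_def by auto
    then have c: "(x, b') \<in> conn ?Q" using b'(2) conn_mono by blast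
    have "b' \<in> - {r}" by (rule conn_closed[OF c]) (use x r in \<open>auto simp: cut_root_def\<close>)
    then show "\<exists>b\<in>B \<union> J. (x, b) \<in> conn ?Q" using b' c by blast
  qed
  ultimately show ?thesis
    using Qsub unfolding forests_def J_def by (auto simp: Un_assoc)
qed

text \<open>Vertices of \<open>J2\<close> gain the arc to \<open>r\<close>, so their colours may
  change; but what is reachable in \<open>Q\<close> from a root in \<open>B\<close> or
  \<open>J1\<close> stays in the tree of that root and meets neither \<open>r\<close> nor
  \<open>J2\<close>.\<close>

lemma graft_red_set:
  assumes J: "J1 \<subseteq> M" "J2 \<subseteq> M" "J1 \<inter> J2 = {}"
    and Q: "Q \<in> forests (B \<union> J1 \<union> J2) (M - (J1 \<union> J2))"
  defines "P \<equiv> graft r J1 J2 Q"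
  shows "x \<in> B \<union> J1 \<Longrightarrow> x \<in> red_set P \<longleftrightarrow> x \<in> red_set Q" "r \<in> red_set P \<longleftrightarrow> J1 \<inter> red_set Q = {}"
proof -
  note gf = graft_forest[OF J Q, folded P_def]
  have fP: "finite (insert r B)" "finite M" "insert r B \<inter> M = {}" using fin disj r by auto
  have fQ: "finite (B \<union> J1 \<union> J2)" "finite (M - (J1 \<union> J2))" "(B \<union> J1 \<union> J2) \<inter> (M - (J1 \<union> J2)) = {}"
    using fin disj J by (auto intro: finite_subset)
  note cP = red_coloring_red_set[OF forest_finite[OF fP gf(1)] forest_acyclic[OF fP gf(1)]]
  note cQ = red_coloring_red_set[OF forest_finite[OF fQ Q] forest_acyclic[OF fQ Q]]
  have QBM: "Q \<subseteq> (B \<union> M) \<times> (B \<union> M)" using Q J unfolding forests_def by auto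
  show *: "x \<in> red_set P \<longleftrightarrow> x \<in> red_set Q" if x: "x \<in> B \<union> J1" for x
  proof -
    define S where "S = {z. (x, z) \<in> Q\<^sup>*}"
    have S: "z \<noteq> r \<and> z \<notin> J2" if z: "z \<in> S" for z
    proof
      have xz: "(x, z) \<in> conn Q" using z rtrancl_mono[of Q "Q \<union> Q\<inverse>"] unfolding S_def conn_def by blast
      have "z \<in> - {r}" by (rule conn_closed[OF xz]) (use x r J QBM in auto)
      then show "z \<noteq> r" by simp
      show "z \<notin> J2"
        using forest_roots_separated[OF fQ Q _ _ xz] x J fin disj by auto
    qed
    have "x \<in> red_set Q \<longleftrightarrow> x \<in> red_set P"
    proof (rule red_coloring_agree[OF forest_finite[OF fQ Q] forest_acyclic[OF fQ Q] cQ cP])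
      show "x \<in> S" by (simp add: S_def)
      show "a \<in> S \<Longrightarrow> (a, b) \<in> Q \<Longrightarrow> b \<in> S" for a b
        unfolding S_def by (auto intro: rtrancl_into_rtrancl)
      show "a \<in> S \<Longrightarrow> (a, b) \<in> Q \<longleftrightarrow> (a, b) \<in> P" for a b
        using S[of a] unfolding P_def graft_def by auto
    qed
    then show ?thesis by blast
  qed
  have "r \<in> red_set P \<longleftrightarrow> (\<forall>y\<in>J1. y \<notin> red_set P)"
    using cP gf(2) unfolding red_coloring_def outs_def by blast
  then show "r \<in> red_set P \<longleftrightarrow> J1 \<inter> red_set Q = {}" using * by blast
qed

end

text \<open>\<open>F\<close> are free roots, \<open>R\<close> red and \<open>G\<close> green ones,
  colours referring to the forest by itself. All three kinds are needed because peeling off a red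
  root makes its out-neighbours green and leaves its in-neighbours free.\<close>

definition colored_forests :: "'a set \<Rightarrow> 'a set \<Rightarrow> 'a set \<Rightarrow> 'a set \<Rightarrow> ('a \<times> 'a) set set" where
  "colored_forests F R G M = {P \<in> forests (F \<union> R \<union> G) M. R \<subseteq> red_set P \<and> G \<inter> red_set P = {}}"

lemma finite_forests: "finite B \<Longrightarrow> finite M \<Longrightarrow> finite (forests B M)"
  by (rule finite_subset[of _ "Pow ((B \<union> M) \<times> (B \<union> M))"]) (auto simp: forests_def)

lemma finite_colored_forests: "finite F \<Longrightarrow> finite R \<Longrightarrow> finite G \<Longrightarrow> finite M \<Longrightarrow> finite (colored_forests F R G M)"
  unfolding colored_forests_def using finite_forests[of "F \<union> R \<union> G" M] by simp

text \<open>A forest splits into the set \<open>J\<close> of neighbours of the root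
  \<open>r\<close>, the set \<open>J1\<close> of out-neighbours among them, and the forest in which
  \<open>J\<close> has joined the roots. The property is kept abstract to serve the coloured and the
  plain count alike.\<close>

lemma peel_bij:
  assumes "finite B" "finite M" "B \<inter> M = {}" "r \<notin> B" "r \<notin> M"
    and \<Phi>: "\<And>J1 J2 Q. J1 \<subseteq> M \<Longrightarrow> J2 \<subseteq> M \<Longrightarrow> J1 \<inter> J2 = {} \<Longrightarrow>
      Q \<in> forests (B \<union> J1 \<union> J2) (M - (J1 \<union> J2)) \<Longrightarrow> \<Phi> (graft r J1 J2 Q) \<longleftrightarrow> \<Psi> J1 J2 Q"
  shows "card {P \<in> forests (insert r B) M. \<Phi> P} =
    (\<Sum>J\<in>Pow M. \<Sum>J1\<in>Pow J. card {Q \<in> forests (B \<union> J1 \<union> (J - J1)) (M - J). \<Psi> J1 (J - J1) Q})"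
proof -
  note a = assms(1-5)
  let ?S = "\<lambda>J J1. {Q \<in> forests (B \<union> J1 \<union> (J - J1)) (M - J). \<Psi> J1 (J - J1) Q}"
  let ?D = "SIGMA J:Pow M. SIGMA J1:Pow J. ?S J J1"
  let ?f = "\<lambda>P. (outs r P \<union> ins r P, outs r P, cut_root r P)"
  let ?g = "\<lambda>(J, J1, Q). graft r J1 (J - J1) Q"
  have finS: "finite (?S J J1)" if "J \<subseteq> M" "J1 \<subseteq> J" for J J1
  proof (rule finite_subset)
    show "?S J J1 \<subseteq> forests (B \<union> J1 \<union> (J - J1)) (M - J)" by blast
    have "finite J" using that(1) a(2) finite_subset by blast
    then show "finite (forests (B \<union> J1 \<union> (J - J1)) (M - J))"
      using a(1,2) that finite_subset[of J1 J] by (intro finite_forests) auto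
  qed
  have finP: "finite (Pow J)" if "J \<subseteq> M" for J using that a(2) finite_subset by auto
  have un: "J1 \<union> (J - J1) = J" if "J1 \<subseteq> J" for J1 J :: "'a set" using that by blast
  have "bij_betw ?f {P \<in> forests (insert r B) M. \<Phi> P} ?D"
  proof (rule bij_betwI[where g = ?g])
    show "?f \<in> {P \<in> forests (insert r B) M. \<Phi> P} \<rightarrow> ?D"
    proof
      fix P assume P: "P \<in> {P \<in> forests (insert r B) M. \<Phi> P}"
      note rp = root_props[OF a, of P] and cf = cut_root_forest[OF a, of P]
      have d: "outs r P \<union> ins r P - outs r P = ins r P" using rp(3) P by blast
      have "\<Psi> (outs r P) (ins r P) (cut_root r P)"
        using \<Phi>[OF rp(1-3) cf] rp(4) P by simp
      then show "?f P \<in> ?D" using rp cf P d by auto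
    qed
    show "?g \<in> ?D \<rightarrow> {P \<in> forests (insert r B) M. \<Phi> P}"
    proof
      fix t assume t: "t \<in> ?D"
      obtain J J1 Q where t': "t = (J, J1, Q)" by (cases t)
      have J: "J1 \<subseteq> M" "J - J1 \<subseteq> M" "J1 \<inter> (J - J1) = {}" and J1: "J1 \<subseteq> J" using t t' by auto
      have Q: "Q \<in> forests (B \<union> J1 \<union> (J - J1)) (M - (J1 \<union> (J - J1)))" "\<Psi> J1 (J - J1) Q"
        using t t' un[OF J1] by auto
      show "?g t \<in> {P \<in> forests (insert r B) M. \<Phi> P}"
        using graft_forest(1)[OF a J Q(1)] \<Phi>[OF J Q(1)] Q(2) t' by simp
    qed
    show "?g (?f P) = P" if "P \<in> {P \<in> forests (insert r B) M. \<Phi> P}" for P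
    proof -
      note rp = root_props[OF a, of P]
      have d: "outs r P \<union> ins r P - outs r P = ins r P" using rp(3) that by blast
      show ?thesis using rp(4) that by (simp add: d)
    qed
    show "?f (?g t) = t" if t: "t \<in> ?D" for t
    proof -
      obtain J J1 Q where t': "t = (J, J1, Q)" by (cases t)
      have J: "J1 \<subseteq> M" "J - J1 \<subseteq> M" "J1 \<inter> (J - J1) = {}" and J1: "J1 \<subseteq> J" using t t' by auto
      have Q: "Q \<in> forests (B \<union> J1 \<union> (J - J1)) (M - (J1 \<union> (J - J1)))"
        using t t' un[OF J1] by auto
      show ?thesis using graft_forest(2-4)[OF a J Q] t' un[OF J1] by simp
    qed
  qed
  then have "card {P \<in> forests (insert r B) M. \<Phi> P} = card ?D" by (rule bij_betw_same_card)
  also have "\<dots> = (\<Sum>J\<in>Pow M. card (SIGMA J1:Pow J. ?S J J1))"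
  proof (rule card_SigmaI)
    show "\<forall>J\<in>Pow M. finite (SIGMA J1:Pow J. ?S J J1)"
    proof
      fix J assume "J \<in> Pow M"
      then show "finite (SIGMA J1:Pow J. ?S J J1)"
        using finS finP by (intro finite_SigmaI) auto
    qed
  qed (use a in simp)
  also have "\<dots> = (\<Sum>J\<in>Pow M. \<Sum>J1\<in>Pow J. card (?S J J1))"
  proof (rule sum.cong[OF refl], rule card_SigmaI)
    fix J assume "J \<in> Pow M"
    then show "finite (Pow J)" "\<forall>J1\<in>Pow J. finite (?S J J1)" using finS finP by auto
  qed
  finally show ?thesis .
qed

lemma sum_Pow_card:
  fixes h :: "nat \<Rightarrow> 'b :: comm_semiring_1"
  assumes "finite M"
  shows "(\<Sum>J\<in>Pow M. h (card J)) = (\<Sum>j\<le>card M. of_nat (card M choose j) * h j)"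
proof -
  have "(\<Sum>J\<in>Pow M. h (card J)) = (\<Sum>j\<le>card M. \<Sum>J\<in>{J \<in> Pow M. card J = j}. h (card J))"
    using assms by (intro sum.group[symmetric]) (auto intro: card_mono)
  also have "\<dots> = (\<Sum>j\<le>card M. of_nat (card M choose j) * h j)"
  proof (rule sum.cong[OF refl])
    fix j assume "j \<in> {..card M}"
    have "(\<Sum>J\<in>{J \<in> Pow M. card J = j}. h (card J)) = (\<Sum>J\<in>{J \<in> Pow M. card J = j}. h j)"
      by (rule sum.cong) auto
    then show "(\<Sum>J\<in>{J \<in> Pow M. card J = j}. h (card J)) = of_nat (card M choose j) * h j"
      using n_subsets[OF assms, of j] by (simp add: Pow_def)
  qed
  finally show ?thesis .
qed

section \<open>Power series of rooted oriented trees\<close>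

abbreviation fexp :: "real fps \<Rightarrow> real fps" where
  "fexp a \<equiv> fps_exp 1 oo a"

lemma fexp_deriv: "a $ 0 = 0 \<Longrightarrow> fps_deriv (fexp a) = fexp a * fps_deriv a"
  by (simp add: fps_compose_deriv)

text \<open>The product exp(a + b) exp(-a) exp(-b) has derivative zero and constant term 1.\<close>

lemma fexp_add:
  assumes a: "a $ 0 = 0" and b: "b $ 0 = 0"
  shows "fexp (a + b) = fexp a * fexp b"
proof -
  have one: "f = 1" if "fps_deriv f = 0" "f $ 0 = 1" for f :: "real fps"
    using that by (metis fps_const_1_eq_1 fps_deriv_eq_0_iff)
  have ainv: "fexp (- c) * fexp c = 1" if c: "c $ 0 = 0" for c
  proof (rule one)
    show "fps_deriv (fexp (- c) * fexp c) = 0" using c by (simp add: fexp_deriv algebra_simps)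
  qed (simp add: fps_mult_nth)
  have "fexp (a + b) * fexp (- a) * fexp (- b) = 1"
  proof (rule one)
    show "fps_deriv (fexp (a + b) * fexp (- a) * fexp (- b)) = 0"
      using a b by (simp add: fexp_deriv algebra_simps)
  qed (simp add: fps_mult_nth)
  then have "fexp (a + b) * fexp (- a) * fexp (- b) * (fexp a * fexp b) = fexp a * fexp b" by simp
  moreover have "fexp (a + b) * fexp (- a) * fexp (- b) * (fexp a * fexp b)
     = fexp (a + b) * (fexp (- a) * fexp a) * (fexp (- b) * fexp b)"
    by (simp add: algebra_simps)
  ultimately show ?thesis using ainv[OF a] ainv[OF b] by simp
qed

lemma fps_exp_compose_eq: "a $ 0 = 0 \<Longrightarrow> fps_exp c oo a = fexp (fps_const c * a)"
proof -
  assume a: "a $ 0 = 0"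
  have "fps_exp c = fps_exp 1 oo (fps_const c * fps_X)" by simp
  then have "fps_exp c oo a = fexp ((fps_const c * fps_X) oo a)"
    using a by (simp add: fps_compose_assoc)
  also have "(fps_const c * fps_X) oo a = fps_const c * a"
    using a by (simp add: fps_compose_mult_distrib)
  finally show ?thesis .
qed

text \<open>\<open>fps_inv\<close> is the compositional inverse, so \<open>Tser\<close> solves T
  exp(-2T) = X; \<open>Rser\<close> is the Lambert function applied to it.\<close>

definition Tser :: "real fps" where "Tser = fps_inv (fps_X * fps_exp (- 2))"
definition Rser :: "real fps" where "Rser = fps_inv (fps_X * fps_exp 1) oo Tser"
text \<open>\<open>Yser\<close> and \<open>Xser\<close> turn out to be \<open>Tser\<close> and
  \<open>Rser\<close> divided by X: the root is not counted. Thus their k-th powers belong to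
  forests with k given roots, where only the remaining vertices carry the labelling.\<close>

definition Yser :: "real fps" where "Yser = fexp (Tser + Tser)"
definition Xser :: "real fps" where "Xser = fexp (Tser + Tser - Rser)"

lemma Tser_0 [simp]: "Tser $ 0 = 0" and Rser_0 [simp]: "Rser $ 0 = 0"
  by (simp_all add: Tser_def Rser_def fps_inv_def)

lemma Tser_eq: "Tser * fexp (- (Tser + Tser)) = fps_X"
proof -
  have "(fps_X * fps_exp (- 2)) oo Tser = fps_X"
    unfolding Tser_def by (rule fps_inv_right) simp_all
  moreover have "fps_const (- 2) * Tser = - (Tser + Tser)"
    by (rule fps_ext) (simp only: fps_mult_left_const_nth fps_neg_nth fps_add_nth; simp)
  ultimately show ?thesis
    using fps_exp_compose_eq[of Tser "- 2"] by (simp only: fps_compose_mult_distrib Tser_0 fps_X_fps_compose_startby0)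
qed

lemma Rser_eq: "Rser * fexp Rser = Tser"
proof -
  let ?w = "fps_inv (fps_X * fps_exp 1 :: real fps)"
  have w0: "?w $ 0 = 0" by (simp add: fps_inv_def)
  have "(fps_X * fps_exp 1) oo ?w = fps_X" by (rule fps_inv_right) simp_all
  then have "?w * fexp ?w = fps_X" using w0 by (simp add: fps_compose_mult_distrib)
  then have "(?w * fexp ?w) oo Tser = fps_X oo Tser" by simp
  then show ?thesis
    using w0 by (simp add: fps_compose_mult_distrib Rser_def fps_compose_assoc)
qed

lemma fexp_inverse: "a $ 0 = 0 \<Longrightarrow> fexp a * fexp (- a) = 1"
  using fexp_add[of a "- a"] by simp

lemma X_Yser: "fps_X * Yser = Tser"
proof -
  have "fexp (Tser + Tser) * fexp (- (Tser + Tser)) = 1" by (rule fexp_inverse) simp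
  then have "Tser * (fexp (- (Tser + Tser)) * Yser) = Tser" by (simp add: Yser_def mult.commute)
  then show ?thesis by (simp only: mult.assoc[symmetric] Tser_eq)
qed

lemma X_Xser: "fps_X * Xser = Rser"
proof -
  have "Xser = Yser * fexp (- Rser)"
    unfolding Xser_def Yser_def using fexp_add[of "Tser + Tser" "- Rser"] by simp
  then have "fps_X * Xser = Tser * fexp (- Rser)" by (simp only: X_Yser[symmetric] mult.assoc)
  also have "\<dots> = Rser * (fexp Rser * fexp (- Rser))" by (simp only: Rser_eq mult.assoc[symmetric])
  finally show ?thesis by (simp add: fexp_inverse)
qed

lemma Yser_eq: "Yser = fexp (fps_X * (Yser + Yser))"
  by (simp only: distrib_left X_Yser) (simp only: Yser_def)

lemma Xser_eq: "Xser = fexp (fps_X * (Yser - Xser + Yser))"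
proof -
  have "fps_X * (Yser - Xser + Yser) = Tser + Tser - Rser"
    by (simp add: distrib_left right_diff_distrib X_Yser X_Xser)
  then show ?thesis by (simp only: Xser_def)
qed

text \<open>As \<open>b\<close> has no constant term, the composition may be cut off at the same
  \<open>m\<close> in all lower coefficients; the interchange of sums is then a finite one.\<close>

lemma mult_compose_nth:
  fixes A a b :: "real fps"
  assumes "b $ 0 = 0"
  shows "(A * (a oo b)) $ m = (\<Sum>j\<le>m. a $ j * (A * b ^ j) $ m)"
proof -
  have e: "(a oo b) $ i = (\<Sum>j\<le>m. a $ j * (b ^ j) $ i)" if "i \<le> m" for i
  proof -
    have "(a oo b) $ i = (\<Sum>j\<le>i. a $ j * (b ^ j) $ i)"
      by (simp add: fps_compose_nth atLeast0AtMost)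
    also have "\<dots> = (\<Sum>j\<le>m. a $ j * (b ^ j) $ i)"
      using that assms by (intro sum.mono_neutral_left) (auto simp: startsby_zero_power_prefix)
    finally show ?thesis .
  qed
  have "(A * (a oo b)) $ m = (\<Sum>i\<le>m. \<Sum>j\<le>m. a $ j * (A $ i * (b ^ j) $ (m - i)))"
    by (simp add: fps_mult_nth atLeast0AtMost e sum_distrib_left mult.left_commute)
  also have "\<dots> = (\<Sum>j\<le>m. \<Sum>i\<le>m. a $ j * (A $ i * (b ^ j) $ (m - i)))"
    by (rule sum.swap)
  also have "\<dots> = (\<Sum>j\<le>m. a $ j * (A * b ^ j) $ m)"
    by (simp add: fps_mult_nth atLeast0AtMost sum_distrib_left)
  finally show ?thesis .
qed

lemma mult_fexp_nth:
  "V $ 0 = 0 \<Longrightarrow> (A * fexp V) $ m = (\<Sum>j\<le>m. (A * V ^ j) $ m / fact j)"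
  by (simp add: mult_compose_nth)

text \<open>The peeling recursion in terms of series: the binomial theorem merges \<open>Z1\<close>
  for out-neighbours and \<open>Z2\<close> for in-neighbours, each neighbour taken from
  \<open>M\<close> costs a factor X, and the choice of the set \<open>J\<close> produces the
  exponential.\<close>

lemma sum_Pow_fps:
  fixes A Z1 Z2 :: "real fps"
  assumes "finite M"
  shows "(\<Sum>J\<in>Pow M. \<Sum>J1\<in>Pow J. fact (card (M - J)) * (A * Z1 ^ card J1 * Z2 ^ card (J - J1)) $ card (M - J))
    = fact (card M) * (A * fexp (fps_X * (Z1 + Z2))) $ card M"
proof -
  let ?m = "card M"
  have "(\<Sum>J1\<in>Pow J. fact (card (M - J)) * (A * Z1 ^ card J1 * Z2 ^ card (J - J1)) $ card (M - J))
      = fact (?m - card J) * (A * (Z1 + Z2) ^ card J) $ (?m - card J)" if "J \<in> Pow M" for J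
  proof -
    have fJ: "finite J" using that assms finite_subset by auto
    have c: "card (M - J) = ?m - card J" using that fJ by (simp add: card_Diff_subset)
    have d: "card (J - J1) = card J - card J1" if "J1 \<in> Pow J" for J1
      using that fJ finite_subset[of J1 J] by (simp add: card_Diff_subset)
    have "(\<Sum>J1\<in>Pow J. A * Z1 ^ card J1 * Z2 ^ card (J - J1))
        = (\<Sum>J1\<in>Pow J. A * (Z1 ^ card J1 * Z2 ^ (card J - card J1)))"
      using d by (intro sum.cong) (auto simp: mult.assoc)
    also have "\<dots> = A * (Z1 + Z2) ^ card J"
      unfolding sum_distrib_left[symmetric] sum_Pow_card[OF fJ, of "\<lambda>i. Z1 ^ i * Z2 ^ (card J - i)"]
      by (simp add: binomial_ring mult.assoc)
    finally have "(\<Sum>J1\<in>Pow J. A * Z1 ^ card J1 * Z2 ^ card (J - J1)) $ (?m - card J)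
      = (A * (Z1 + Z2) ^ card J) $ (?m - card J)" by (rule arg_cong)
    then show ?thesis
      unfolding c sum_distrib_left[symmetric] fps_sum_nth by (rule arg_cong)
  qed
  then have "(\<Sum>J\<in>Pow M. \<Sum>J1\<in>Pow J. fact (card (M - J)) * (A * Z1 ^ card J1 * Z2 ^ card (J - J1)) $ card (M - J))
      = (\<Sum>J\<in>Pow M. fact (?m - card J) * (A * (Z1 + Z2) ^ card J) $ (?m - card J))"
    by (rule sum.cong[OF refl])
  also have "\<dots> = (\<Sum>j\<le>?m. real (?m choose j) * (fact (?m - j) * (A * (Z1 + Z2) ^ j) $ (?m - j)))"
    by (rule sum_Pow_card[OF assms])
  also have "\<dots> = (\<Sum>j\<le>?m. fact ?m * ((A * (fps_X * (Z1 + Z2)) ^ j) $ ?m / fact j))"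
  proof (rule sum.cong[OF refl])
    fix j assume j: "j \<in> {..?m}"
    have "A * (fps_X * (Z1 + Z2)) ^ j = fps_X ^ j * (A * (Z1 + Z2) ^ j)"
      by (simp only: power_mult_distrib mult.left_commute)
    then have "(A * (fps_X * (Z1 + Z2)) ^ j) $ ?m = (A * (Z1 + Z2) ^ j) $ (?m - j)"
      using j by (simp only: fps_X_power_mult_nth) simp
    then show "real (?m choose j) * (fact (?m - j) * (A * (Z1 + Z2) ^ j) $ (?m - j))
        = fact ?m * ((A * (fps_X * (Z1 + Z2)) ^ j) $ ?m / fact j)"
      using j by (simp add: binomial_fact field_simps)
  qed
  also have "\<dots> = fact ?m * (A * fexp (fps_X * (Z1 + Z2))) $ ?m"
    by (simp add: mult_fexp_nth sum_distrib_left)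
  finally show ?thesis .
qed

lemma forests_empty_roots: "finite M \<Longrightarrow> forests {} M = (if M = {} then {{}} else {})"
  unfolding forests_def spans_def by auto

text \<open>Green roots are traded for free minus red ones; red and free roots are peeled off,
  matching \<open>Xser_eq\<close> and \<open>Yser_eq\<close>. The outer induction runs over the
  total number of vertices, which drops by one with each peeled root.\<close>

lemma card_colored_forests:
  assumes "finite F" "finite R" "finite G" "finite M"
    "F \<inter> R = {}" "F \<inter> G = {}" "R \<inter> G = {}" "(F \<union> R \<union> G) \<inter> M = {}"
  shows "real (card (colored_forests F R G M)) =
    fact (card M) * (Yser ^ card F * Xser ^ card R * (Yser - Xser) ^ card G) $ card M"
  using assms
proof (induction "card M + card F + card R + card G" arbitrary: F R G M rule: less_induct)
  case less
  define N where "N = card M + card F + card R + card G"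
  have IH: "real (card (colored_forests F R G M)) =
      fact (card M) * (Yser ^ card F * Xser ^ card R * (Yser - Xser) ^ card G) $ card M"
    if "card M + card F + card R + card G < N" "finite F" "finite R" "finite G" "finite M"
      "F \<inter> R = {}" "F \<inter> G = {}" "R \<inter> G = {}" "(F \<union> R \<union> G) \<inter> M = {}" for F R G M :: "'a set"
    using less(1)[of M F R G] that unfolding N_def by blast
  have "real (card (colored_forests F R G M)) =
      fact (card M) * (Yser ^ card F * Xser ^ card R * (Yser - Xser) ^ card G) $ card M"
    if "card M + card F + card R + card G = N" "finite G" "finite F" "finite R" "finite M"
      "F \<inter> R = {}" "F \<inter> G = {}" "R \<inter> G = {}" "(F \<union> R \<union> G) \<inter> M = {}" for F R G M :: "'a set"
    using that(2,1,3-)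
  \<comment> \<open>Recolouring a green root does not change the number of vertices, hence a
    separate inner induction on \<open>G\<close>.\<close>
  proof (induction G arbitrary: F R rule: finite_induct)
    case (insert g G)
    have g: "g \<notin> F" "g \<notin> R" using insert by auto
    have cF: "card (insert g F) = Suc (card F)" and cR: "card (insert g R) = Suc (card R)"
      and cG: "card (insert g G) = Suc (card G)" using g insert by auto
    let ?A = "colored_forests (insert g F) R G M" and ?B = "colored_forests F (insert g R) G M"
    have fin: "finite ?A" using insert by (intro finite_colored_forests) auto
    have "?B \<subseteq> ?A" "colored_forests F R (insert g G) M = ?A - ?B"
      unfolding colored_forests_def by auto
    then have "real (card (colored_forests F R (insert g G) M)) = real (card ?A) - real (card ?B)"
      using fin by (simp add: card_Diff_subset finite_subset card_mono of_nat_diff)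
    also have "real (card ?A) = fact (card M) * (Yser ^ card (insert g F) * Xser ^ card R * (Yser - Xser) ^ card G) $ card M"
      by (rule insert.IH) (use insert.prems insert.hyps g cF cG in auto)
    also have "real (card ?B) = fact (card M) * (Yser ^ card F * Xser ^ card (insert g R) * (Yser - Xser) ^ card G) $ card M"
      by (rule insert.IH) (use insert.prems insert.hyps g cR cG in auto)
    finally show ?case
      unfolding cF cR cG by (simp add: algebra_simps flip: right_diff_distrib fps_sub_nth)
  next
    case empty
    show ?case
    proof (cases "R = {}")
      case False
      then obtain r where "r \<in> R" by blast
      define R' where "R' = R - {r}"
      have R: "R = insert r R'" "r \<notin> R'" using \<open>r \<in> R\<close> by (auto simp: R'_def)
      have fR': "finite R'" using empty R by auto
      let ?B = "F \<union> R'"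
      have a: "finite ?B" "finite M" "?B \<inter> M = {}" "r \<notin> ?B" "r \<notin> M"
        using empty R by auto
      have "card (colored_forests F R {} M) = card {P \<in> forests (insert r ?B) M. R \<subseteq> red_set P}"
        using R(1) unfolding colored_forests_def by (intro arg_cong[where f = card]) auto
      also have "\<dots> = (\<Sum>J\<in>Pow M. \<Sum>J1\<in>Pow J.
        card {Q \<in> forests (?B \<union> J1 \<union> (J - J1)) (M - J). R' \<subseteq> red_set Q \<and> J1 \<inter> red_set Q = {}})"
      proof (rule peel_bij[OF a, where \<Psi> = "\<lambda>J1 J2 Q. R' \<subseteq> red_set Q \<and> J1 \<inter> red_set Q = {}"])
        fix J1 J2 :: "'a set" and Q
        assume J: "J1 \<subseteq> M" "J2 \<subseteq> M" "J1 \<inter> J2 = {}" "Q \<in> forests (?B \<union> J1 \<union> J2) (M - (J1 \<union> J2))"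
        show "R \<subseteq> red_set (graft r J1 J2 Q) \<longleftrightarrow> R' \<subseteq> red_set Q \<and> J1 \<inter> red_set Q = {}"
          using graft_red_set[OF a J] unfolding R(1) by blast
      qed
      finally have "real (card (colored_forests F R {} M)) = (\<Sum>J\<in>Pow M. \<Sum>J1\<in>Pow J.
        real (card {Q \<in> forests (?B \<union> J1 \<union> (J - J1)) (M - J). R' \<subseteq> red_set Q \<and> J1 \<inter> red_set Q = {}}))"
        by simp
      also have "\<dots> = (\<Sum>J\<in>Pow M. \<Sum>J1\<in>Pow J. fact (card (M - J)) *
        (Yser ^ card F * Xser ^ card R' * (Yser - Xser) ^ card J1 * Yser ^ card (J - J1)) $ card (M - J))"
      proof (intro sum.cong refl)
        fix J J1 assume J: "J \<in> Pow M" "J1 \<in> Pow J"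
        have fJ: "finite J" "finite J1" using J empty.prems(4) finite_subset[of J M] finite_subset[of J1 M] by auto
        have cM: "card M = card (M - J) + card J" using J empty.prems fJ by (simp add: card_Diff_subset card_mono)
        have cJ: "card J = card J1 + card (J - J1)" using J fJ by (simp add: card_Diff_subset card_mono)
        have cF: "card (F \<union> (J - J1)) = card F + card (J - J1)"
          using empty.prems J fJ by (intro card_Un_disjoint) auto
        have cR: "card R = Suc (card R')" using R fR' by simp
        \<comment> \<open>Out-neighbours of the red root become green roots, in-neighbours free
          ones.\<close>
        have "{Q \<in> forests (?B \<union> J1 \<union> (J - J1)) (M - J). R' \<subseteq> red_set Q \<and> J1 \<inter> red_set Q = {}}
          = colored_forests (F \<union> (J - J1)) R' J1 (M - J)"
        proof -
          have "?B \<union> J1 \<union> (J - J1) = F \<union> (J - J1) \<union> R' \<union> J1" by blast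
          then show ?thesis unfolding colored_forests_def by simp
        qed
        also have "real (card \<dots>) = fact (card (M - J)) *
          (Yser ^ card (F \<union> (J - J1)) * Xser ^ card R' * (Yser - Xser) ^ card J1) $ card (M - J)"
        proof (rule IH)
          show "card (M - J) + card (F \<union> (J - J1)) + card R' + card J1 < N"
            using empty.prems(1) cM cJ cF cR by simp
        qed (use empty.prems J fJ R fR' in auto)
        finally show "real (card {Q \<in> forests (?B \<union> J1 \<union> (J - J1)) (M - J). R' \<subseteq> red_set Q \<and> J1 \<inter> red_set Q = {}}) =
          fact (card (M - J)) * (Yser ^ card F * Xser ^ card R' * (Yser - Xser) ^ card J1 * Yser ^ card (J - J1)) $ card (M - J)"
          unfolding cF power_add by (simp only: mult_ac)
      qed
      also have "\<dots> = fact (card M) * (Yser ^ card F * Xser ^ card R' * Xser) $ card M"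
        unfolding sum_Pow_fps[OF \<open>finite M\<close>] by (simp only: Xser_eq[symmetric])
      finally show ?thesis using R fR' by (simp add: mult_ac)
    next
      case R0: True
      show ?thesis
      proof (cases "F = {}")
        case True
        then show ?thesis using R0 empty.prems
          by (auto simp: colored_forests_def forests_empty_roots)
      next
        case False
        then obtain r where "r \<in> F" by blast
        define F' where "F' = F - {r}"
        have F: "F = insert r F'" "r \<notin> F'" using \<open>r \<in> F\<close> by (auto simp: F'_def)
        have fF': "finite F'" using empty F by auto
        have a: "finite F'" "finite M" "F' \<inter> M = {}" "r \<notin> F'" "r \<notin> M"
          using empty F by auto
        have "card (colored_forests F R {} M) = card {P \<in> forests (insert r F') M. True}"
          using F(1) R0 unfolding colored_forests_def by (intro arg_cong[where f = card]) auto
        also have "\<dots> = (\<Sum>J\<in>Pow M. \<Sum>J1\<in>Pow J.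
          card {Q \<in> forests (F' \<union> J1 \<union> (J - J1)) (M - J). True})"
          by (rule peel_bij[OF a]) simp
        finally have "real (card (colored_forests F R {} M)) = (\<Sum>J\<in>Pow M. \<Sum>J1\<in>Pow J.
          real (card {Q \<in> forests (F' \<union> J1 \<union> (J - J1)) (M - J). True}))"
          by simp
        also have "\<dots> = (\<Sum>J\<in>Pow M. \<Sum>J1\<in>Pow J. fact (card (M - J)) *
          (Yser ^ card F' * Yser ^ card J1 * Yser ^ card (J - J1)) $ card (M - J))"
        proof (intro sum.cong refl)
          fix J J1 assume J: "J \<in> Pow M" "J1 \<in> Pow J"
          have fJ: "finite J" "finite J1" using J empty.prems(4) finite_subset[of J M] finite_subset[of J1 M] by auto
          have cM: "card M = card (M - J) + card J" using J empty.prems fJ by (simp add: card_Diff_subset card_mono)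
          have cJ: "card J = card J1 + card (J - J1)" using J fJ by (simp add: card_Diff_subset card_mono)
          have cF: "card (F' \<union> J) = card F' + card J"
            using a J fJ by (intro card_Un_disjoint) auto
          have cF': "card F = Suc (card F')" using F fF' by simp
          have "{Q \<in> forests (F' \<union> J1 \<union> (J - J1)) (M - J). True} = colored_forests (F' \<union> J) {} {} (M - J)"
          proof -
            have "F' \<union> J1 \<union> (J - J1) = F' \<union> J" using J by blast
            then show ?thesis unfolding colored_forests_def by simp
          qed
          also have "real (card \<dots>) = fact (card (M - J)) *
            (Yser ^ card (F' \<union> J) * Xser ^ card ({} :: 'a set) * (Yser - Xser) ^ card ({} :: 'a set)) $ card (M - J)"
          proof (rule IH)
            show "card (M - J) + card (F' \<union> J) + card ({} :: 'a set) + card ({} :: 'a set) < N"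
              using empty.prems(1) cM cJ cF cF' R0 by simp
          qed (use empty.prems J fJ F fF' in auto)
          finally show "real (card {Q \<in> forests (F' \<union> J1 \<union> (J - J1)) (M - J). True}) =
            fact (card (M - J)) * (Yser ^ card F' * Yser ^ card J1 * Yser ^ card (J - J1)) $ card (M - J)"
            unfolding cF cJ power_add by (simp add: mult_ac)
        qed
        also have "\<dots> = fact (card M) * (Yser ^ card F' * Yser) $ card M"
          unfolding sum_Pow_fps[OF \<open>finite M\<close>] by (simp only: Yser_eq[symmetric])
        finally show ?thesis using F fF' R0 by (simp add: mult_ac)
      qed
    qed
  qed
  then show ?case using less.prems N_def by blast
qed

section \<open>Closed formulas for the numbers of forests\<close>

lemma card_forests_fps:
  assumes "finite B" "finite M" "B \<inter> M = {}"
  shows "real (card (forests B M)) = fact (card M) * (Yser ^ card B) $ card M"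
  using card_colored_forests[of B "{}" "{}" M] assms by (simp add: colored_forests_def)

lemma card_red_forests_fps:
  assumes "finite B" "finite M" "B \<inter> M = {}"
  shows "real (card {P \<in> forests B M. B \<subseteq> red_set P}) = fact (card M) * (Xser ^ card B) $ card M"
  using card_colored_forests[of "{}" B "{}" M] assms by (simp add: colored_forests_def)

text \<open>Two binomial sums, one of them by absorbing the factor j into the binomial coefficient.
  Multiplying by \<open>N + 1\<close> avoids the exponent m - 1.\<close>

lemma sum_binomial_linear:
  fixes N c :: real
  shows "(\<Sum>j\<le>m. real (m choose j) * ((c + real j) * N ^ (m - j))) * (N + 1) = (c * (N + 1) + real m) * (N + 1) ^ m"
proof -
  have 1: "(\<Sum>j\<le>m. real (m choose j) * N ^ (m - j)) = (N + 1) ^ m"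
    using binomial_ring[of 1 N m] by (simp add: add.commute)
  have 2: "(\<Sum>j\<le>m. real (m choose j) * real j * N ^ (m - j)) * (N + 1) = real m * (N + 1) ^ m"
  proof (cases m)
    case (Suc k)
    have "(\<Sum>j\<le>m. real (m choose j) * real j * N ^ (m - j))
        = (\<Sum>j\<le>k. real (Suc k choose Suc j) * real (Suc j) * N ^ (k - j))"
      unfolding Suc by (subst sum.atMost_Suc_shift) simp
    also have "\<dots> = (\<Sum>j\<le>k. real (Suc k) * (real (k choose j) * N ^ (k - j)))"
    proof (rule sum.cong[OF refl])
      fix j
      have "real (Suc k choose Suc j) * real (Suc j) = real (Suc k) * real (k choose j)"
        using Suc_times_binomial_eq[of k j] by (metis mult.commute of_nat_mult)
      then show "real (Suc k choose Suc j) * real (Suc j) * N ^ (k - j) = real (Suc k) * (real (k choose j) * N ^ (k - j))"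
        by simp
    qed
    also have "\<dots> = real (Suc k) * (N + 1) ^ k"
      using binomial_ring[of 1 N k] unfolding sum_distrib_left[symmetric] by (simp add: add.commute)
    finally show ?thesis using Suc by (simp add: mult_ac)
  qed simp
  have "(\<Sum>j\<le>m. real (m choose j) * ((c + real j) * N ^ (m - j)))
    = c * (\<Sum>j\<le>m. real (m choose j) * N ^ (m - j)) + (\<Sum>j\<le>m. real (m choose j) * real j * N ^ (m - j))"
    unfolding sum_distrib_left sum.distrib[symmetric] by (rule sum.cong) (auto simp: algebra_simps)
  then show ?thesis unfolding 1 using 2 by (simp add: algebra_simps)
qed

text \<open>Cayley's formula for forests on m + b vertices with b given roots, times 2^m for the
  orientations of the arcs; the extra factor m + b avoids the exponent m - 1. The induction removes
  one root.\<close>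

lemma Yser_power_nth:
  "fact m * (Yser ^ b) $ m * (real m + real b) = 2 ^ m * real b * (real m + real b) ^ m"
proof (induction "m + b" arbitrary: m b rule: less_induct)
  case less
  show ?case
  proof (cases b)
    case 0
    then show ?thesis by (cases m) auto
  next
    case (Suc c)
    define N where "N = real m + real c"
    have "Yser ^ b = Yser ^ c * fexp (fps_X * (Yser + Yser))"
      unfolding Suc power_Suc Yser_eq[symmetric] by (rule mult.commute)
    then have "fact m * (Yser ^ b) $ m = fact m * (Yser ^ c * fexp (fps_X * (Yser + Yser))) $ m"
      by simp
    also have "\<dots> = (\<Sum>j\<le>m. real (m choose j) * (fact (m - j) * 2 ^ j * (Yser ^ (c + j)) $ (m - j)))"
    proof -
      have t: "fact m * ((Yser ^ c * (fps_X * (Yser + Yser)) ^ j) $ m / fact j)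
        = real (m choose j) * (fact (m - j) * 2 ^ j * (Yser ^ (c + j)) $ (m - j))" if j: "j \<le> m" for j
      proof -
        have "Yser ^ c * (fps_X * (Yser + Yser)) ^ j = fps_X ^ j * (fps_const (2 ^ j) * Yser ^ (c + j))"
        proof -
          have "Yser + Yser = fps_const 2 * Yser"
            by (rule fps_ext) (simp only: fps_mult_left_const_nth fps_add_nth; simp)
          then show ?thesis
            by (simp only: power_mult_distrib power_add fps_const_power[symmetric] mult_ac)
        qed
        then have "(Yser ^ c * (fps_X * (Yser + Yser)) ^ j) $ m = 2 ^ j * (Yser ^ (c + j)) $ (m - j)"
          using j by (simp only: fps_X_power_mult_nth fps_mult_left_const_nth) simp
        then show ?thesis using j by (simp add: binomial_fact field_simps)
      qed
      have "(fps_X * (Yser + Yser)) $ 0 = 0" by simp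
      then show ?thesis unfolding mult_fexp_nth[OF \<open>(fps_X * (Yser + Yser)) $ 0 = 0\<close>] sum_distrib_left
        by (intro sum.cong refl t) simp
    qed
    finally have S: "fact m * (Yser ^ b) $ m
      = (\<Sum>j\<le>m. real (m choose j) * (fact (m - j) * 2 ^ j * (Yser ^ (c + j)) $ (m - j)))" .
    show ?thesis
    \<comment> \<open>The induction hypothesis determines the coefficients only up to the factor
      \<open>N\<close>, so \<open>N = 0\<close> is settled by hand.\<close>
    proof (cases "N = 0")
      case True
      then have "m = 0" "c = 0" by (auto simp: N_def)
      then show ?thesis using Suc by (simp add: Yser_def)
    next
      case False
      have IH: "fact (m - j) * (Yser ^ (c + j)) $ (m - j) * N = 2 ^ (m - j) * (real c + real j) * N ^ (m - j)"
        if "j \<le> m" for j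
      proof -
        have "real (m - j) + real (c + j) = N" using that by (simp add: N_def)
        then show ?thesis using less[of "m - j" "c + j"] that Suc by simp
      qed
      have "fact m * (Yser ^ b) $ m * N
        = (\<Sum>j\<le>m. 2 ^ m * (real (m choose j) * ((real c + real j) * N ^ (m - j))))"
        unfolding S sum_distrib_right
      proof (rule sum.cong[OF refl])
        fix j assume "j \<in> {..m}"
        then have j: "j \<le> m" by simp
        have "real (m choose j) * (fact (m - j) * 2 ^ j * (Yser ^ (c + j)) $ (m - j)) * N
          = real (m choose j) * 2 ^ j * (fact (m - j) * (Yser ^ (c + j)) $ (m - j) * N)" by simp
        also have "\<dots> = (2 ^ j * 2 ^ (m - j)) * (real (m choose j) * ((real c + real j) * N ^ (m - j)))"
          unfolding IH[OF j] by simp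
        also have "2 ^ j * 2 ^ (m - j) = (2 ^ m :: real)" using j by (simp flip: power_add)
        finally show "real (m choose j) * (fact (m - j) * 2 ^ j * (Yser ^ (c + j)) $ (m - j)) * N
          = 2 ^ m * (real (m choose j) * ((real c + real j) * N ^ (m - j)))" .
      qed
      then have "fact m * (Yser ^ b) $ m * N * (N + 1) = 2 ^ m * ((real c * (N + 1) + real m) * (N + 1) ^ m)"
        using sum_binomial_linear[of m "real c" N] by (simp flip: sum_distrib_left)
      \<comment> \<open>Since m = N - c, a factor \<open>N\<close> splits off, the one to be
        cancelled.\<close>
      also have "real c * (N + 1) + real m = N * (real c + 1)" by (simp add: N_def algebra_simps)
      finally have "N * (fact m * (Yser ^ b) $ m * (N + 1)) = N * (2 ^ m * (real c + 1) * (N + 1) ^ m)"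
        by (simp add: mult_ac)
      then have "fact m * (Yser ^ b) $ m * (N + 1) = 2 ^ m * (real c + 1) * (N + 1) ^ m"
        using False by simp
      then show ?thesis using Suc by (simp add: N_def add_ac)
    qed
  qed
qed

section \<open>Counting unicycle digraphs without kernel\<close>

definition distinct_lists :: "'a set \<Rightarrow> nat \<Rightarrow> 'a list set" where
  "distinct_lists V k = {vs. length vs = k \<and> distinct vs \<and> set vs \<subseteq> V}"

lemma finite_distinct_lists: "finite V \<Longrightarrow> finite (distinct_lists V k)"
  unfolding distinct_lists_def by (rule finite_subset[OF _ finite_lists_length_eq[of V k]]) auto

lemma card_distinct_lists:
  assumes "finite V" "k \<le> card V"
  shows "real (card (distinct_lists V k)) = fact (card V) / fact (card V - k)"
proof -
  have "card (distinct_lists V k) = \<Prod>{card V - k + 1..card V}"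
    unfolding distinct_lists_def using card_lists_distinct_length_eq[OF assms] .
  also have "\<dots> = fact (card V) div fact (card V - k)"
    by (simp add: fact_div_fact)
  finally show ?thesis
    by (simp add: real_of_nat_div fact_dvd)
qed

lemma dicycle_rotate1: "dicycle (rotate1 vs) = dicycle vs"
proof -
  have "zip (rotate1 vs) (rotate1 (rotate1 vs)) = rotate1 (zip vs (rotate1 vs))"
  proof (rule nth_equalityI)
    fix i assume "i < length (zip (rotate1 vs) (rotate1 (rotate1 vs)))"
    then have "i < length vs" "Suc i mod length vs < length vs" by (auto intro!: mod_less_divisor)
    then show "zip (rotate1 vs) (rotate1 (rotate1 vs)) ! i = rotate1 (zip vs (rotate1 vs)) ! i"
      by (simp add: nth_rotate1)
  qed simp
  then show ?thesis by (simp add: dicycle_def)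
qed

lemma dicycle_rotate: "dicycle (rotate i vs) = dicycle vs"
  by (induction i) (simp_all add: dicycle_rotate1)

lemma dicycle_card: "distinct vs \<Longrightarrow> card (dicycle vs) = length vs"
  unfolding dicycle_def by (simp add: distinct_card distinct_zipI1)

lemma dicycle_vertices: "fst ` dicycle vs = set vs"
  unfolding dicycle_def by (simp flip: set_map)

lemma dicycle_determined:
  assumes "distinct vs" "distinct ws" "dicycle vs = dicycle ws" "length vs = length ws" "hd vs = hd ws"
  shows "vs = ws"
proof (rule nth_equalityI)
  show "vs ! i = ws ! i" if "i < length vs" for i
    using that
  proof (induction i)
    case 0
    then show ?case using assms(4,5) by (metis hd_conv_nth list.size(3) not_less0)
  next
    case (Suc i)
    have "(vs ! i, vs ! Suc i) \<in> dicycle ws" using dicycle_arc[of i vs] Suc.prems assms(3) by simp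
    then show ?case
      using dicycle_next[OF assms(2), of i "vs ! Suc i"] Suc assms(4) by simp
  qed
qed (rule assms(4))

text \<open>The lists are the rotations of \<open>vs\<close>, told apart by their first
  element.\<close>

lemma card_dicycle_lists:
  assumes vs: "distinct vs" "vs \<noteq> []"
  shows "card {ws. distinct ws \<and> dicycle ws = dicycle vs} = length vs"
proof -
  let ?S = "{ws. distinct ws \<and> dicycle ws = dicycle vs}"
  have len: "length ws = length vs" if "ws \<in> ?S" for ws
    using that dicycle_card[of ws] dicycle_card[OF vs(1)] by simp
  have "bij_betw hd ?S (set vs)"
  proof (rule bij_betw_imageI)
    show "inj_on hd ?S"
      using len by (intro inj_onI dicycle_determined) auto
    show "hd ` ?S = set vs"
    proof
      show "hd ` ?S \<subseteq> set vs"
      proof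
        fix x assume "x \<in> hd ` ?S"
        then obtain ws where ws: "ws \<in> ?S" "x = hd ws" by blast
        then have "ws \<noteq> []" using len[OF ws(1)] vs(2) by auto
        then show "x \<in> set vs" using ws dicycle_vertices[of ws] dicycle_vertices[of vs] by auto
      qed
      show "set vs \<subseteq> hd ` ?S"
      proof
        fix x assume "x \<in> set vs"
        then obtain i where i: "i < length vs" "x = vs ! i" by (auto simp: in_set_conv_nth)
        have "hd (rotate i vs) = x" using i vs(2) by (simp add: hd_rotate_conv_nth)
        moreover have "rotate i vs \<in> ?S" using vs by (simp add: dicycle_rotate)
        ultimately show "x \<in> hd ` ?S" by blast
      qed
    qed
  qed
  then show ?thesis using vs(1) by (simp add: bij_betw_same_card distinct_card)
qed

definition kernelless_length :: "'a set \<Rightarrow> nat \<Rightarrow> ('a \<times> 'a) set set" where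
  "kernelless_length V k = {E \<in> kernelless V. \<exists>vs. length vs = k \<and> distinct vs \<and> dicycle vs \<subseteq> E}"

context
  fixes V :: "'a set"
  assumes V: "finite V"
begin

lemma unicycles_dicycle_unique:
  assumes "E \<in> unicycles V" "2 \<le> length vs" "distinct vs" "dicycle vs \<subseteq> E" "2 \<le> length ws" "distinct ws" "dicycle ws \<subseteq> E"
  shows "dicycle ws = dicycle vs"
  using ucycle_unique[OF V _ _ dicycle_ucycle[OF assms(5-7)] dicycle_ucycle[OF assms(2-4)]] assms(1)
  by (simp add: unicycles_def dicycle_def)

lemma finite_kernelless: "finite (kernelless V)"
  using finite_unicycles[OF V] by (simp add: kernelless_def)

lemma card_kernelless_sum: "card (kernelless V) = (\<Sum>k=2..card V. card (kernelless_length V k))"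
proof -
  have "kernelless V = (\<Union>k\<in>{2..card V}. kernelless_length V k)"
  proof
    show "kernelless V \<subseteq> (\<Union>k\<in>{2..card V}. kernelless_length V k)"
    proof
      fix E assume E: "E \<in> kernelless V"
      then obtain vs where vs: "2 \<le> length vs" "distinct vs" "dicycle vs \<subseteq> E"
        using kernelless_has_dicycle[OF V] by blast
      have "E \<in> unicycles V" using E by (simp add: kernelless_def)
      then have "set vs \<subseteq> V" using cycle_decompose(2)[OF V _ dicycle_ucycle[OF vs]] by simp
      then have "length vs \<le> card V" using vs(2) V card_mono distinct_card by metis
      then show "E \<in> (\<Union>k\<in>{2..card V}. kernelless_length V k)" using E vs unfolding kernelless_length_def by auto
    qed
  qed (auto simp: kernelless_length_def)
  then have "card (kernelless V) = card (\<Union>k\<in>{2..card V}. kernelless_length V k)" by simp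
  also have "\<dots> = (\<Sum>k=2..card V. card (kernelless_length V k))"
  proof (rule card_UN_disjoint)
    show "\<forall>k\<in>{2..card V}. finite (kernelless_length V k)" using finite_kernelless by (simp add: kernelless_length_def)
    show "\<forall>k\<in>{2..card V}. \<forall>l\<in>{2..card V}. k \<noteq> l \<longrightarrow> kernelless_length V k \<inter> kernelless_length V l = {}"
    proof (intro ballI impI equals0I)
      fix k l E assume kl: "k \<in> {2..card V}" "l \<in> {2..card V}" "k \<noteq> l" "E \<in> kernelless_length V k \<inter> kernelless_length V l"
      then obtain vs ws where v: "length vs = k" "distinct vs" "dicycle vs \<subseteq> E"
        and w: "length ws = l" "distinct ws" "dicycle ws \<subseteq> E" and E: "E \<in> unicycles V"
        unfolding kernelless_length_def kernelless_def by auto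
      have "dicycle ws = dicycle vs" using unicycles_dicycle_unique[OF E _ v(2,3) _ w(2,3)] v w kl by auto
      then show False using dicycle_card[OF v(2)] dicycle_card[OF w(2)] v w kl by simp
    qed
  qed simp
  finally show ?thesis .
qed

lemma card_kernelless_with_cycle:
  assumes vs: "vs \<in> distinct_lists V k" "2 \<le> k"
  shows "card {E \<in> kernelless V. dicycle vs \<subseteq> E} =
    (if odd k then card {P \<in> forests (set vs) (V - set vs). set vs \<subseteq> red_set P} else 0)"
proof -
  have v: "2 \<le> length vs" "distinct vs" "set vs \<subseteq> V" "length vs = k" using vs by (auto simp: distinct_lists_def)
  note u = dicycle_ucycle[OF v(1,2) order_refl]
  have in_kernelless: "E \<in> kernelless V \<longleftrightarrow> odd k \<and> set vs \<subseteq> red_set (E - dicycle vs)" if "E \<in> unicycles V" "dicycle vs \<subseteq> E" for E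
    using no_coloring_iff[OF V that(1) v(1,2) that(2) refl] that v(4) by (simp add: kernelless_def)
  let ?L = "{E \<in> kernelless V. dicycle vs \<subseteq> E}" and ?R = "{P \<in> forests (set vs) (V - set vs). set vs \<subseteq> red_set P}"
  show ?thesis
  proof (cases "odd k")
    case False
    then have "?L = {}" using in_kernelless by (auto simp: kernelless_def)
    then have "card ?L = 0" by (simp only: card.empty)
    then show ?thesis using False by simp
  next
    case True
    have "bij_betw (\<lambda>P. dicycle vs \<union> P) ?R ?L"
    proof (rule bij_betwI[where g = "\<lambda>E. E - dicycle vs"])
      have comp: "dicycle vs \<union> P \<in> unicycles V \<and> dicycle vs \<inter> P = {}" if "P \<in> ?R" for P
        using cycle_compose(1,2)[OF V v(3) u _, of P] that by (simp add: dicycle_def)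
      show "(\<lambda>P. dicycle vs \<union> P) \<in> ?R \<rightarrow> ?L"
      proof
        fix P assume P: "P \<in> ?R"
        have "dicycle vs \<union> P - dicycle vs = P" using comp[OF P] by blast
        then show "dicycle vs \<union> P \<in> ?L" using in_kernelless[of "dicycle vs \<union> P"] comp[OF P] P True by simp
      qed
      show "(\<lambda>E. E - dicycle vs) \<in> ?L \<rightarrow> ?R"
      proof
        fix E assume E: "E \<in> ?L"
        then have unicycles: "E \<in> unicycles V" by (simp add: kernelless_def)
        show "E - dicycle vs \<in> ?R"
          using in_kernelless[OF unicycles] E unicycle_forest[OF V unicycles v(1,2) _ refl] by simp
      qed
      show "dicycle vs \<union> P - dicycle vs = P" if "P \<in> ?R" for P using comp[OF that] by blast
    qed auto
    then show ?thesis using True by (simp add: bij_betw_same_card)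
  qed
qed

lemma card_cycle_lists:
  assumes "E \<in> kernelless_length V k" "2 \<le> k"
  shows "card {vs \<in> distinct_lists V k. dicycle vs \<subseteq> E} = k"
proof -
  obtain vs where vs: "length vs = k" "distinct vs" "dicycle vs \<subseteq> E" and E: "E \<in> unicycles V"
    using assms unfolding kernelless_length_def kernelless_def by auto
  have "{ws \<in> distinct_lists V k. dicycle ws \<subseteq> E} = {ws. distinct ws \<and> dicycle ws = dicycle vs}"
  proof (intro Collect_cong iffI)
    fix ws assume "ws \<in> distinct_lists V k \<and> dicycle ws \<subseteq> E"
    then show "distinct ws \<and> dicycle ws = dicycle vs"
      using unicycles_dicycle_unique[OF E _ vs(2,3)] vs(1) assms(2) by (simp add: distinct_lists_def)
  next
    fix ws assume ws: "distinct ws \<and> dicycle ws = dicycle vs"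
    have l: "length ws = k" using ws dicycle_card[of ws] dicycle_card[OF vs(2)] vs(1) by simp
    have "set ws \<subseteq> V"
      using cycle_decompose(2)[OF V E dicycle_ucycle, of ws] ws l assms(2) vs(3) by simp
    then show "ws \<in> distinct_lists V k \<and> dicycle ws \<subseteq> E" using ws l vs(3) by (simp add: distinct_lists_def)
  qed
  moreover have "vs \<noteq> []" using vs(1) assms(2) by auto
  ultimately show ?thesis using card_dicycle_lists[OF vs(2)] vs(1) by simp
qed

text \<open>Double counting of pairs of a digraph and a list that runs through its cycle: each
  digraph occurs k times, and for odd k each of the n!/(n-k)! lists contributes (n-k)! times a
  coefficient of \<open>Xser ^ k\<close>.\<close>

lemma card_kernelless_length:
  assumes k: "2 \<le> k" "k \<le> card V"
  shows "real (card (kernelless_length V k)) = (if odd k then fact (card V) * (Rser ^ k) $ card V / real k else 0)"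
proof -
  have fin: "finite (kernelless_length V k)" "finite (distinct_lists V k)" using finite_kernelless finite_distinct_lists[OF V] by (auto simp: kernelless_length_def)
  have "k * card (kernelless_length V k) = (\<Sum>E\<in>kernelless_length V k. card {vs \<in> distinct_lists V k. dicycle vs \<subseteq> E})"
    using card_cycle_lists k(1) by simp
  also have "\<dots> = (\<Sum>vs\<in>distinct_lists V k. card {E \<in> kernelless_length V k. dicycle vs \<subseteq> E})"
    using fin by (intro sum_multicount_gen) auto
  also have "\<dots> = (\<Sum>vs\<in>distinct_lists V k. card {E \<in> kernelless V. dicycle vs \<subseteq> E})"
    by (intro sum.cong refl arg_cong[where f = card]) (auto simp: kernelless_length_def distinct_lists_def)
  also have "\<dots> = (\<Sum>vs\<in>distinct_lists V k. if odd k then card {P \<in> forests (set vs) (V - set vs). set vs \<subseteq> red_set P} else 0)"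
    using card_kernelless_with_cycle k(1) by (intro sum.cong) auto
  finally have eq: "k * card (kernelless_length V k) = \<dots>" .
  have "real k * real (card (kernelless_length V k)) =
    (\<Sum>vs\<in>distinct_lists V k. if odd k then real (card {P \<in> forests (set vs) (V - set vs). set vs \<subseteq> red_set P}) else 0)"
    unfolding of_nat_mult[symmetric] eq of_nat_sum by (intro sum.cong refl) simp
  also have "\<dots> = (\<Sum>vs\<in>distinct_lists V k. if odd k then fact (card V - k) * (Xser ^ k) $ (card V - k) else 0)"
  proof (intro sum.cong refl)
    fix vs assume "vs \<in> distinct_lists V k"
    then have v: "distinct vs" "set vs \<subseteq> V" "length vs = k" by (auto simp: distinct_lists_def)
    then have "card (V - set vs) = card V - k" "card (set vs) = k"
      using V by (auto simp: card_Diff_subset distinct_card)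
    then show "(if odd k then real (card {P \<in> forests (set vs) (V - set vs). set vs \<subseteq> red_set P}) else 0)
      = (if odd k then fact (card V - k) * (Xser ^ k) $ (card V - k) else 0)"
      using card_red_forests_fps[of "set vs" "V - set vs"] V by simp
  qed
  also have "\<dots> = (if odd k then fact (card V) * (Xser ^ k) $ (card V - k) else 0)"
    using card_distinct_lists[OF V k(2)] by simp
  also have "(Xser ^ k) $ (card V - k) = (Rser ^ k) $ card V"
    using k(2) by (simp add: X_Xser[symmetric] power_mult_distrib fps_X_power_mult_nth)
  finally show ?thesis using k(1) by (auto simp: field_simps)
qed

lemma card_kernelless:
  "real (card (kernelless V)) = (\<Sum>k=2..card V. if odd k then fact (card V) * (Rser ^ k) $ card V / real k else 0)"
  unfolding card_kernelless_sum of_nat_sum by (intro sum.cong refl card_kernelless_length) auto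

end

section \<open>Counting unicycle digraphs\<close>

lemma ucycle_rotate1:
  assumes c: "ucycle E vs es" shows "ucycle E (rotate1 vs) (rotate1 es)"
proof -
  have l: "2 \<le> length vs" "length es = length vs" using c by (auto simp: ucycle_def)
  have "{fst (rotate1 es ! i), snd (rotate1 es ! i)} = {rotate1 vs ! i, rotate1 vs ! (Suc i mod length vs)}"
    if i: "i < length vs" for i
  proof -
    have s: "Suc i mod length vs < length vs" using i by (intro mod_less_divisor) linarith
    then have "{fst (es ! (Suc i mod length vs)), snd (es ! (Suc i mod length vs))}
        = {vs ! (Suc i mod length vs), vs ! (Suc (Suc i mod length vs) mod length vs)}"
      using c unfolding ucycle_def by blast
    then show ?thesis using i s l by (simp add: nth_rotate1)
  qed
  then show ?thesis using c unfolding ucycle_def by simp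
qed

lemma ucycle_rotate: "ucycle E vs es \<Longrightarrow> ucycle E (rotate i vs) (rotate i es)"
  by (induction i) (simp_all add: ucycle_rotate1)

text \<open>Reversal shifts arcs against vertices: the arc after position i of \<open>rev vs\<close>
  stands at position i + 1 of \<open>rev es\<close>, hence the additional rotation.\<close>

lemma ucycle_rev:
  assumes c: "ucycle E vs es" shows "ucycle E (rev vs) (rotate1 (rev es))"
proof -
  define k where "k = length vs"
  have l: "2 \<le> k" "length es = k" "length vs = k" using c by (auto simp: ucycle_def k_def)
  have arc: "{fst (es ! i), snd (es ! i)} = {vs ! i, vs ! (Suc i mod k)}" if "i < k" for i
    using c that unfolding ucycle_def k_def by blast
  have "{fst (rotate1 (rev es) ! i), snd (rotate1 (rev es) ! i)} = {rev vs ! i, rev vs ! (Suc i mod k)}"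
    if i: "i < k" for i
  proof (cases "Suc i = k")
    case True
    then have "i = k - 1" by simp
    then show ?thesis using l arc[of "k - 1"] by (simp add: nth_rotate1 rev_nth insert_commute)
  next
    case False
    then have i': "Suc i < k" using i by simp
    then have "Suc (k - Suc (Suc i)) = k - Suc i" by simp
    then show ?thesis using l i i' arc[of "k - Suc (Suc i)"]
      by (simp add: nth_rotate1 rev_nth insert_commute)
  qed
  then show ?thesis using c l unfolding ucycle_def by simp
qed

text \<open>Fails for length 2, where both edges join the same two vertices; this is why that length
  is treated apart.\<close>

lemma cycle_edge_inj:
  assumes "distinct vs" "3 \<le> length vs" "i < length vs" "j < length vs"
    "{vs ! i, vs ! (Suc i mod length vs)} = {vs ! j, vs ! (Suc j mod length vs)}"
  shows "i = j"
proof (rule ccontr)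
  assume ne: "i \<noteq> j"
  have s: "Suc i mod length vs < length vs" "Suc j mod length vs < length vs"
    using assms(3) by (auto intro!: mod_less_divisor)
  have "vs ! i \<noteq> vs ! j" using ne assms nth_eq_iff_index_eq by blast
  then have "vs ! i = vs ! (Suc j mod length vs)" "vs ! j = vs ! (Suc i mod length vs)"
    using assms(5) by (auto simp: doubleton_eq_iff)
  then have "i = Suc j mod length vs" "j = Suc i mod length vs"
    using assms(1,3,4) s nth_eq_iff_index_eq by metis+
  note ij = this
  show False
  proof (cases "Suc i = length vs")
    case True
    then have "j = 0" using ij(2) by simp
    then have "i = 1" using ij(1) assms(2) by simp
    then show False using True assms(2) by simp
  next
    case False
    then have j: "j = Suc i" using ij(2) assms(3) by simp
    show False
    proof (cases "Suc j = length vs")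
      case True
      then have "i = 0" using ij(1) by simp
      then show False using True j assms(2) by simp
    next
      case False
      then have "i = Suc j" using ij(1) assms(4) by simp
      then show False using j by simp
    qed
  qed
qed

lemma ucycle_arc_index:
  assumes c: "ucycle E vs es" and k: "3 \<le> length vs" and i: "i < length vs"
    and e: "(vs ! i, vs ! (Suc i mod length vs)) \<in> set es \<or> (vs ! (Suc i mod length vs), vs ! i) \<in> set es"
    (is "?a \<in> _ \<or> ?b \<in> _")
  shows "?a \<in> set es \<longleftrightarrow> es ! i = ?a" "?b \<in> set es \<longleftrightarrow> es ! i = ?b"
proof -
  have l: "length es = length vs" "distinct vs" using c by (auto simp: ucycle_def)
  have *: "es ! i = e" if e: "e \<in> set es" "{fst e, snd e} = {vs ! i, vs ! (Suc i mod length vs)}" for e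
  proof -
    obtain j where j: "j < length vs" "es ! j = e" using e(1) l(1) by (auto simp: in_set_conv_nth)
    have "{fst e, snd e} = {vs ! j, vs ! (Suc j mod length vs)}" using c j unfolding ucycle_def by blast
    then have "i = j" using cycle_edge_inj[OF l(2) k i j(1)] e(2) by simp
    then show ?thesis using j(2) by simp
  qed
  have "es ! i \<in> set es" using i l by simp
  then show "?a \<in> set es \<longleftrightarrow> es ! i = ?a" "?b \<in> set es \<longleftrightarrow> es ! i = ?b"
    using *[of ?a] *[of ?b] by auto
qed

text \<open>The first two vertices fix both the starting point and the direction; from then on each
  vertex is forced, because the only other edge of the cycle at the current vertex leads back to the
  previous one.\<close>

lemma ucycle_same_start:
  assumes c: "ucycle E vs es" "ucycle E ws fs" and eq: "set fs = set es" and k: "3 \<le> length vs" "length ws = length vs"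
    and start: "vs ! 0 = ws ! 0" "vs ! 1 = ws ! 1"
  shows "vs = ws"
proof -
  have d: "distinct vs" "distinct ws" using c by (auto simp: ucycle_def)
  have "i < length vs \<longrightarrow> vs ! i = ws ! i" for i
  proof (induction i rule: less_induct)
    case (less i)
    show ?case
    proof
      assume i: "i < length vs"
      show "vs ! i = ws ! i"
      proof (cases "i \<le> 1")
        case True
        then show ?thesis using start by (auto simp: le_Suc_eq)
      next
        case False
        then obtain j where j: "i = Suc (Suc j)" by (metis One_nat_def Suc_le_mono le0 not0_implies_Suc)
        have jj: "vs ! j = ws ! j" "vs ! Suc j = ws ! Suc j" using less[of j] less[of "Suc j"] i j by auto
        have "Suc j < length fs" using c(2) k(2) i j by (simp add: ucycle_def)
        then have "fs ! Suc j \<in> set es" using eq nth_mem by blast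
        then obtain l where l: "l < length vs" "es ! l = fs ! Suc j"
          using c(1) by (auto simp: in_set_conv_nth ucycle_def)
        have "{fst (fs ! Suc j), snd (fs ! Suc j)} = {ws ! Suc j, ws ! i}"
          using c(2) k(2) i j unfolding ucycle_def by (metis Suc_lessD mod_less)
        moreover have "{fst (es ! l), snd (es ! l)} = {vs ! l, vs ! (Suc l mod length vs)}"
          using c(1) l(1) unfolding ucycle_def by blast
        ultimately have e: "{vs ! l, vs ! (Suc l mod length vs)} = {vs ! Suc j, ws ! i}"
          using l(2) jj by simp
        have s: "Suc l mod length vs < length vs" using l(1) by (intro mod_less_divisor) linarith
        have "ws ! i \<noteq> ws ! j" using d(2) i j k(2) nth_eq_iff_index_eq[of ws i j] by simp
        consider "vs ! l = vs ! Suc j" "vs ! (Suc l mod length vs) = ws ! i"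
          | "vs ! l = ws ! i" "vs ! (Suc l mod length vs) = vs ! Suc j"
          using e by (auto simp: doubleton_eq_iff)
        then show ?thesis
        proof cases
          case 1
          then have "l = Suc j" using d(1) l(1) i j nth_eq_iff_index_eq[of vs l "Suc j"] by simp
          then show ?thesis using 1(2) i j by simp
        next
          \<comment> \<open>This edge would lead back to the vertex visited just before.\<close>
          case 2
          have "Suc l mod length vs = Suc j"
            using 2(2) d(1) s i j nth_eq_iff_index_eq[of vs "Suc l mod length vs" "Suc j"] by simp
          then have "l = j" using l(1) by (auto simp: mod_Suc split: if_splits)
          then show ?thesis using 2(1) jj(1) \<open>ws ! i \<noteq> ws ! j\<close> by simp
        qed
      qed
    qed
  qed
  then show ?thesis using k(2) by (intro nth_equalityI) auto
qed

text \<open>A traversal is determined by its first two vertices, which form an arc of the cycle or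
  the reverse of one. As a cycle of length k >= 3 contains no two opposite arcs, there are 2k such
  pairs.\<close>

lemma card_ucycle_lists:
  assumes V: "finite V" and E: "E \<in> unicycles V" and c: "ucycle E vs es" and k: "3 \<le> length vs"
  shows "card {ws. \<exists>fs. ucycle E ws fs} = 2 * length vs"
proof -
  let ?k = "length vs"
  let ?S = "{ws. \<exists>fs. ucycle E ws fs}"
  have E': "conn_digraph V E" "card E \<le> card V" using E by (auto simp: unicycles_def)
  have eq: "set fs = set es" "length ws = ?k" if "ucycle E ws fs" for ws fs
  proof -
    show "set fs = set es" using ucycle_unique[OF V E' that c] .
    then show "length ws = ?k" using ucycle_card[OF that] ucycle_card[OF c] by simp
  qed
  have l: "length es = ?k" "distinct es" "distinct vs" using c by (auto simp: ucycle_def)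
  define W where "W = set es \<union> (set es)\<inverse>"
  have anti: "(y, x) \<notin> set es" if xy: "(x, y) \<in> set es" for x y
  proof
    assume yx: "(y, x) \<in> set es"
    obtain i where i: "i < ?k" "es ! i = (x, y)" using xy l(1) by (metis in_set_conv_nth)
    let ?v = "vs ! i" and ?w = "vs ! (Suc i mod ?k)"
    have "(x, y) = (?v, ?w) \<or> (x, y) = (?w, ?v)" using ucycle_arc[OF c i(1)] unfolding i(2) .
    then have "x = ?v \<and> y = ?w \<or> x = ?w \<and> y = ?v" by blast
    then have "(y, x) = (x, y)"
    proof (elim disjE conjE)
      assume e: "x = ?v" "y = ?w"
      have "es ! i = (?w, ?v)" using ucycle_arc_index(2)[OF c k i(1)] yx xy unfolding e by blast
      then show "(y, x) = (x, y)" using i(2) unfolding e by (rule subst)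
    next
      assume e: "x = ?w" "y = ?v"
      have "es ! i = (?v, ?w)" using ucycle_arc_index(1)[OF c k i(1)] yx xy unfolding e by blast
      then show "(y, x) = (x, y)" using i(2) unfolding e by (rule subst)
    qed
    then have "(x, x) \<in> set es" using xy by blast
    then show False using ucycle_irrefl[OF c] by blast
  qed
  have "card W = card (set es) + card ((set es)\<inverse>)"
    unfolding W_def using anti by (intro card_Un_disjoint) auto
  then have cW: "card W = 2 * ?k" using l by (simp add: distinct_card)
  have "bij_betw (\<lambda>ws. (ws ! 0, ws ! 1)) ?S W"
  proof (rule bij_betw_imageI)
    show "inj_on (\<lambda>ws. (ws ! 0, ws ! 1)) ?S"
    proof (rule inj_onI)
      fix ws us assume a: "ws \<in> ?S" "us \<in> ?S" "(ws ! 0, ws ! 1) = (us ! 0, us ! 1)"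
      then obtain fs gs where f: "ucycle E ws fs" and g: "ucycle E us gs" by blast
      show "ws = us" using ucycle_same_start[OF f g] eq[OF f] eq[OF g] k a(3) by simp
    qed
    show "(\<lambda>ws. (ws ! 0, ws ! 1)) ` ?S = W"
    proof
      show "(\<lambda>ws. (ws ! 0, ws ! 1)) ` ?S \<subseteq> W"
      proof
        fix p assume "p \<in> (\<lambda>ws. (ws ! 0, ws ! 1)) ` ?S"
        then obtain ws fs where f: "ucycle E ws fs" "p = (ws ! 0, ws ! 1)" by blast
        have "0 < length ws" "Suc 0 mod length ws = 1" using eq(2)[OF f(1)] k by auto
        then have "fs ! 0 = (ws ! 0, ws ! 1) \<or> fs ! 0 = (ws ! 1, ws ! 0)"
          using ucycle_arc[OF f(1), of 0] by simp
        moreover have "fs ! 0 \<in> set es" using ucycle_nonempty[OF f(1)] eq(1)[OF f(1)] by blast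
        ultimately have "(ws ! 0, ws ! 1) \<in> set es \<or> (ws ! 1, ws ! 0) \<in> set es" by metis
        then show "p \<in> W" unfolding W_def f(2) by blast
      qed
      have rot: "\<exists>fs. ucycle E (rotate i us) fs" "rotate i us ! 0 = us ! i" "rotate i us ! 1 = us ! (Suc i mod ?k)"
        if "ucycle E us gs" "i < ?k" for us gs i
      proof -
        show "\<exists>fs. ucycle E (rotate i us) fs" using ucycle_rotate[OF that(1)] by blast
        have lu: "length us = ?k" using eq(2)[OF that(1)] .
        have "(0::nat) < ?k" "1 < ?k" using k by auto
        then show "rotate i us ! 0 = us ! i" "rotate i us ! 1 = us ! (Suc i mod ?k)"
          using lu that(2) nth_rotate[of 0 us i] nth_rotate[of 1 us i] by simp_all
      qed
      have start: "(vs ! i, vs ! (Suc i mod ?k)) \<in> (\<lambda>ws. (ws ! 0, ws ! 1)) ` ?S"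
          "(vs ! (Suc i mod ?k), vs ! i) \<in> (\<lambda>ws. (ws ! 0, ws ! 1)) ` ?S" if i: "i < ?k" for i
      proof -
        show "(vs ! i, vs ! (Suc i mod ?k)) \<in> (\<lambda>ws. (ws ! 0, ws ! 1)) ` ?S"
          using rot[OF c i] by (intro image_eqI[of _ _ "rotate i vs"]) auto
        note r = ucycle_rev[OF c]
        \<comment> \<open>The position of the successor of \<open>vs ! i\<close> in the reversed
          list, where the backward traversal starts.\<close>
        define j where "j = ?k - Suc (Suc i mod ?k)"
        have s: "Suc i mod ?k < ?k" using i by (intro mod_less_divisor) linarith
        have j: "j < ?k" using i by (simp add: j_def)
        have "rev vs ! j = vs ! (Suc i mod ?k)" using s j by (simp add: rev_nth j_def)
        moreover have "rev vs ! (Suc j mod ?k) = vs ! i"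
        proof (cases "Suc i = ?k")
          case True
          then have "Suc j = ?k" "i = ?k - 1" using k by (auto simp: j_def)
          moreover have "0 < ?k" using k by linarith
          ultimately show ?thesis by (simp add: rev_nth)
        next
          case False
          then have "Suc i < ?k" using i by simp
          then have "Suc j = ?k - Suc i" "Suc j < ?k" by (auto simp: j_def)
          then show ?thesis using i by (simp add: rev_nth)
        qed
        ultimately show "(vs ! (Suc i mod ?k), vs ! i) \<in> (\<lambda>ws. (ws ! 0, ws ! 1)) ` ?S"
          using rot[OF r j] by (intro image_eqI[of _ _ "rotate j (rev vs)"]) auto
      qed
      show "W \<subseteq> (\<lambda>ws. (ws ! 0, ws ! 1)) ` ?S"
      proof
        fix p assume "p \<in> W"
        then obtain i where i: "i < ?k" "p = es ! i \<or> p = (snd (es ! i), fst (es ! i))"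
          using l(1) by (auto simp: W_def in_set_conv_nth)
        then have "p = (vs ! i, vs ! (Suc i mod ?k)) \<or> p = (vs ! (Suc i mod ?k), vs ! i)"
          using ucycle_arc[OF c i(1)] by auto
        then show "p \<in> (\<lambda>ws. (ws ! 0, ws ! 1)) ` ?S" using start[OF i(1)] by auto
      qed
    qed
  qed
  then show ?thesis using cW by (simp add: bij_betw_same_card)
qed

text \<open>Parametrises the 2^k orientations of a cycle of length k by the set \<open>I\<close> of
  positions whose arc points forward.\<close>

definition orient :: "'a list \<Rightarrow> nat set \<Rightarrow> nat \<Rightarrow> 'a \<times> 'a" where
  "orient vs I i = (if i \<in> I then (vs ! i, vs ! (Suc i mod length vs)) else (vs ! (Suc i mod length vs), vs ! i))"

lemma orient_ucycle:
  assumes "distinct vs" "3 \<le> length vs"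
  shows "ucycle (orient vs I ` {..<length vs}) vs (map (orient vs I) [0..<length vs])"
proof -
  have s: "{fst (orient vs I i), snd (orient vs I i)} = {vs ! i, vs ! (Suc i mod length vs)}" for i
    by (auto simp: orient_def)
  have "inj_on (orient vs I) {0..<length vs}"
  proof (rule inj_onI)
    fix i j assume ij: "i \<in> {0..<length vs}" "j \<in> {0..<length vs}" "orient vs I i = orient vs I j"
    then have "{vs ! i, vs ! (Suc i mod length vs)} = {vs ! j, vs ! (Suc j mod length vs)}" using s by metis
    then show "i = j" using cycle_edge_inj[OF assms] ij by simp
  qed
  then show ?thesis using assms s unfolding ucycle_def by (simp add: distinct_map atLeast0LessThan)
qed

definition unicycles_length :: "'a set \<Rightarrow> nat \<Rightarrow> ('a \<times> 'a) set set" where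
  "unicycles_length V k = {E \<in> unicycles V. \<exists>vs es. ucycle E vs es \<and> length vs = k}"

context
  fixes V :: "'a set"
  assumes V: "finite V"
begin

text \<open>A digraph amounts to an orientation of every cycle edge and an attached forest. Since
  the forest has no arcs between roots, deleting all arcs inside \<open>set vs\<close> recovers it,
  and the arcs deleted are those of the cycle.\<close>

lemma card_unicycles_with_cycle:
  assumes vs: "vs \<in> distinct_lists V k" "3 \<le> k"
  shows "card {E \<in> unicycles V. \<exists>es. ucycle E vs es} = 2 ^ k * card (forests (set vs) (V - set vs))"
proof -
  have v: "3 \<le> length vs" "distinct vs" "set vs \<subseteq> V" "length vs = k" using vs by (auto simp: distinct_lists_def)
  let ?B = "set vs"
  let ?F = "forests ?B (V - ?B)"
  let ?C = "\<lambda>I. orient vs I ` {..<k}"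
  have f: "finite ?B" "finite (V - ?B)" "?B \<inter> (V - ?B) = {}" using V by auto
  note u = orient_ucycle[OF v(2,1), unfolded v(4)]
  have su: "set (map (orient vs I) [0..<k]) = ?C I" for I by (simp add: atLeast0LessThan)
  let ?L = "{E \<in> unicycles V. \<exists>es. ucycle E vs es}"
  let ?f = "\<lambda>(I, P). ?C I \<union> P" and ?g = "\<lambda>E. ({i. i < k \<and> (vs ! i, vs ! (Suc i mod k)) \<in> E}, E - ?B \<times> ?B)"
  have CB: "?C I \<subseteq> ?B \<times> ?B" for I using ucycle_arcs_subset[OF u] su by simp
  have PB: "P \<inter> ?B \<times> ?B = {}" if "P \<in> ?F" for P by (rule forest_no_root_arcs[OF f that])
  have "bij_betw ?f (Pow {..<k} \<times> ?F) ?L"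
  proof (rule bij_betwI[where g = ?g])
    show "?f \<in> Pow {..<k} \<times> ?F \<rightarrow> ?L"
    proof
      fix t assume t: "t \<in> Pow {..<k} \<times> ?F"
      obtain I P where t': "t = (I, P)" by (cases t)
      show "?f t \<in> ?L" using cycle_compose(1,3)[OF V v(3) u su, of P I] t t' by auto
    qed
    show "?g \<in> ?L \<rightarrow> Pow {..<k} \<times> ?F"
    proof
      fix E assume "E \<in> ?L"
      then obtain es where E: "E \<in> unicycles V" and c: "ucycle E vs es" by blast
      have P: "E - set es \<in> ?F" by (rule cycle_decompose(1)[OF V E c])
      have "E - ?B \<times> ?B = E - set es" using PB[OF P] ucycle_arcs_subset[OF c] by blast
      then show "?g E \<in> Pow {..<k} \<times> ?F" using P by auto
    qed
    show "?g (?f t) = t" if t: "t \<in> Pow {..<k} \<times> ?F" for t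
    proof -
      obtain I P where t': "t = (I, P)" by (cases t)
      have I: "I \<subseteq> {..<k}" and P: "P \<in> ?F" using t t' by auto
      have "?C I \<union> P - ?B \<times> ?B = P" using CB[of I] PB[OF P] by blast
      moreover have "(vs ! i, vs ! (Suc i mod k)) \<in> ?C I \<union> P \<longleftrightarrow> i \<in> I" if i: "i < k" for i
      proof -
        have "Suc i mod k < k" using i by (intro mod_less_divisor) linarith
        then have vB: "vs ! i \<in> ?B" "vs ! (Suc i mod k) \<in> ?B" using i v(4) by auto
        then have a: "(vs ! i, vs ! (Suc i mod k)) \<in> ?C I \<union> P \<longleftrightarrow> (vs ! i, vs ! (Suc i mod k)) \<in> ?C I"
          using PB[OF P] by blast
        have m: "orient vs I i \<in> ?C I" using i by simp
        have d: "(vs ! i, vs ! (Suc i mod k)) \<noteq> (vs ! (Suc i mod k), vs ! i)"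
        proof
          assume "(vs ! i, vs ! (Suc i mod k)) = (vs ! (Suc i mod k), vs ! i)"
          then have e: "vs ! (Suc i mod length vs) = vs ! i" using v(4) by blast
          have "orient vs I i = (vs ! i, vs ! i)" unfolding orient_def e by simp
          then show False using m ucycle_irrefl[OF u] su by metis
        qed
        show ?thesis
        proof (cases "i \<in> I")
          case True
          then show ?thesis using a m v(4) by (simp add: orient_def)
        next
          case False
          then have o: "orient vs I i = (vs ! (Suc i mod k), vs ! i)" using v(4) by (simp add: orient_def)
          have "(vs ! i, vs ! (Suc i mod k)) \<notin> ?C I"
          proof
            assume "(vs ! i, vs ! (Suc i mod k)) \<in> ?C I"
            then have "(vs ! i, vs ! (Suc i mod k)) \<in> set (map (orient vs I) [0..<k])" by (simp only: su)
            then have "map (orient vs I) [0..<k] ! i = (vs ! i, vs ! (Suc i mod k))"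
              using ucycle_arc_index(1)[OF u v(1)] v(4) i by simp
            then have "orient vs I i = (vs ! i, vs ! (Suc i mod k))" using i by simp
            then show False using o d by metis
          qed
          then show ?thesis using a False by blast
        qed
      qed
      then have "{i. i < k \<and> (vs ! i, vs ! (Suc i mod k)) \<in> ?C I \<union> P} = I" using I by auto
      ultimately show ?thesis using t' by simp
    qed
    show "?f (?g E) = E" if "E \<in> ?L" for E
    proof -
      obtain es where E: "E \<in> unicycles V" and c: "ucycle E vs es" using \<open>E \<in> ?L\<close> by blast
      have P: "E - set es \<in> ?F" by (rule cycle_decompose(1)[OF V E c])
      have EB: "E \<inter> ?B \<times> ?B = set es" using PB[OF P] ucycle_arcs_subset[OF c] c unfolding ucycle_def by blast
      let ?I = "{i. i < k \<and> (vs ! i, vs ! (Suc i mod k)) \<in> E}"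
      have l: "length es = k" using c v(4) by (simp add: ucycle_def)
      have "orient vs ?I i = es ! i" if i: "i < k" for i
      proof -
        have s: "Suc i mod k < k" using i by (intro mod_less_divisor) linarith
        then have vB: "vs ! i \<in> ?B" "vs ! (Suc i mod k) \<in> ?B" using i v(4) by auto
        have esi: "es ! i \<in> set es" using i l by simp
        have ar: "es ! i = (vs ! i, vs ! (Suc i mod k)) \<or> es ! i = (vs ! (Suc i mod k), vs ! i)"
          using ucycle_arc[OF c] i v(4) by simp
        show ?thesis
        proof (cases "i \<in> ?I")
          case True
          then have "(vs ! i, vs ! (Suc i mod k)) \<in> set es" using EB vB by blast
          then have "es ! i = (vs ! i, vs ! (Suc i mod k))"
            using ucycle_arc_index(1)[OF c v(1)] i v(4) by simp
          then show ?thesis using True v(4) by (simp add: orient_def)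
        next
          case False
          then have "(vs ! i, vs ! (Suc i mod k)) \<notin> set es" using EB i by blast
          then have e: "es ! i = (vs ! (Suc i mod k), vs ! i)" using ar esi by metis
          show ?thesis unfolding orient_def e if_not_P[OF False] v(4) ..
        qed
      qed
      then have "?C ?I = (\<lambda>i. es ! i) ` {..<k}" by (intro image_cong refl) auto
      also have "\<dots> = set es" using l by (auto simp: set_conv_nth)
      finally show ?thesis using EB by auto
    qed
  qed
  then have "card ?L = card (Pow {..<k} \<times> ?F)" by (simp add: bij_betw_same_card)
  then show ?thesis by (simp add: card_cartesian_product card_Pow)
qed

lemma unicycles_length_finite: "finite (unicycles_length V k)"
  using finite_unicycles[OF V] by (simp add: unicycles_length_def)

lemma ucycle_in_distinct_lists: "E \<in> unicycles V \<Longrightarrow> ucycle E vs es \<Longrightarrow> vs \<in> distinct_lists V (length vs)"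
  using cycle_decompose(2)[OF V] by (simp add: distinct_lists_def ucycle_def)

lemma unicycles_ucycle_length: "E \<in> unicycles V \<Longrightarrow> ucycle E vs es \<Longrightarrow> ucycle E ws fs \<Longrightarrow> length ws = length vs"
  using ucycle_unique[OF V] ucycle_card unfolding unicycles_def mem_Collect_eq by metis

lemma card_forests:
  assumes B: "B \<subseteq> V" "V \<noteq> {}"
  shows "real (card (forests B (V - B))) * real (card V) = 2 ^ (card V - card B) * real (card B) * real (card V) ^ (card V - card B)"
proof -
  have fin: "finite B" "finite (V - B)" using V B finite_subset by auto
  have c: "card (V - B) = card V - card B" "card B \<le> card V" using V B fin by (auto simp: card_Diff_subset card_mono)
  then have "real (card (V - B)) + real (card B) = real (card V)" by simp
  then show ?thesis
    using Yser_power_nth[of "card (V - B)" "card B"] card_forests_fps[OF fin] c by auto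
qed

text \<open>Double counting with 2k lists per digraph and 2^k orientations per list; the factor k of
  the forest formula cancels against the 2k, leaving a term of Ramanujan's function.\<close>

lemma card_unicycles_length:
  assumes k: "3 \<le> k" "k \<le> card V"
  shows "real (card (unicycles_length V k)) = 2 ^ (card V - 1) * real (card V) ^ (card V - 1) * (fact (card V) / fact (card V - k) / real (card V) ^ k)"
proof -
  let ?n = "card V"
  have n: "0 < ?n" using k by linarith
  then have Vne: "V \<noteq> {}" by auto
  have fin: "finite (unicycles_length V k)" "finite (distinct_lists V k)" using unicycles_length_finite finite_distinct_lists[OF V] by auto
  have lists: "card {vs \<in> distinct_lists V k. \<exists>es. ucycle E vs es} = 2 * k" if unicycles_length: "E \<in> unicycles_length V k" for E
  proof -
    obtain vs es where c: "ucycle E vs es" "length vs = k" and E: "E \<in> unicycles V" using unicycles_length by (auto simp: unicycles_length_def)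
    have "{vs \<in> distinct_lists V k. \<exists>es. ucycle E vs es} = {ws. \<exists>fs. ucycle E ws fs}"
      using ucycle_in_distinct_lists[OF E] unicycles_ucycle_length[OF E c(1)] c(2) by force
    then show ?thesis using card_ucycle_lists[OF V E c(1)] c(2) k by simp
  qed
  have "2 * k * card (unicycles_length V k) = (\<Sum>E\<in>unicycles_length V k. card {vs \<in> distinct_lists V k. \<exists>es. ucycle E vs es})"
    using lists by simp
  also have "\<dots> = (\<Sum>vs\<in>distinct_lists V k. card {E \<in> unicycles_length V k. \<exists>es. ucycle E vs es})"
    using fin by (intro sum_multicount_gen) auto
  also have "\<dots> = (\<Sum>vs\<in>distinct_lists V k. card {E \<in> unicycles V. \<exists>es. ucycle E vs es})"
    by (intro sum.cong refl arg_cong[where f = card]) (auto simp: unicycles_length_def distinct_lists_def)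
  also have "\<dots> = (\<Sum>vs\<in>distinct_lists V k. 2 ^ k * card (forests (set vs) (V - set vs)))"
    using card_unicycles_with_cycle k(1) by (intro sum.cong) auto
  finally have eq: "2 * k * card (unicycles_length V k) = \<dots>" .
  have "2 * real k * real (card (unicycles_length V k)) * real ?n =
    (\<Sum>vs\<in>distinct_lists V k. 2 ^ k * (real (card (forests (set vs) (V - set vs))) * real ?n))"
  proof -
    have "2 * real k * real (card (unicycles_length V k)) = real (2 * k * card (unicycles_length V k))" by simp
    also have "\<dots> = (\<Sum>vs\<in>distinct_lists V k. 2 ^ k * real (card (forests (set vs) (V - set vs))))"
      unfolding eq of_nat_sum by simp
    finally show ?thesis by (simp only: sum_distrib_right mult.assoc)
  qed
  also have "\<dots> = (\<Sum>vs\<in>distinct_lists V k. 2 ^ ?n * real k * real ?n ^ (?n - k))"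
  proof (intro sum.cong refl)
    fix vs assume "vs \<in> distinct_lists V k"
    then have v: "set vs \<subseteq> V" "card (set vs) = k" by (auto simp: distinct_lists_def distinct_card)
    have "2 ^ k * 2 ^ (?n - k) = (2 ^ ?n :: real)" using k(2) by (simp flip: power_add)
    then show "2 ^ k * (real (card (forests (set vs) (V - set vs))) * real ?n) = 2 ^ ?n * real k * real ?n ^ (?n - k)"
      unfolding card_forests[OF v(1) Vne] v(2) by (simp add: mult.assoc[symmetric])
  qed
  also have "\<dots> = (fact ?n / fact (?n - k)) * (2 ^ ?n * real k * real ?n ^ (?n - k))"
    using card_distinct_lists[OF V k(2)] by simp
  finally have a: "2 * real k * real (card (unicycles_length V k)) * real ?n = (fact ?n / fact (?n - k)) * (2 ^ ?n * real k * real ?n ^ (?n - k))" .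
  have b: "real ?n ^ (?n - k) * real ?n ^ k = real ?n ^ (?n - 1) * real ?n"
    using k(2) n by (simp flip: power_add power_Suc2)
  have c: "(2::real) ^ ?n = 2 * 2 ^ (?n - 1)" using n by (simp flip: power_Suc)
  have p: "real k > 0" "real ?n > 0" using k n by auto
  have "2 * real k * real ?n * (real (card (unicycles_length V k)) * real ?n ^ k)
    = (2 * real k * real (card (unicycles_length V k)) * real ?n) * real ?n ^ k" by simp
  also have "\<dots> = (fact ?n / fact (?n - k)) * (2 ^ ?n * real k) * (real ?n ^ (?n - k) * real ?n ^ k)"
    unfolding a by simp
  also have "\<dots> = 2 * real k * real ?n * (fact ?n / fact (?n - k) * 2 ^ (?n - 1) * real ?n ^ (?n - 1))"
    unfolding b c by simp
  finally have "2 * real k * real ?n * (real (card (unicycles_length V k)) * real ?n ^ k)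
    = 2 * real k * real ?n * (fact ?n / fact (?n - k) * 2 ^ (?n - 1) * real ?n ^ (?n - 1))" .
  moreover have "2 * real k * real ?n \<noteq> 0" using p by simp
  ultimately have "real (card (unicycles_length V k)) * real ?n ^ k = fact ?n / fact (?n - k) * 2 ^ (?n - 1) * real ?n ^ (?n - 1)"
    using mult_left_cancel by blast
  then show ?thesis using p by (simp add: field_simps)
qed

lemma card_unicycles_sum:
  "card (unicycles V) = card {E \<in> unicycles V. \<nexists>vs es. ucycle E vs es} + (\<Sum>k=2..card V. card (unicycles_length V k))"
proof -
  let ?T = "{E \<in> unicycles V. \<nexists>vs es. ucycle E vs es}"
  have "unicycles V = ?T \<union> (\<Union>k\<in>{2..card V}. unicycles_length V k)"
  proof
    show "unicycles V \<subseteq> ?T \<union> (\<Union>k\<in>{2..card V}. unicycles_length V k)"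
    proof
      fix E assume E: "E \<in> unicycles V"
      show "E \<in> ?T \<union> (\<Union>k\<in>{2..card V}. unicycles_length V k)"
      proof (cases "\<exists>vs es. ucycle E vs es")
        case True
        then obtain vs es where c: "ucycle E vs es" by blast
        have "set vs \<subseteq> V" "distinct vs" "2 \<le> length vs" using ucycle_in_distinct_lists[OF E c] c by (auto simp: distinct_lists_def ucycle_def)
        then have "length vs \<le> card V" "2 \<le> length vs" using V card_mono distinct_card by metis+
        then have "E \<in> unicycles_length V (length vs)" using c E by (auto simp: unicycles_length_def)
        then show ?thesis using \<open>length vs \<le> card V\<close> \<open>2 \<le> length vs\<close> by auto
      qed (use E in blast)
    qed
  qed (auto simp: unicycles_length_def)
  then have "card (unicycles V) = card (?T \<union> (\<Union>k\<in>{2..card V}. unicycles_length V k))" by simp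
  also have "\<dots> = card ?T + card (\<Union>k\<in>{2..card V}. unicycles_length V k)"
    using finite_unicycles[OF V] unicycles_length_finite by (intro card_Un_disjoint) (auto simp: unicycles_length_def)
  also have "card (\<Union>k\<in>{2..card V}. unicycles_length V k) = (\<Sum>k=2..card V. card (unicycles_length V k))"
  proof (rule card_UN_disjoint)
    show "\<forall>k\<in>{2..card V}. \<forall>l\<in>{2..card V}. k \<noteq> l \<longrightarrow> unicycles_length V k \<inter> unicycles_length V l = {}"
      using unicycles_ucycle_length unfolding unicycles_length_def by blast
  qed (use unicycles_length_finite in auto)
  finally show ?thesis .
qed

text \<open>With any fixed vertex as root, a tree is a forest. The true number is smaller by a
  factor n, but 2^(n-1) n^(n-1) is already negligible against the total, which carries an additional
  factor of order sqrt n.\<close>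

lemma card_trees_le:
  assumes "V \<noteq> {}"
  shows "real (card {E \<in> unicycles V. \<nexists>vs es. ucycle E vs es}) \<le> 2 ^ (card V - 1) * real (card V) ^ (card V - 1)"
proof -
  let ?n = "card V"
  have n: "0 < ?n" using assms V by (simp add: card_gt_0_iff)
  obtain r where r: "r \<in> V" using assms by blast
  have "{E \<in> unicycles V. \<nexists>vs es. ucycle E vs es} \<subseteq> forests {r} (V - {r})"
  proof
    fix E assume E: "E \<in> {E \<in> unicycles V. \<nexists>vs es. ucycle E vs es}"
    then have u: "irrefl E" "conn_digraph V E" "card E \<le> ?n" by (auto simp: unicycles_def)
    have "card E \<noteq> ?n" using ucycle_exists_if_card[OF V u(2,1)] E by blast
    moreover have "?n \<le> Suc (card E)" using card_conn[OF V u(2)] by blast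
    ultimately have "card E = card (V - {r})" using u(3) r V by simp
    moreover have "spans {r} (V - {r}) E" using conn_digraph_spans[OF V u(2), of "{r}"] r by simp
    ultimately show "E \<in> forests {r} (V - {r})"
      using u(2) r by (auto simp: forests_def conn_digraph_def insert_absorb)
  qed
  then have "card {E \<in> unicycles V. \<nexists>vs es. ucycle E vs es} \<le> card (forests {r} (V - {r}))"
    using finite_forests[of "{r}" "V - {r}"] V by (intro card_mono) auto
  then have "real (card {E \<in> unicycles V. \<nexists>vs es. ucycle E vs es}) * 1 \<le> real (card (forests {r} (V - {r}))) * real ?n"
    using n by (intro mult_mono) auto
  then show ?thesis using card_forests[of "{r}"] r assms by simp
qed

text \<open>Two opposite arcs leave no choice of orientation, so the formula for longer cycles does
  not carry over. An upper bound suffices, and it may count each digraph twice, once per order of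
  the two vertices.\<close>

lemma card_two_cycles_le:
  assumes "2 \<le> card V"
  shows "real (card (unicycles_length V 2)) \<le> 2 ^ (card V - 1) * real (card V) ^ (card V - 1)"
proof -
  let ?n = "card V"
  have Vne: "V \<noteq> {}" using assms by auto
  let ?S = "SIGMA vs:distinct_lists V 2. forests (set vs) (V - set vs)"
  have finF: "finite (forests (set vs) (V - set vs))" for vs
    using V by (intro finite_forests) auto
  have "unicycles_length V 2 \<subseteq> (\<lambda>(vs, P). dicycle vs \<union> P) ` ?S"
  proof
    fix E assume "E \<in> unicycles_length V 2"
    then obtain vs es where E: "E \<in> unicycles V" and c: "ucycle E vs es" and l: "length vs = 2" by (auto simp: unicycles_length_def)
    have v: "vs \<in> distinct_lists V 2" using ucycle_in_distinct_lists[OF E c] l by simp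
    have le: "length es = 2" "distinct es" using c l by (auto simp: ucycle_def)
    have e0: "es ! 0 = (vs ! 0, vs ! 1) \<or> es ! 0 = (vs ! 1, vs ! 0)" using ucycle_arc[OF c, of 0] l by simp
    have e1: "es ! 1 = (vs ! 1, vs ! 0) \<or> es ! 1 = (vs ! 0, vs ! 1)" using ucycle_arc[OF c, of 1] l by simp
    have ne: "es ! 0 \<noteq> es ! 1" using le nth_eq_iff_index_eq[of es 0 1] by simp
    have "set es = {es ! 0, es ! 1}" using le by (auto simp: set_conv_nth less_2_cases_iff)
    also have "\<dots> = {(vs ! 0, vs ! 1), (vs ! 1, vs ! 0)}" using e0 e1 ne by auto
    also have "\<dots> = dicycle vs" unfolding dicycle_eq using l by (auto simp: less_2_cases_iff)
    finally have "set es = dicycle vs" .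
    then have "E - dicycle vs \<in> forests (set vs) (V - set vs)" "dicycle vs \<subseteq> E"
      using cycle_decompose(1)[OF V E c] c by (auto simp: ucycle_def)
    then show "E \<in> (\<lambda>(vs, P). dicycle vs \<union> P) ` ?S" using v by (intro image_eqI[of _ _ "(vs, E - dicycle vs)"]) auto
  qed
  moreover have finS: "finite ?S" using finite_distinct_lists[OF V] finF by (intro finite_SigmaI) auto
  ultimately have "card (unicycles_length V 2) \<le> card ?S"
    by (meson card_image_le card_mono finite_imageI le_trans)
  also have "card ?S = (\<Sum>vs\<in>distinct_lists V 2. card (forests (set vs) (V - set vs)))"
    using finite_distinct_lists[OF V] finF by (intro card_SigmaI) auto
  finally have "real (card (unicycles_length V 2)) * real ?n \<le> (\<Sum>vs\<in>distinct_lists V 2. real (card (forests (set vs) (V - set vs)))) * real ?n"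
    by (intro mult_right_mono) (simp_all flip: of_nat_sum)
  also have "\<dots> = (\<Sum>vs\<in>distinct_lists V 2. 2 ^ (?n - 2) * 2 * real ?n ^ (?n - 2))"
    unfolding sum_distrib_right
  proof (intro sum.cong refl)
    fix vs assume "vs \<in> distinct_lists V 2"
    then have "set vs \<subseteq> V" "card (set vs) = 2" by (auto simp: distinct_lists_def distinct_card)
    then show "real (card (forests (set vs) (V - set vs))) * real ?n = 2 ^ (?n - 2) * 2 * real ?n ^ (?n - 2)"
      using card_forests[of "set vs"] Vne by simp
  qed
  also have "\<dots> = (fact ?n / fact (?n - 2)) * (2 ^ (?n - 1) * real ?n ^ (?n - 2))"
  proof -
    have "2 ^ (?n - 2) * 2 = (2 ^ (?n - 1) :: real)" using assms by (simp flip: power_Suc2 add: Suc_diff_Suc numeral_2_eq_2)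
    then show ?thesis using card_distinct_lists[OF V assms] by simp
  qed
  also have "fact ?n / fact (?n - 2) = real ?n * (real ?n - 1)"
  proof -
    obtain m where m: "?n = Suc (Suc m)" using assms by (metis One_nat_def Suc_1 Suc_le_D Suc_le_mono)
    show ?thesis unfolding m by (simp add: field_simps)
  qed
  also have "real ?n * (real ?n - 1) * (2 ^ (?n - 1) * real ?n ^ (?n - 2)) \<le> real ?n * real ?n * (2 ^ (?n - 1) * real ?n ^ (?n - 2))"
    by (intro mult_right_mono mult_left_mono) auto
  also have "\<dots> = (2 ^ (?n - 1) * real ?n ^ (?n - 1)) * real ?n"
  proof -
    have e: "real ?n ^ (?n - 1) = real ?n * real ?n ^ (?n - 2)"
      using assms by (simp flip: power_Suc add: Suc_diff_Suc numeral_2_eq_2)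
    show ?thesis unfolding e by (simp only: mult_ac)
  qed
  finally show ?thesis using assms by simp
qed

lemma card_unicycles_bounds:
  assumes "2 \<le> card V"
  defines "g \<equiv> 2 ^ (card V - 1) * real (card V) ^ (card V - 1)"
    and "Q \<equiv> (\<Sum>k=3..card V. fact (card V) / fact (card V - k) / real (card V) ^ k)"
  shows "g * Q \<le> real (card (unicycles V))" "real (card (unicycles V)) \<le> g * Q + 2 * g"
proof -
  have "{2..card V} = insert 2 {3..card V}" using assms(1) by auto
  then have "(\<Sum>k=2..card V. card (unicycles_length V k)) = card (unicycles_length V 2) + (\<Sum>k=3..card V. card (unicycles_length V k))" by simp
  then have e: "real (card (unicycles V)) = real (card {E \<in> unicycles V. \<nexists>vs es. ucycle E vs es}) + real (card (unicycles_length V 2))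
      + (\<Sum>k=3..card V. real (card (unicycles_length V k)))"
    unfolding card_unicycles_sum by simp
  have "(\<Sum>k=3..card V. real (card (unicycles_length V k))) = g * Q"
    unfolding Q_def sum_distrib_left g_def by (intro sum.cong refl card_unicycles_length) auto
  moreover have "V \<noteq> {}" using assms(1) by auto
  ultimately show "g * Q \<le> real (card (unicycles V))" "real (card (unicycles V)) \<le> g * Q + 2 * g"
    using e card_trees_le card_two_cycles_le[OF assms(1)] unfolding g_def by auto
qed

end

section \<open>Analytic estimates\<close>

text \<open>The function 2x - exp(-x) is strictly increasing, and its signs at both ends of a short
  interval follow from the Taylor polynomial of degree 7, whose Lagrange remainder is nonnegative
  because the power 8 is even.\<close>

lemma two_x_eq_exp_root:
  "\<exists>l::real. (\<forall>x::real. 2 * x = exp (- x) \<longleftrightarrow> x = l) \<and> 0 < l \<and> l < 1 \<and> \<bar>l - 0.351733\<bar> < 1 / 10 ^ 6"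
proof -
  define f where "f x = 2 * x - exp (- x)" for x :: real
  have mono: "f x < f y" if "x < y" for x y
  proof -
    have "exp (- y) < exp (- x)" using that by simp
    then show ?thesis using that unfolding f_def by linarith
  qed
  have taylor: "\<exists>t. \<bar>t\<bar> \<le> \<bar>x\<bar> \<and> exp x = (\<Sum>m<8. x ^ m / fact m) + exp t / fact 8 * x ^ 8" for x :: real
    by (rule Maclaurin_exp_le)
  have a: "f (351732 / 1000000) < 0"
  proof -
    obtain t where t: "exp (- (351732 / 1000000) :: real) = (\<Sum>m<8. (- (351732 / 1000000)) ^ m / fact m) + exp t / fact 8 * (- (351732 / 1000000)) ^ 8"
      using taylor by blast
    have "(\<Sum>m<8. (- (351732 / 1000000)) ^ m / fact m) \<le> exp (- (351732 / 1000000) :: real)"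
      unfolding t by simp
    then show ?thesis unfolding f_def by (simp add: eval_nat_numeral fact_numeral)
  qed
  \<comment> \<open>Moving the right end inwards by 10^(-7) makes the required bound strict there;
    the root 0.3517337... still lies to its left.\<close>
  have b: "f (351734 / 1000000 - 1 / 10000000) > 0"
  proof -
    let ?x = "351734 / 1000000 - 1 / 10000000 :: real"
    obtain t where t: "\<bar>t\<bar> \<le> \<bar>- ?x\<bar>" "exp (- ?x) = (\<Sum>m<8. (- ?x) ^ m / fact m) + exp t / fact 8 * (- ?x) ^ 8"
      using taylor by blast
    have "exp t \<le> exp 1" using t(1) by simp
    also have "\<dots> \<le> (3::real)" by (rule exp_le)
    finally have "exp t / fact 8 * (- ?x) ^ 8 \<le> 3 / fact 8 * (- ?x) ^ 8"
      by (intro mult_right_mono divide_right_mono) auto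
    then have "exp (- ?x) \<le> (\<Sum>m<8. (- ?x) ^ m / fact m) + 3 / fact 8 * (- ?x) ^ 8" using t(2) by simp
    then show ?thesis unfolding f_def by (simp add: eval_nat_numeral fact_numeral)
  qed
  have "\<exists>x. 351732 / 1000000 \<le> x \<and> x \<le> 351734 / 1000000 - 1 / 10000000 \<and> f x = 0"
    by (rule IVT') (use a b in \<open>auto simp: f_def intro!: continuous_intros\<close>)
  then obtain l where l: "351732 / 1000000 \<le> l" "l \<le> 351734 / 1000000 - 1 / 10000000" "f l = 0" by blast
  have "l \<noteq> 351732 / 1000000" using a l(3) by (metis less_irrefl)
  then have "351732 / 1000000 < l" using l(1) by linarith
  then have near: "\<bar>l - 0.351733\<bar> < 1 / 10 ^ 6" unfolding abs_less_iff using l(2) by simp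
  have "2 * x = exp (- x) \<longleftrightarrow> x = l" for x
  proof -
    have "f x = 0 \<longleftrightarrow> x = l" using mono[of x l] mono[of l x] l(3) by (cases x l rule: linorder_cases) auto
    then show ?thesis by (simp add: f_def)
  qed
  then show ?thesis using l(1,2) near by (intro exI[of _ l]) auto
qed

text \<open>The difference of both sides has derivative x^2 / (2 (1 + x)^2). The bound is needed for
  arbitrarily large t, to dominate an integrand, as well as for t = 1/n.\<close>

lemma ln_one_plus_upper:
  assumes "0 \<le> (t::real)" shows "ln (1 + t) \<le> t - t\<^sup>2 / (2 * (1 + t))"
proof -
  have "0 - 0\<^sup>2 / (2 * (1 + 0)) - ln (1 + 0) \<le> t - t\<^sup>2 / (2 * (1 + t)) - ln (1 + t)"
  proof (rule DERIV_nonneg_imp_nondecreasing[OF assms])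
    fix x :: real assume x: "0 \<le> x" "x \<le> t"
    have "((\<lambda>t. t - t\<^sup>2 / (2 * (1 + t)) - ln (1 + t)) has_real_derivative
      1 - (2 * x * (2 * (1 + x)) - x\<^sup>2 * 2) / (2 * (1 + x))\<^sup>2 - 1 / (1 + x)) (at x)"
      using x by (auto intro!: derivative_eq_intros simp: power2_eq_square)
    moreover have "1 - (2 * x * (2 * (1 + x)) - x\<^sup>2 * 2) / (2 * (1 + x))\<^sup>2 - 1 / (1 + x) = x\<^sup>2 / (2 * (1 + x)\<^sup>2)"
      using x by (simp add: divide_simps) (simp add: power2_eq_square algebra_simps)
    ultimately show "\<exists>y. ((\<lambda>t. t - t\<^sup>2 / (2 * (1 + t)) - ln (1 + t)) has_real_derivative y) (at x) \<and> 0 \<le> y"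
      by (intro exI[of _ "x\<^sup>2 / (2 * (1 + x)\<^sup>2)"]) simp
  qed
  then show ?thesis by simp
qed

text \<open>Sharp enough that t = 1/x gives (x + 1/2) ln(1 + 1/x) >= 1, the monotonicity behind
  Stirling's formula.\<close>

lemma ln_one_plus_lower:
  assumes "0 \<le> (t::real)" shows "2 * t / (2 + t) \<le> ln (1 + t)"
proof -
  have "ln (1 + 0) - 2 * 0 / (2 + 0) \<le> ln (1 + t) - 2 * t / (2 + t)"
  proof (rule DERIV_nonneg_imp_nondecreasing[OF assms])
    fix x :: real assume x: "0 \<le> x" "x \<le> t"
    have "((\<lambda>t. ln (1 + t) - 2 * t / (2 + t)) has_real_derivative
      1 / (1 + x) - (2 * (2 + x) - 2 * x) / (2 + x)\<^sup>2) (at x)"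
      using x by (auto intro!: derivative_eq_intros simp: power2_eq_square)
    moreover have "1 / (1 + x) - (2 * (2 + x) - 2 * x) / (2 + x)\<^sup>2 = x\<^sup>2 / ((1 + x) * (2 + x)\<^sup>2)"
      using x by (simp add: divide_simps) (simp add: power2_eq_square algebra_simps)
    moreover have "0 \<le> x\<^sup>2 / ((1 + x) * (2 + x)\<^sup>2)" using x by simp
    ultimately show "\<exists>y. ((\<lambda>t. ln (1 + t) - 2 * t / (2 + t)) has_real_derivative y) (at x) \<and> 0 \<le> y"
      by metis
  qed
  then show ?thesis by simp
qed

section \<open>Ramanujan's function as an integral, and its asymptotics\<close>

lemma exp_power_integral:
  "has_bochner_integral lborel (\<lambda>x::real. indicator {0..} x * (x ^ k * exp (- x))) (fact k)"
proof (rule has_bochner_integral_nn_integral)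
  show "(\<integral>\<^sup>+x. ennreal (indicator {0..} x * (x ^ k * exp (- x))) \<partial>lborel) = ennreal (fact k)"
  proof -
    have "(\<integral>\<^sup>+x. ennreal (indicator {0..} x * (x ^ k * exp (- x))) \<partial>lborel)
      = (\<integral>\<^sup>+x. ennreal (x ^ k * exp (- x)) * indicator {0 ..} x \<partial>lborel)"
      by (intro nn_integral_cong) (auto split: split_indicator)
    then show ?thesis unfolding nn_intergal_power_times_exp_Ici by simp
  qed
qed (auto split: split_indicator)

text \<open>Ramanujan's Q(n) plus a term 1 for k = 0, which completes the binomial expansion in the
  integral representation.\<close>

definition Qsum :: "nat \<Rightarrow> real" where
  "Qsum n = (\<Sum>k\<le>n. fact n / fact (n - k) / real n ^ k)"

text \<open>Expand (1 + x/n)^n binomially, integrate against exp(-x), and substitute x = y sqrt n,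
  the scale on which the integrand converges.\<close>

lemma Qsum_integral:
  assumes "0 < n"
  shows "Qsum n / sqrt (real n) =
    (\<integral>y. indicator {0..} y * ((1 + y / sqrt (real n)) ^ n * exp (- (sqrt (real n) * y))) \<partial>lborel)"
proof -
  define s where "s = sqrt (real n)"
  have s: "0 < s" "s * s = real n" using assms by (auto simp: s_def)
  have "has_bochner_integral lborel (\<lambda>x::real. \<Sum>k\<le>n. (real (n choose k) / real n ^ k) * (indicator {0..} x * (x ^ k * exp (- x))))
    (\<Sum>k\<le>n. (real (n choose k) / real n ^ k) * fact k)"
    by (intro has_bochner_integral_sum has_bochner_integral_mult_right exp_power_integral)
  also have "(\<lambda>x::real. \<Sum>k\<le>n. (real (n choose k) / real n ^ k) * (indicator {0..} x * (x ^ k * exp (- x))))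
    = (\<lambda>x. indicator {0..} x * ((1 + x / real n) ^ n * exp (- x)))"
  proof
    fix x :: real
    have "(1 + x / real n) ^ n = (\<Sum>k\<le>n. (real (n choose k) / real n ^ k) * x ^ k)"
      using binomial_ring[of "x / real n" 1 n] by (simp add: add.commute power_divide)
    then show "(\<Sum>k\<le>n. (real (n choose k) / real n ^ k) * (indicator {0..} x * (x ^ k * exp (- x))))
      = indicator {0..} x * ((1 + x / real n) ^ n * exp (- x))"
      by (simp add: sum_distrib_left sum_distrib_right mult_ac)
  qed
  also have "(\<Sum>k\<le>n. (real (n choose k) / real n ^ k) * fact k) = Qsum n"
    unfolding Qsum_def by (intro sum.cong refl) (simp add: binomial_fact)
  finally have "has_bochner_integral lborel (\<lambda>x. indicator {0..} (0 + s * x) * ((1 + (0 + s * x) / real n) ^ n * exp (- (0 + s * x))))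
     (Qsum n /\<^sub>R \<bar>s\<bar>)"
    using lborel_has_bochner_integral_real_affine_iff[of s _ "Qsum n" 0] s by simp
  then have "(\<integral>x. indicator {0..} (0 + s * x) * ((1 + (0 + s * x) / real n) ^ n * exp (- (0 + s * x))) \<partial>lborel) = Qsum n / s"
    using s by (simp add: has_bochner_integral_iff divide_inverse mult.commute)
  moreover have "(\<lambda>x. indicator {0..} (0 + s * x) * ((1 + (0 + s * x) / real n) ^ n * exp (- (0 + s * x))))
    = (\<lambda>x. indicator {0..} x * ((1 + x / s) ^ n * exp (- (s * x))))"
  proof
    fix x
    have "s * x / real n = x / s" using s by (simp add: s(2)[symmetric])
    then show "indicator {0..} (0 + s * x) * ((1 + (0 + s * x) / real n) ^ n * exp (- (0 + s * x)))
      = indicator {0..} x * ((1 + x / s) ^ n * exp (- (s * x)))"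
      using s by (auto split: split_indicator simp: zero_le_mult_iff)
  qed
  ultimately have "(\<integral>x. indicator {0..} x * ((1 + x / s) ^ n * exp (- (s * x))) \<partial>lborel) = Qsum n / s"
    by (simp only:)
  then show ?thesis unfolding s_def by (rule sym)
qed

text \<open>With s = sqrt n, the exponent n ln(1 + y/s) - s y is at most -y^2 / (2 (1 + y/s)). As s
  >= 1, replacing y/s by y only weakens this, and y^2 / (1 + y) >= y - 1 gives an integrable bound
  independent of n.\<close>

lemma Qsum_integrand_bound:
  assumes "0 < n" "0 \<le> y"
  shows "(1 + y / sqrt (real n)) ^ n * exp (- (sqrt (real n) * y)) \<le> exp ((1 - y) / 2)"
proof -
  define s where "s = sqrt (real n)"
  have s: "1 \<le> s" "s * s = real n" using assms by (auto simp: s_def)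
  have p: "0 < 1 + y / s" using s assms by (simp add: add_pos_nonneg)
  have "ln (1 + y / s) \<le> y / s - (y / s)\<^sup>2 / (2 * (1 + y / s))" using ln_one_plus_upper[of "y / s"] s assms by simp
  then have "real n * ln (1 + y / s) \<le> real n * (y / s - (y / s)\<^sup>2 / (2 * (1 + y / s)))"
    by (intro mult_left_mono) auto
  also have "\<dots> = s * y - y\<^sup>2 / (2 * (1 + y / s))"
  proof -
    define u where "u = y / s"
    have y: "y = s * u" using s by (simp add: u_def)
    show ?thesis unfolding u_def[symmetric] unfolding y s(2)[symmetric]
      by (simp add: right_diff_distrib power2_eq_square mult_ac)
  qed
  also have "\<dots> \<le> s * y - y\<^sup>2 / (2 * (1 + y))"
  proof -
    have "y / s \<le> y" using s assms by (simp add: divide_le_eq mult_le_cancel_left1 mult_ge1_I mult_right_le_one_le mult_left_le)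
    then have "y\<^sup>2 / (2 * (1 + y)) \<le> y\<^sup>2 / (2 * (1 + y / s))" using p assms by (intro divide_left_mono mult_pos_pos) auto
    then show ?thesis by simp
  qed
  also have "\<dots> \<le> s * y - (y - 1) / 2"
  proof -
    have "(y - 1) / 2 \<le> y\<^sup>2 / (2 * (1 + y))" using assms by (simp add: field_simps power2_eq_square)
    then show ?thesis by simp
  qed
  finally have "real n * ln (1 + y / s) - s * y \<le> (1 - y) / 2" by (simp add: field_simps)
  moreover have "(1 + y / s) ^ n * exp (- (s * y)) = exp (real n * ln (1 + y / s) - s * y)"
    using p by (simp add: exp_diff exp_minus exp_of_nat_mult field_simps)
  ultimately show ?thesis unfolding s_def by simp
qed

text \<open>Dominated convergence: the rescaled integrand tends to exp(-y^2 / 2), whose integral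
  over the half line is the limit.\<close>

lemma Qsum_asymp: "(\<lambda>n. Qsum n / sqrt (real n)) \<longlonglongrightarrow> sqrt (pi / 2)"
proof -
  let ?f = "\<lambda>n y. indicator {0..} y * ((1 + y / sqrt (real n)) ^ n * exp (- (sqrt (real n) * y)))"
  let ?g = "\<lambda>y::real. indicator {0..} y * exp (- y\<^sup>2 / 2)"
  let ?w = "\<lambda>y::real. indicator {0..} y * exp ((1 - y) / 2)"
  \<comment> \<open>The majorant is integrable as a rescaled exponential, the case k = 0 of
    \<open>exp_power_integral\<close>.\<close>
  have "has_bochner_integral lborel (\<lambda>x::real. indicator {0..} (0 + (1/2) * x) * ((0 + (1/2) * x) ^ 0 * exp (- (0 + (1/2) * x)))) (fact 0 /\<^sub>R \<bar>1/2\<bar>)"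
    using lborel_has_bochner_integral_real_affine_iff[of "1/2::real" "\<lambda>x. indicator {0..} x * (x ^ 0 * exp (- x))" "fact 0" 0]
      exp_power_integral[of 0] by simp
  then have "integrable lborel (\<lambda>x::real. indicator {0..} (0 + (1/2) * x) * ((0 + (1/2) * x) ^ 0 * exp (- (0 + (1/2) * x))))"
    by (simp add: has_bochner_integral_iff)
  then have "integrable lborel (\<lambda>x::real. exp (1/2) * (indicator {0..} (0 + (1/2) * x) * ((0 + (1/2) * x) ^ 0 * exp (- (0 + (1/2) * x)))))"
    by (rule integrable_mult_right)
  also have "(\<lambda>x::real. exp (1/2) * (indicator {0..} (0 + (1/2) * x) * ((0 + (1/2) * x) ^ 0 * exp (- (0 + (1/2) * x))))) = ?w"
    by (rule ext) (auto split: split_indicator simp: diff_divide_distrib simp flip: exp_add)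
  finally have w: "integrable lborel ?w" .
  have "has_bochner_integral lborel (\<lambda>x::real. indicator {0..} (0 + (1 / sqrt 2) * x) *\<^sub>R exp (- (0 + (1 / sqrt 2) * x)\<^sup>2)) ((sqrt pi / 2) /\<^sub>R \<bar>1 / sqrt 2\<bar>)"
    using lborel_has_bochner_integral_real_affine_iff[of "1 / sqrt 2" "\<lambda>x. indicator {0..} x *\<^sub>R exp (- x\<^sup>2)" "sqrt pi / 2" 0]
      gaussian_moment_0 by simp
  also have "(\<lambda>x::real. indicator {0..} (0 + (1 / sqrt 2) * x) *\<^sub>R exp (- (0 + (1 / sqrt 2) * x)\<^sup>2)) = ?g"
    by (rule ext) (auto split: split_indicator simp: power_divide zero_le_divide_iff)
  also have "(sqrt pi / 2) /\<^sub>R \<bar>1 / sqrt 2\<bar> = sqrt (pi / 2)"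
    by (simp add: real_sqrt_divide field_simps)
  finally have g: "(\<integral>y. ?g y \<partial>lborel) = sqrt (pi / 2)" by (simp add: has_bochner_integral_iff)
  have "(\<lambda>n. \<integral>y. ?f (Suc n) y \<partial>lborel) \<longlonglongrightarrow> (\<integral>y. ?g y \<partial>lborel)"
  proof (rule integral_dominated_convergence[OF _ _ w])
    show "AE y in lborel. (\<lambda>n. ?f (Suc n) y) \<longlonglongrightarrow> ?g y"
    proof (rule AE_I2)
      fix y :: real
      show "(\<lambda>n. ?f (Suc n) y) \<longlonglongrightarrow> ?g y"
      proof (cases "0 \<le> y")
        case True
        have "(\<lambda>n. (1 + y / sqrt (real n)) ^ n * exp (- (sqrt (real n) * y))) \<longlonglongrightarrow> exp (- y\<^sup>2 / 2)"
        proof (cases "y = 0")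
          case False
          then have "y > 0" using True by simp
          then show ?thesis by (real_asymp, use \<open>y > 0\<close> in \<open>simp add: power2_eq_square\<close>)
        qed simp
        then show ?thesis using True LIMSEQ_Suc[of "\<lambda>n. (1 + y / sqrt (real n)) ^ n * exp (- (sqrt (real n) * y))"] by simp
      qed simp
    qed
    show "AE y in lborel. norm (?f (Suc n) y) \<le> ?w y" for n
    proof (rule AE_I2)
      fix y :: real
      show "norm (?f (Suc n) y) \<le> ?w y"
        using Qsum_integrand_bound[of "Suc n" y] by (auto split: split_indicator simp: abs_mult)
    qed
  qed auto
  then have "(\<lambda>n. Qsum (Suc n) / sqrt (real (Suc n))) \<longlonglongrightarrow> sqrt (pi / 2)"
    unfolding g Qsum_integral[OF zero_less_Suc] .
  then show ?thesis by (rule LIMSEQ_imp_Suc)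
qed

text \<open>Equal to 2n times the n-th coefficient of T rescaled by \<rho>, see
  \<open>Tser_nth\<close>. It behaves like 1 / sqrt(2 pi n), but only bounds of this order and the
  limits of its quotients are used.\<close>

definition qseq :: "nat \<Rightarrow> real" where
  "qseq n = real n ^ n * exp (- real n) / fact n"

lemma qseq_pos: "0 < n \<Longrightarrow> 0 < qseq n"
  by (simp add: qseq_def)

lemma qseq_Suc_ratio:
  assumes "0 < n"
  shows "qseq (Suc n) = qseq n * ((1 + 1 / real n) ^ n * exp (- 1))"
proof -
  have e: "real (Suc n) ^ n = (1 + 1 / real n) ^ n * real n ^ n"
    using assms by (simp add: power_mult_distrib[symmetric] algebra_simps)
  have "qseq (Suc n) = real (Suc n) ^ n * exp (- real n - 1) / fact n"
    by (simp add: qseq_def)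
  also have "\<dots> = qseq n * ((1 + 1 / real n) ^ n * exp (- 1))"
    unfolding e by (simp add: qseq_def exp_diff exp_minus field_simps)
  finally show ?thesis .
qed

lemma sqrt_qseq_ratio:
  assumes "0 < n"
  shows "sqrt (real (Suc n)) * qseq (Suc n) =
    sqrt (real n) * qseq n * exp ((real n + 1 / 2) * ln (1 + 1 / real n) - 1)"
proof -
  have p: "0 < 1 + 1 / real n" by (simp add: add_pos_nonneg)
  have "sqrt (real (Suc n)) = sqrt (real n * (1 + 1 / real n))" using assms by (simp add: distrib_left)
  also have "\<dots> = sqrt (real n) * sqrt (1 + 1 / real n)" by (rule real_sqrt_mult)
  also have "sqrt (1 + 1 / real n) = exp (1 / 2 * ln (1 + 1 / real n))"
    using p by (simp add: ln_sqrt[symmetric])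
  finally have s: "sqrt (real (Suc n)) = sqrt (real n) * exp (1 / 2 * ln (1 + 1 / real n))" .
  have "(1 + 1 / real n) ^ n = exp (real n * ln (1 + 1 / real n))"
    using p by (simp add: exp_of_nat_mult)
  moreover have "exp ((real n + 1 / 2) * ln (1 + 1 / real n) - 1)
    = exp (1 / 2 * ln (1 + 1 / real n)) * exp (real n * ln (1 + 1 / real n)) * exp (- 1)"
    unfolding exp_add[symmetric] by (simp add: distrib_right)
  ultimately show ?thesis unfolding qseq_Suc_ratio[OF assms] s by simp
qed

text \<open>The sequence sqrt n q(n) increases, starting from exp(-1) at n = 1.\<close>

lemma qseq_lower: "0 < n \<Longrightarrow> exp (- 1) / sqrt (real n) \<le> qseq n"
proof -
  have "exp (- 1) \<le> sqrt (real (Suc n)) * qseq (Suc n)" for n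
  proof (induction n)
    case (Suc n)
    define x where "x = real (Suc n)"
    have x: "0 < x" by (simp add: x_def)
    have "2 * (1 / x) / (2 + 1 / x) \<le> ln (1 + 1 / x)" using x by (intro ln_one_plus_lower) simp
    then have "(x + 1 / 2) * (2 * (1 / x) / (2 + 1 / x)) \<le> (x + 1 / 2) * ln (1 + 1 / x)"
      using x by (intro mult_left_mono) auto
    moreover have "2 * (1 / x) / (2 + 1 / x) = 1 / (x + 1 / 2)" using x by (simp add: field_simps)
    then have "(x + 1 / 2) * (2 * (1 / x) / (2 + 1 / x)) = 1" using x by simp
    ultimately have "1 \<le> (x + 1 / 2) * ln (1 + 1 / x)" by (simp only:)
    then have 1: "1 \<le> exp ((x + 1 / 2) * ln (1 + 1 / x) - 1)" by (simp only: one_le_exp_iff le_diff_eq add_0)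
    have "exp (- 1) \<le> sqrt x * qseq (Suc n) * 1" using Suc by (simp add: x_def)
    also have "\<dots> \<le> sqrt x * qseq (Suc n) * exp ((x + 1 / 2) * ln (1 + 1 / x) - 1)"
      using x qseq_pos[of "Suc n"] 1 by (intro mult_left_mono) auto
    also have "\<dots> = sqrt (real (Suc (Suc n))) * qseq (Suc (Suc n))"
      unfolding x_def by (rule sqrt_qseq_ratio[symmetric]) simp
    finally show ?case .
  qed (simp add: qseq_def)
  from this[of "n - 1"] show "0 < n \<Longrightarrow> exp (- 1) / sqrt (real n) \<le> qseq n"
    by (simp add: field_simps)
qed

text \<open>The factor exp(1/(4n)) turns sqrt n q(n) into a nonincreasing sequence, since (x + 1/2)
  ln(1 + 1/x) - 1 is at most the telescoping difference 1/(4x) - 1/(4(x + 1)). The initial value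
  exp(-3/4) is below 1.\<close>

lemma qseq_upper: "0 < n \<Longrightarrow> qseq n \<le> 1 / sqrt (real n)"
proof -
  have "sqrt (real (Suc n)) * qseq (Suc n) * exp (1 / (4 * real (Suc n))) \<le> exp (- 1) * exp (1 / 4)" for n
  proof (induction n)
    case (Suc n)
    define x where "x = real (Suc n)"
    have x: "0 < x" by (simp add: x_def)
    have "ln (1 + 1 / x) \<le> 1 / x - (1 / x)\<^sup>2 / (2 * (1 + 1 / x))" using x by (intro ln_one_plus_upper) simp
    then have "(x + 1 / 2) * ln (1 + 1 / x) \<le> (x + 1 / 2) * (1 / x - (1 / x)\<^sup>2 / (2 * (1 + 1 / x)))"
      using x by (intro mult_left_mono) auto
    also have "\<dots> = 1 + 1 / (4 * x) - 1 / (4 * (x + 1))"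
      using x by (simp add: divide_simps power2_eq_square) (simp add: algebra_simps)
    finally have 1: "exp ((x + 1 / 2) * ln (1 + 1 / x) - 1) * exp (1 / (4 * (x + 1))) \<le> exp (1 / (4 * x))"
      by (simp flip: exp_add)
    have x1: "real (Suc (Suc n)) = x + 1" by (simp add: x_def)
    have "sqrt (real (Suc (Suc n))) * qseq (Suc (Suc n)) * exp (1 / (4 * real (Suc (Suc n))))
      = sqrt x * qseq (Suc n) * exp ((x + 1 / 2) * ln (1 + 1 / x) - 1) * exp (1 / (4 * (x + 1)))"
      using sqrt_qseq_ratio[of "Suc n"] unfolding x_def[symmetric] x1 by simp
    also have "\<dots> \<le> sqrt x * qseq (Suc n) * exp (1 / (4 * x))"
      unfolding mult.assoc[of "sqrt x * qseq (Suc n)"]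
      using x qseq_pos[of "Suc n"] 1 by (intro mult_left_mono) auto
    also have "\<dots> \<le> exp (- 1) * exp (1 / 4)" using Suc unfolding x_def .
    finally show ?case .
  qed (simp add: qseq_def)
  note A = this
  assume n: "0 < n"
  then have "sqrt (real n) * qseq n * exp (1 / (4 * real n)) \<le> exp (- 1) * exp (1 / 4)" using A[of "n - 1"] by simp
  also have "\<dots> \<le> 1" by (simp flip: exp_add)
  finally have "sqrt (real n) * qseq n * exp (1 / (4 * real n)) \<le> 1" .
  moreover have "sqrt (real n) * qseq n * 1 \<le> sqrt (real n) * qseq n * exp (1 / (4 * real n))"
    using n qseq_pos[of n] by (intro mult_left_mono) auto
  ultimately show "qseq n \<le> 1 / sqrt (real n)" using n by (simp add: field_simps)
qed

lemma qseq_ratio_Suc: "(\<lambda>n. qseq n / qseq (Suc n)) \<longlonglongrightarrow> 1"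
proof -
  have "(\<lambda>n. 1 / ((1 + 1 / real n) ^ n * exp (- 1))) \<longlonglongrightarrow> 1"
    by (real_asymp, simp add: exp_minus)
  moreover have "eventually (\<lambda>n. 1 / ((1 + 1 / real n) ^ n * exp (- 1)) = qseq n / qseq (Suc n)) sequentially"
    using eventually_gt_at_top[of 0]
  proof eventually_elim
    case (elim n)
    then show ?case using qseq_Suc_ratio[OF elim] qseq_pos[OF elim] by simp
  qed
  ultimately show ?thesis by (rule Lim_transform_eventually)
qed

lemma qseq_ratio: "(\<lambda>n. qseq (n - j) / qseq n) \<longlonglongrightarrow> 1"
proof (induction j)
  case 0
  have "eventually (\<lambda>n. 1 = qseq n / qseq n) sequentially"
    using eventually_gt_at_top[of 0]
  proof eventually_elim
    case (elim n)
    then show ?case using qseq_pos[OF elim] by simp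
  qed
  then have "(\<lambda>n. qseq n / qseq n) \<longlonglongrightarrow> 1" by (rule Lim_transform_eventually[OF tendsto_const])
  then show ?case by (simp only: diff_zero)
next
  case (Suc j)
  have "(\<lambda>n. qseq n / qseq (Suc n) * (qseq (n - j) / qseq n)) \<longlonglongrightarrow> 1 * 1"
    by (intro tendsto_mult qseq_ratio_Suc Suc)
  moreover have "eventually (\<lambda>n. qseq n / qseq (Suc n) * (qseq (n - j) / qseq n) = qseq (Suc n - Suc j) / qseq (Suc n)) sequentially"
    using eventually_gt_at_top[of 0]
  proof eventually_elim
    case (elim n)
    then show ?case using qseq_pos[OF elim] by simp
  qed
  ultimately have "(\<lambda>n. qseq (Suc n - Suc j) / qseq (Suc n)) \<longlonglongrightarrow> 1"
    using Lim_transform_eventually by fastforce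
  then show ?case by (rule LIMSEQ_imp_Suc)
qed

text \<open>Each term is at most 2 (sqrt m - sqrt(m - 1)), so the sum telescopes.\<close>

lemma sum_inverse_sqrt: "(\<Sum>m=1..n. 1 / sqrt (real m)) \<le> 2 * sqrt (real n)"
proof (induction n)
  case (Suc n)
  define a b where "a = sqrt (real n)" and "b = sqrt (real (Suc n))"
  have ab: "0 \<le> a" "a \<le> b" "0 < b" "b * b = a * a + 1" by (auto simp: a_def b_def)
  have "0 \<le> (b - a)\<^sup>2" by simp
  then have "1 \<le> 2 * b * b - 2 * a * b" using ab(4) by (simp add: power2_eq_square algebra_simps)
  then have "1 / b \<le> 2 * b - 2 * a"
    unfolding pos_divide_le_eq[OF ab(3)] by (simp add: algebra_simps)
  then show ?case using Suc by (simp add: a_def b_def)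
qed simp

text \<open>The terms with \<open>2 j \<le> n\<close> are dominated by the summable \<open>\<bar>S j\<bar>\<close>; the remaining ones
  are small since there \<open>S j = O(n\<^sup>-\<^sup>3\<^sup>/\<^sup>2)\<close>.\<close>

lemma qseq_convolution:
  assumes sumS: "summable (\<lambda>j. \<bar>S j\<bar>)" and D: "0 \<le> D" "\<And>j. 0 < j \<Longrightarrow> \<bar>S j\<bar> \<le> D * qseq j / real j"
  shows "(\<lambda>n. (\<Sum>j<n. S j * qseq (n - j)) / qseq n) \<longlonglongrightarrow> (\<Sum>j. S j)"
proof -
  \<comment> \<open>The first half of the convolution, extended by zero to an infinite series so
    that Tannery's theorem applies.\<close>
  define a where "a j n = (if 2 * j \<le> n \<and> 0 < n then S j * (qseq (n - j) / qseq n) else 0)" for j n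
  \<comment> \<open>From n - j >= n/2 with \<open>qseq_upper\<close> for the numerator,
    \<open>qseq_lower\<close> for the denominator, and exp 1 <= 3.\<close>
  have c: "qseq (n - j) / qseq n \<le> 3 * sqrt 2" if "2 * j \<le> n" "0 < n" for j n
  proof -
    have nj: "0 < n - j" "real n \<le> 2 * real (n - j)" using that by auto
    have e: "exp 1 \<le> (3::real)" by (rule exp_le)
    have "qseq (n - j) \<le> 1 / sqrt (real (n - j))" by (rule qseq_upper[OF nj(1)])
    also have "\<dots> \<le> sqrt 2 / sqrt (real n)"
    proof -
      have "sqrt (real n) \<le> sqrt 2 * sqrt (real (n - j))" using nj by (simp flip: real_sqrt_mult)
      then show ?thesis using nj that by (simp add: field_simps)
    qed
    also have "\<dots> \<le> sqrt 2 / sqrt (real n) * (3 * exp (- 1))"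
    proof -
      have "1 \<le> 3 * exp (- 1 :: real)" using e by (simp add: exp_minus field_simps)
      then have "sqrt 2 / sqrt (real n) * 1 \<le> sqrt 2 / sqrt (real n) * (3 * exp (- 1))"
        by (intro mult_left_mono) auto
      then show ?thesis by simp
    qed
    also have "\<dots> = 3 * sqrt 2 * (exp (- 1) / sqrt (real n))" by simp
    also have "\<dots> \<le> 3 * sqrt 2 * qseq n" using qseq_lower[OF that(2)] by (intro mult_left_mono) auto
    finally show ?thesis using qseq_pos[OF that(2)] by (simp add: divide_le_eq)
  qed
  have main: "(\<lambda>n. \<Sum>j. a j n) \<longlonglongrightarrow> (\<Sum>j. S j)"
  proof -
    have lim: "(\<lambda>n. a j n) \<longlonglongrightarrow> S j" for j
    proof -
      have "(\<lambda>n. S j * (qseq (n - j) / qseq n)) \<longlonglongrightarrow> S j * 1" by (intro tendsto_intros qseq_ratio)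
      moreover have "eventually (\<lambda>n. S j * (qseq (n - j) / qseq n) = a j n) sequentially"
        using eventually_ge_at_top[of "2 * j + 1"] by eventually_elim (simp add: a_def)
      ultimately show ?thesis using Lim_transform_eventually by fastforce
    qed
    have bound: "norm (a j n) \<le> 3 * sqrt 2 * \<bar>S j\<bar>" for j n
    proof (cases "2 * j \<le> n \<and> 0 < n")
      case True
      have "0 < qseq (n - j)" "0 < qseq n" using True by (auto intro!: qseq_pos)
      then have "\<bar>a j n\<bar> = \<bar>S j\<bar> * (qseq (n - j) / qseq n)" using True by (simp add: a_def abs_mult)
      also have "\<dots> \<le> \<bar>S j\<bar> * (3 * sqrt 2)" using c[of j n] True by (intro mult_left_mono) auto
      finally show ?thesis by (simp add: mult.commute)
    qed (auto simp: a_def)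
    have "eventually (\<lambda>(j, n). norm (a j n) \<le> 3 * sqrt 2 * \<bar>S j\<bar>) (at_top \<times>\<^sub>F sequentially)"
      by (rule always_eventually) (use bound in auto)
    from tannerys_theorem[OF lim this summable_mult[OF sumS] sequentially_bot]
    show ?thesis by blast
  qed
  have tail: "(\<lambda>n. (\<Sum>j<n. S j * qseq (n - j)) / qseq n - (\<Sum>j. a j n)) \<longlonglongrightarrow> 0"
  proof (rule Lim_null_comparison)
    \<comment> \<open>The second half is at most 4 sqrt 2 D / n, as the inverse square roots sum to
      at most 2 sqrt n; dividing by \<open>qseq n\<close>, which is at least 1 / (3 sqrt n), costs a
      factor 3 sqrt n.\<close>
    show "(\<lambda>n. 12 * sqrt 2 * D * (1 / sqrt (real n))) \<longlonglongrightarrow> 0" by real_asymp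
    show "eventually (\<lambda>n. norm ((\<Sum>j<n. S j * qseq (n - j)) / qseq n - (\<Sum>j. a j n)) \<le> 12 * sqrt 2 * D * (1 / sqrt (real n))) sequentially"
      using eventually_gt_at_top[of 0]
    proof eventually_elim
      case (elim n)
      have qn: "0 < qseq n" using elim by (rule qseq_pos)
      have "(\<Sum>j. a j n) = (\<Sum>j<n. a j n)"
        using elim by (intro suminf_finite) (auto simp: a_def)
      also have "\<dots> = (\<Sum>j<n. if 2 * j \<le> n then S j * qseq (n - j) else 0) / qseq n"
        unfolding sum_divide_distrib using elim by (intro sum.cong) (auto simp: a_def)
      finally have split: "(\<Sum>j<n. S j * qseq (n - j)) / qseq n - (\<Sum>j. a j n)
        = (\<Sum>j<n. if 2 * j \<le> n then 0 else S j * qseq (n - j)) / qseq n"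
        by (simp add: diff_divide_distrib[symmetric] sum_subtractf[symmetric] if_distrib cong: if_cong)
      have "\<bar>\<Sum>j<n. if 2 * j \<le> n then 0 else S j * qseq (n - j)\<bar> \<le> (\<Sum>j<n. D * (2 * sqrt 2 / (real n * sqrt (real n))) * (1 / sqrt (real (n - j))))"
      proof (rule order_trans[OF sum_abs], rule sum_mono)
        fix j assume "j \<in> {..<n}"
        then have j: "j < n" by simp
        show "\<bar>if 2 * j \<le> n then 0 else S j * qseq (n - j)\<bar> \<le> D * (2 * sqrt 2 / (real n * sqrt (real n))) * (1 / sqrt (real (n - j)))"
        proof (cases "2 * j \<le> n")
          case False
          then have j0: "0 < j" "real n \<le> 2 * real j" by auto
          have "qseq j / real j \<le> 1 / sqrt (real j) / real j"
            using qseq_upper[OF j0(1)] by (intro divide_right_mono) auto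
          also have "\<dots> = 1 / (sqrt (real j) * real j)" by simp
          also have "\<dots> \<le> 2 * sqrt 2 / (real n * sqrt (real n))"
          proof -
            have "sqrt (real n) \<le> sqrt 2 * sqrt (real j)" using j0 by (simp flip: real_sqrt_mult)
            then have "real n * sqrt (real n) \<le> (2 * real j) * (sqrt 2 * sqrt (real j))"
              using j0 by (intro mult_mono) auto
            then show ?thesis using j0 elim by (simp add: field_simps)
          qed
          finally have "D * (qseq j / real j) \<le> D * (2 * sqrt 2 / (real n * sqrt (real n)))"
            using D(1) by (rule mult_left_mono)
          then have "\<bar>S j\<bar> \<le> D * (2 * sqrt 2 / (real n * sqrt (real n)))" using D(2)[OF j0(1)] by simp
          moreover have "0 \<le> qseq (n - j)" "qseq (n - j) \<le> 1 / sqrt (real (n - j))"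
            using qseq_pos[of "n - j"] qseq_upper[of "n - j"] j by auto
          ultimately have "\<bar>S j\<bar> * qseq (n - j) \<le> D * (2 * sqrt 2 / (real n * sqrt (real n))) * (1 / sqrt (real (n - j)))"
            using D(1) by (intro mult_mono) auto
          then show ?thesis using False \<open>0 \<le> qseq (n - j)\<close> by (simp add: abs_mult)
        qed (use D in auto)
      qed
      also have "\<dots> = D * (2 * sqrt 2 / (real n * sqrt (real n))) * (\<Sum>j<n. 1 / sqrt (real (n - j)))"
        by (simp add: sum_distrib_left)
      also have "(\<Sum>j<n. 1 / sqrt (real (n - j))) = (\<Sum>m=1..n. 1 / sqrt (real m))"
        by (rule sum.reindex_bij_witness[where i = "\<lambda>m. n - m" and j = "\<lambda>j. n - j"]) auto
      also have "D * (2 * sqrt 2 / (real n * sqrt (real n))) * (\<Sum>m=1..n. 1 / sqrt (real m))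
        \<le> D * (2 * sqrt 2 / (real n * sqrt (real n))) * (2 * sqrt (real n))"
        using D(1) sum_inverse_sqrt by (intro mult_left_mono) auto
      also have "\<dots> = 4 * sqrt 2 * D / real n" using elim by (simp add: field_simps)
      finally have t: "\<bar>\<Sum>j<n. if 2 * j \<le> n then 0 else S j * qseq (n - j)\<bar> \<le> 4 * sqrt 2 * D / real n" .
      have "1 / (3 * sqrt (real n)) \<le> exp (- 1) / sqrt (real n)"
        using exp_le elim by (simp add: exp_minus field_simps)
      also have "\<dots> \<le> qseq n" by (rule qseq_lower[OF elim])
      finally have ql: "1 / (3 * sqrt (real n)) \<le> qseq n" .
      have "\<bar>\<Sum>j<n. if 2 * j \<le> n then 0 else S j * qseq (n - j)\<bar> / qseq n \<le> (4 * sqrt 2 * D / real n) / (1 / (3 * sqrt (real n)))"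
        using t ql elim by (intro frac_le) auto
      also have "\<dots> = 12 * sqrt 2 * D * (sqrt (real n) / real n)" by simp
      also have "sqrt (real n) / real n = 1 / sqrt (real n)" using elim by (simp add: field_simps)
      finally show ?case unfolding split using qn by (simp add: abs_divide)
    qed
  qed
  show ?thesis using tendsto_add[OF tail main] by simp
qed

section \<open>Evaluation of the generating functions at the singularity\<close>

text \<open>Series such as T are evaluated on their circle of convergence, so absolute convergence
  is carried along instead of being deduced from a radius.\<close>

definition fsums :: "real fps \<Rightarrow> real \<Rightarrow> real \<Rightarrow> bool" where
  "fsums f x s \<longleftrightarrow> summable (\<lambda>n. \<bar>f $ n * x ^ n\<bar>) \<and> (\<lambda>n. f $ n * x ^ n) sums s"

lemma fsums_mult:
  assumes "fsums f x s" "fsums g x t"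
  shows "fsums (f * g) x (s * t)"
proof -
  have c: "(f * g) $ n * x ^ n = (\<Sum>i\<le>n. (f $ i * x ^ i) * (g $ (n - i) * x ^ (n - i)))" for n
  proof -
    have "(f * g) $ n * x ^ n = (\<Sum>i\<le>n. f $ i * g $ (n - i) * x ^ n)"
      by (simp add: fps_mult_nth atLeast0AtMost sum_distrib_right)
    also have "\<dots> = (\<Sum>i\<le>n. (f $ i * x ^ i) * (g $ (n - i) * x ^ (n - i)))"
    proof (rule sum.cong[OF refl])
      fix i assume "i \<in> {..n}"
      then have "x ^ n = x ^ i * x ^ (n - i)" by (simp flip: power_add)
      then show "f $ i * g $ (n - i) * x ^ n = (f $ i * x ^ i) * (g $ (n - i) * x ^ (n - i))" by simp
    qed
    finally show ?thesis .
  qed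
  have a: "summable (\<lambda>n. norm (f $ n * x ^ n))" "summable (\<lambda>n. norm (g $ n * x ^ n))"
    and s: "(\<Sum>n. f $ n * x ^ n) = s" "(\<Sum>n. g $ n * x ^ n) = t"
    using assms by (auto simp: fsums_def sums_iff)
  have "summable (\<lambda>n. \<Sum>i\<le>n. norm (f $ i * x ^ i) * norm (g $ (n - i) * x ^ (n - i)))"
    using a by (intro summable_Cauchy_product) auto
  then have "summable (\<lambda>n. norm ((f * g) $ n * x ^ n))"
  proof (rule summable_comparison_test'[where N = 0])
    fix n
    have "norm ((f * g) $ n * x ^ n) \<le> (\<Sum>i\<le>n. norm (f $ i * x ^ i) * norm (g $ (n - i) * x ^ (n - i)))"
      unfolding c norm_mult[symmetric] by (rule norm_sum)
    then show "norm (norm ((f * g) $ n * x ^ n)) \<le> (\<Sum>i\<le>n. norm (f $ i * x ^ i) * norm (g $ (n - i) * x ^ (n - i)))"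
      by simp
  qed
  moreover have "(\<lambda>n. (f * g) $ n * x ^ n) sums (s * t)"
    unfolding c using Cauchy_product_sums[OF a] s by simp
  ultimately show ?thesis by (simp add: fsums_def)
qed

lemma fsums_unique: "fsums f x s \<Longrightarrow> fsums f x t \<Longrightarrow> s = t"
  unfolding fsums_def using sums_unique2 by blast

lemma fsums_finite:
  assumes "finite N" "\<And>n. n \<notin> N \<Longrightarrow> f $ n = 0"
  shows "fsums f x (\<Sum>n\<in>N. f $ n * x ^ n)"
  unfolding fsums_def using assms by (auto intro!: summable_finite[of N] sums_finite)

lemma fsums_one: "fsums 1 x 1"
  using fsums_finite[of "{0}" 1 x] by simp

lemma fsums_X: "fsums fps_X x x"
  using fsums_finite[of "{1}" fps_X x] by (simp add: fps_X_nth)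

lemma fsums_add: "fsums f x s \<Longrightarrow> fsums g x t \<Longrightarrow> fsums (f + g) x (s + t)"
  unfolding fsums_def
proof (elim conjE, intro conjI)
  assume a: "summable (\<lambda>n. \<bar>f $ n * x ^ n\<bar>)" "summable (\<lambda>n. \<bar>g $ n * x ^ n\<bar>)"
  show "summable (\<lambda>n. \<bar>(f + g) $ n * x ^ n\<bar>)"
    by (rule summable_comparison_test'[OF summable_add[OF a], where N = 0])
       (use abs_triangle_ineq in \<open>simp add: distrib_right\<close>)
next
  assume "(\<lambda>n. f $ n * x ^ n) sums s" "(\<lambda>n. g $ n * x ^ n) sums t"
  then show "(\<lambda>n. (f + g) $ n * x ^ n) sums (s + t)" using sums_add by (fastforce simp: distrib_right)
qed

lemma fsums_power: "fsums f x s \<Longrightarrow> fsums (f ^ k) x (s ^ k)"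
  by (induction k) (auto intro: fsums_mult fsums_one)

lemma fsums_exp: "fsums (fps_exp c) x (exp (c * x))"
proof -
  have e: "fps_exp c $ n * x ^ n = (c * x) ^ n /\<^sub>R fact n" for n
    by (simp add: power_mult_distrib divide_inverse mult_ac)
  show ?thesis unfolding fsums_def e
    using summable_norm_exp[of "c * x"] exp_converges[of "c * x"] by simp
qed

lemma fps_power_nonneg: "(\<And>n. 0 \<le> b $ n) \<Longrightarrow> 0 \<le> ((b :: real fps) ^ k) $ n"
  by (induction k arbitrary: n) (auto simp: fps_mult_nth fps_one_nth intro!: sum_nonneg mult_nonneg_nonneg)

text \<open>Truncating at degree \<open>N\<close> leaves the sum of a_k p(k, N), where p(k, N) is
  the truncated value of the k-th power of \<open>b\<close>. As the coefficients of \<open>b\<close>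
  are nonnegative, p(k, N) is at most \<beta>^k and tends to it, so Tannery's theorem yields the
  value of \<open>a\<close> at \<beta>.\<close>

lemma fsums_compose:
  assumes b: "fsums b x \<beta>" "\<And>n. 0 \<le> b $ n" "b $ 0 = 0" and x: "0 \<le> x" and a: "fsums a \<beta> s"
  shows "fsums (a oo b) x s"
proof -
  have pow: "fsums (b ^ k) x (\<beta> ^ k)" for k by (rule fsums_power[OF b(1)])
  have nn: "0 \<le> (b ^ k) $ n * x ^ n" for k n using fps_power_nonneg[of b] b(2) x by simp
  have "0 \<le> (\<Sum>n. b $ n * x ^ n)"
    using b(1) nn[of 1] by (intro suminf_nonneg) (auto simp: fsums_def sums_iff)
  then have beta: "0 \<le> \<beta>" using b(1) by (simp add: fsums_def sums_iff)
  define p where "p k N = (\<Sum>n\<le>N. (b ^ k) $ n * x ^ n)" for k N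
  have plim: "(\<lambda>N. p k N) \<longlonglongrightarrow> \<beta> ^ k" for k
    using pow[of k] unfolding fsums_def p_def sums_def_le by blast
  have pb: "0 \<le> p k N" "p k N \<le> \<beta> ^ k" for k N
  proof -
    show "0 \<le> p k N" unfolding p_def by (intro sum_nonneg nn)
    have "p k N \<le> (\<Sum>n. (b ^ k) $ n * x ^ n)"
      unfolding p_def using pow[of k] nn by (intro sum_le_suminf) (auto simp: fsums_def sums_iff)
    then show "p k N \<le> \<beta> ^ k" using pow[of k] by (simp add: fsums_def sums_iff)
  qed
  have comp: "(\<lambda>n. (a oo b) $ n * x ^ n) sums s" if a: "fsums a \<beta> s" for a s
  proof -
    have e: "(a oo b) $ n * x ^ n = (\<Sum>k\<le>N. a $ k * ((b ^ k) $ n * x ^ n))" if "n \<le> N" for n N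
    proof -
      have "(a oo b) $ n = (\<Sum>k\<le>n. a $ k * (b ^ k) $ n)" by (simp add: fps_compose_nth atLeast0AtMost)
      also have "\<dots> = (\<Sum>k\<le>N. a $ k * (b ^ k) $ n)"
        using that b(3) by (intro sum.mono_neutral_left) (auto simp: startsby_zero_power_prefix)
      finally show ?thesis by (simp add: sum_distrib_right mult.assoc)
    qed
    have part: "(\<Sum>n\<le>N. (a oo b) $ n * x ^ n) = (\<Sum>k. a $ k * p k N)" for N
    proof -
      have "(\<Sum>n\<le>N. (a oo b) $ n * x ^ n) = (\<Sum>n\<le>N. \<Sum>k\<le>N. a $ k * ((b ^ k) $ n * x ^ n))"
        by (intro sum.cong refl e) simp
      also have "\<dots> = (\<Sum>k\<le>N. \<Sum>n\<le>N. a $ k * ((b ^ k) $ n * x ^ n))" by (rule sum.swap)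
      also have "\<dots> = (\<Sum>k\<le>N. a $ k * p k N)" by (simp add: p_def sum_distrib_left)
      also have "\<dots> = (\<Sum>k. a $ k * p k N)"
      proof (rule suminf_finite[symmetric])
        fix k assume "k \<notin> {..N}"
        then have "(b ^ k) $ n = 0" if "n \<le> N" for n
          using that b(3) by (intro startsby_zero_power_prefix[rule_format]) auto
        then show "a $ k * p k N = 0" by (simp add: p_def)
      qed simp
      finally show ?thesis .
    qed
    have "(\<lambda>N. \<Sum>k. a $ k * p k N) \<longlonglongrightarrow> (\<Sum>k. a $ k * \<beta> ^ k)"
    proof -
      have l: "(\<lambda>N. a $ k * p k N) \<longlonglongrightarrow> a $ k * \<beta> ^ k" for k by (intro tendsto_intros plim)
      have "norm (a $ k * p k N) \<le> \<bar>a $ k * \<beta> ^ k\<bar>" for k N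
        using pb[of k N] beta by (simp add: abs_mult mult_left_mono)
      then have ev: "eventually (\<lambda>(k, N). norm (a $ k * p k N) \<le> \<bar>a $ k * \<beta> ^ k\<bar>) (at_top \<times>\<^sub>F sequentially)"
        by (intro always_eventually) auto
      have "summable (\<lambda>k. \<bar>a $ k * \<beta> ^ k\<bar>)" using a by (simp add: fsums_def)
      from tannerys_theorem[OF l ev this sequentially_bot] show ?thesis by blast
    qed
    moreover have "(\<Sum>k. a $ k * \<beta> ^ k) = s" using a by (simp add: fsums_def sums_iff)
    ultimately show ?thesis unfolding sums_def_le part by simp
  qed
  \<comment> \<open>Absolute convergence: composing with the absolute values of the outer
    coefficients gives a majorant, to which \<open>comp\<close> applies again.\<close>
  define a' where "a' = Abs_fps (\<lambda>k. \<bar>a $ k\<bar>)"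
  have "fsums a' \<beta> (\<Sum>k. \<bar>a $ k * \<beta> ^ k\<bar>)"
    using a beta unfolding fsums_def a'_def by (simp add: abs_mult summable_sums)
  then have "summable (\<lambda>n. (a' oo b) $ n * x ^ n)" using comp sums_iff by blast
  then have "summable (\<lambda>n. \<bar>(a oo b) $ n * x ^ n\<bar>)"
  proof (rule summable_comparison_test'[where N = 0])
    fix n
    have "\<bar>(a oo b) $ n\<bar> \<le> (a' oo b) $ n"
      unfolding fps_compose_nth a'_def using fps_power_nonneg[of b] b(2)
      by (intro order_trans[OF sum_abs] sum_mono) (simp add: abs_mult)
    then show "norm \<bar>(a oo b) $ n * x ^ n\<bar> \<le> (a' oo b) $ n * x ^ n"
      using x by (simp add: abs_mult mult_right_mono)
  qed
  then show ?thesis using comp[OF a] by (simp add: fsums_def)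
qed

section \<open>Values of T and R at the singularity\<close>

definition \<rho> :: real where "\<rho> = exp (- 1) / 2"

lemma \<rho>_pos: "0 < \<rho>" by (simp add: \<rho>_def)

text \<open>The inequalities hold because the coefficients count forests, those with red roots among
  all; the exponent of \<open>Xser\<close>, with its mixed signs, does not show them.\<close>

lemma Xser_Yser_power:
  "0 \<le> (Xser ^ k) $ m" "(Xser ^ k) $ m \<le> (Yser ^ k) $ m"
proof -
  let ?B = "{..<k}" and ?M = "{k..<k + m}"
  let ?R = "{P \<in> forests ?B ?M. ?B \<subseteq> red_set P}"
  have d: "finite ?B" "finite ?M" "?B \<inter> ?M = {}" by auto
  have r: "real (card ?R) = fact m * (Xser ^ k) $ m" using card_red_forests_fps[OF d] by simp
  have f: "real (card (forests ?B ?M)) = fact m * (Yser ^ k) $ m" using card_forests_fps[OF d] by simp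
  have "card ?R \<le> card (forests ?B ?M)"
    using finite_forests[OF d(1,2)] by (intro card_mono) auto
  then have "real (card ?R) \<le> real (card (forests ?B ?M))" by simp
  then show "(Xser ^ k) $ m \<le> (Yser ^ k) $ m" unfolding r f by simp
  have "0 \<le> fact m * (Xser ^ k) $ m" unfolding r[symmetric] by simp
  then show "0 \<le> (Xser ^ k) $ m" using fact_gt_zero[of m, where 'a = real] by (auto simp: zero_le_mult_iff)
qed

lemma Tser_power_nth:
  assumes "0 < n" "k \<le> n"
  shows "(Tser ^ k) $ n * \<rho> ^ n = real k / 2 ^ k * (real n ^ (n - k) * exp (- real n) / fact (n - k)) / real n"
proof -
  have "Tser ^ k = fps_X ^ k * Yser ^ k" by (simp add: X_Yser[symmetric] power_mult_distrib)
  then have T: "(Tser ^ k) $ n = (Yser ^ k) $ (n - k)" using assms by (simp add: fps_X_power_mult_nth)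
  have "real (n - k) + real k = real n" using assms by simp
  then have Y: "fact (n - k) * (Yser ^ k) $ (n - k) * real n = 2 ^ (n - k) * real k * real n ^ (n - k)"
    using Yser_power_nth[of "n - k" k] by simp
  have "exp (- 1 :: real) ^ n = exp (- real n)" by (simp flip: exp_of_nat_mult)
  then have r: "\<rho> ^ n = exp (- real n) / (2 ^ k * 2 ^ (n - k))"
    using assms by (simp add: \<rho>_def power_divide flip: power_add)
  have "(Yser ^ k) $ (n - k) = 2 ^ (n - k) * real k * real n ^ (n - k) / (fact (n - k) * real n)"
    using Y assms by (simp add: field_simps)
  then show ?thesis unfolding T r by simp
qed

lemma Rser_power_bounds:
  "0 \<le> (Rser ^ k) $ n" "(Rser ^ k) $ n \<le> (Tser ^ k) $ n"
proof -
  have "(Tser ^ k) = fps_X ^ k * Yser ^ k" "(Rser ^ k) = fps_X ^ k * Xser ^ k"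
    by (simp_all add: X_Yser[symmetric] X_Xser[symmetric] power_mult_distrib)
  then show "0 \<le> (Rser ^ k) $ n" "(Rser ^ k) $ n \<le> (Tser ^ k) $ n"
    using Xser_Yser_power by (simp_all add: fps_X_power_mult_nth)
qed

text \<open>Bounding R by T and n^(n-k) / (n-k)! by n^n / n! is enough: the factor 2^(-k) mirrors
  the value 1/2 of T at \<rho> and outweighs the polynomial growth of the coefficients of
  \<open>odd_cycle_ser\<close>.\<close>

lemma Rser_power_le:
  assumes "0 < n"
  shows "(Rser ^ k) $ n * \<rho> ^ n \<le> real k / 2 ^ k * qseq n / real n"
proof (cases "k \<le> n")
  case True
  have "(Rser ^ k) $ n * \<rho> ^ n \<le> (Tser ^ k) $ n * \<rho> ^ n"
    using Rser_power_bounds \<rho>_pos by (intro mult_right_mono) auto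
  also have "\<dots> = real k / 2 ^ k * (real n ^ (n - k) * exp (- real n) / fact (n - k)) / real n"
    by (rule Tser_power_nth[OF assms True])
  also have "\<dots> \<le> real k / 2 ^ k * qseq n / real n"
  proof -
    have "fact n div fact (n - k) \<le> n ^ k" by (rule fact_div_fact_le_pow[OF True])
    then have "real (fact n div fact (n - k)) \<le> real n ^ k" by (metis of_nat_le_iff of_nat_power)
    then have "fact n / fact (n - k) \<le> real n ^ k" by (simp add: real_of_nat_div fact_dvd)
    then have "fact n * real n ^ (n - k) \<le> real n ^ k * fact (n - k) * real n ^ (n - k)"
      by (intro mult_right_mono) (simp_all add: divide_le_eq)
    also have "\<dots> = real n ^ n * fact (n - k)" using True by (simp flip: power_add)
    finally have "real n ^ (n - k) / fact (n - k) \<le> real n ^ n / fact n" by (simp add: field_simps)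
    then have "real n ^ (n - k) / fact (n - k) * exp (- real n) \<le> real n ^ n / fact n * exp (- real n)"
      by (intro mult_right_mono) auto
    then have "real n ^ (n - k) * exp (- real n) / fact (n - k) \<le> qseq n"
      by (simp add: qseq_def field_simps)
    then show ?thesis by (intro divide_right_mono mult_left_mono) auto
  qed
  finally show ?thesis .
next
  case False
  then have "(Rser ^ k) $ n = 0" by (intro startsby_zero_power_prefix[rule_format]) auto
  then show ?thesis using qseq_pos[OF assms] by simp
qed

text \<open>For n = 0 both sides vanish, the right one because division by zero gives 0.\<close>

lemma Tser_nth: "Tser $ n * \<rho> ^ n = qseq n / (2 * real n)"
proof (cases n)
  case (Suc m)
  have "Tser $ n * \<rho> ^ n = real 1 / 2 ^ 1 * (real n ^ (n - 1) * exp (- real n) / fact (n - 1)) / real n"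
    using Tser_power_nth[of n 1] Suc by simp
  also have "real n ^ (n - 1) * exp (- real n) / fact (n - 1) = qseq n"
    unfolding qseq_def Suc diff_Suc_1 power_Suc fact_Suc by (simp del: of_nat_Suc)
  finally show ?thesis by simp
qed simp

lemma summable_qseq_div: "summable (\<lambda>n. qseq n / real n)"
proof (rule summable_comparison_test')
  show "summable (\<lambda>n. real n powr (- 3 / 2))" by (simp add: summable_real_powr_iff)
  fix n :: nat assume n: "1 \<le> n"
  then have q: "0 < qseq n" "qseq n \<le> 1 / sqrt (real n)" using qseq_pos qseq_upper by auto
  have "qseq n / real n \<le> 1 / sqrt (real n) / real n" using q by (intro divide_right_mono) auto
  also have "\<dots> = real n powr (- (1 / 2)) * real n powr (- 1)"
  proof -
    have "real n powr (- (1 / 2)) = 1 / sqrt (real n)" "real n powr (- 1) = 1 / real n"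
      by (simp_all add: powr_minus_divide powr_half_sqrt)
    then show ?thesis by simp
  qed
  also have "\<dots> = real n powr (- 3 / 2)" unfolding powr_add[symmetric] by simp
  finally show "norm (qseq n / real n) \<le> real n powr (- 3 / 2)" using q n by simp
qed

text \<open>The value \<tau> satisfies \<tau> = \<rho> exp(2 \<tau>), that is ln u = u - 1 for u = 2
  \<tau>; the choice of \<rho> makes this the case of equality in ln u <= u - 1, so u = 1.\<close>

lemma fsums_Tser: "fsums Tser \<rho> (1 / 2)"
proof -
  define \<tau> where "\<tau> = (\<Sum>n. qseq n / (2 * real n))"
  have s: "summable (\<lambda>n. qseq n / (2 * real n))"
    using summable_mult[OF summable_qseq_div, of "1 / 2"] by simp
  have nn: "0 \<le> qseq n / (2 * real n)" for n by (simp add: qseq_def)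
  have T: "fsums Tser \<rho> \<tau>"
    unfolding fsums_def Tser_nth abs_of_nonneg[OF nn] using s by (simp add: \<tau>_def summable_sums)
  have Tn: "0 \<le> Tser $ n" for n using Rser_power_bounds[of 1 n] by simp
  have "fsums (fexp (Tser + Tser)) \<rho> (exp (\<tau> + \<tau>))"
    using fsums_compose[OF fsums_add[OF T T] _ _ _ fsums_exp[of 1 "\<tau> + \<tau>"]] Tn \<rho>_pos by simp
  then have "fsums (fps_X * Yser) \<rho> (\<rho> * exp (\<tau> + \<tau>))"
    unfolding Yser_def by (rule fsums_mult[OF fsums_X])
  then have "\<tau> = \<rho> * exp (\<tau> + \<tau>)" using T fsums_unique unfolding X_Yser by blast
  then have e: "2 * \<tau> = exp (2 * \<tau> - 1)" by (simp add: \<rho>_def exp_diff exp_minus field_simps flip: mult_2)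
  then have "0 < 2 * \<tau>" using exp_gt_zero[of "2 * \<tau> - 1"] by linarith
  moreover have "ln (2 * \<tau>) = 2 * \<tau> - 1" by (subst e) simp
  ultimately have "2 * \<tau> = 1" by (rule ln_eq_minus_one)
  then have "\<tau> = 1 / 2" by simp
  then show ?thesis using T by (simp only:)
qed

text \<open>Comparison with T gives convergence, and R exp(R) = T turns into r exp(r) = 1/2, the
  equation that characterises \<open>l\<close>.\<close>

lemma fsums_Rser:
  assumes l: "\<And>x::real. 2 * x = exp (- x) \<longleftrightarrow> x = l"
  shows "fsums Rser \<rho> l"
proof -
  have Rn: "0 \<le> Rser $ n" "Rser $ n \<le> Tser $ n" for n using Rser_power_bounds[of 1 n] by simp_all
  have s: "summable (\<lambda>n. Rser $ n * \<rho> ^ n)"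
  proof (rule summable_comparison_test'[where N = 0])
    show "summable (\<lambda>n. Tser $ n * \<rho> ^ n)" using fsums_Tser by (simp add: fsums_def sums_iff)
    show "norm (Rser $ n * \<rho> ^ n) \<le> Tser $ n * \<rho> ^ n" for n
      using Rn \<rho>_pos by (simp add: mult_right_mono)
  qed
  define r where "r = (\<Sum>n. Rser $ n * \<rho> ^ n)"
  have R: "fsums Rser \<rho> r"
    unfolding fsums_def using s Rn \<rho>_pos by (simp add: r_def summable_sums)
  have "fsums (fexp Rser) \<rho> (exp r)"
    using fsums_compose[OF R _ _ _ fsums_exp[of 1 r]] Rn \<rho>_pos by simp
  then have "fsums (Rser * fexp Rser) \<rho> (r * exp r)" by (rule fsums_mult[OF R])
  then have "r * exp r = 1 / 2" using fsums_Tser fsums_unique unfolding Rser_eq by blast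
  then have "2 * r = exp (- r)" by (simp add: exp_minus field_simps)
  then show ?thesis using R l by simp
qed

section \<open>The series S as a function of R\<close>

definition evens :: "real fps" where "evens = Abs_fps (\<lambda>k. if even k \<and> 2 \<le> k then 1 else 0)"
definition alt :: "real fps" where "alt = Abs_fps (\<lambda>k. (- 1) ^ k)"
text \<open>\<open>evens\<close> is X^2 / (1 - X^2), the derivative of the sum of X^k / k over odd k
  >= 3, and \<open>alt\<close> is 1 / (1 + X). The last two factors convert a derivative of R into
  one of T.\<close>

definition odd_cycle_ser :: "real fps" where "odd_cycle_ser = evens * alt * fps_exp (- 1)"

lemma alt_eq: "(1 + fps_X) * alt = 1"
proof (rule fps_ext)
  fix n show "((1 + fps_X) * alt) $ n = 1 $ n"
    by (cases n) (simp_all add: distrib_right alt_def)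
qed

lemma evens_eq: "(1 - fps_X * fps_X) * evens = fps_X * fps_X"
proof (rule fps_ext)
  fix n
  have "(fps_X * fps_X * evens) $ n = (if n < 2 then 0 else evens $ (n - 2))"
    by (simp add: mult.assoc numeral_2_eq_2)
  moreover have "(fps_X * fps_X :: real fps) $ n = (if n = 2 then 1 else 0)"
    by (simp add: fps_X_nth numeral_2_eq_2) auto
  ultimately show "((1 - fps_X * fps_X) * evens) $ n = (fps_X * fps_X) $ n"
    by (auto simp: left_diff_distrib evens_def)
qed

lemma fsums_bounded_coeffs:
  assumes "0 < x" "x < 1" "\<And>k. \<bar>f $ k\<bar> \<le> 1"
  shows "fsums f x (\<Sum>k. f $ k * x ^ k)"
proof -
  have s: "summable (\<lambda>k. \<bar>f $ k * x ^ k\<bar>)"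
  proof (rule summable_comparison_test'[where N = 0])
    show "summable (\<lambda>k. x ^ k)" using assms by (intro summable_geometric) auto
    show "norm \<bar>f $ k * x ^ k\<bar> \<le> x ^ k" for k
      using assms by (simp add: abs_mult mult_left_le_one_le)
  qed
  show ?thesis unfolding fsums_def by (rule conjI[OF s summable_sums[OF summable_rabs_cancel[OF s]]])
qed

lemma fsums_odd_cycle_ser:
  assumes x: "0 < x" "x < 1"
  shows "fsums odd_cycle_ser x (x\<^sup>2 / ((1 - x\<^sup>2) * (1 + x)) * exp (- x))"
proof -
  define e a where "e = (\<Sum>k. evens $ k * x ^ k)" and "a = (\<Sum>k. alt $ k * x ^ k)"
  have E: "fsums evens x e" and A: "fsums alt x a"
    unfolding e_def a_def by (rule fsums_bounded_coeffs[OF x], simp add: evens_def alt_def power_abs)+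
  have "fsums ((1 + fps_X) * alt) x ((1 + x) * a)"
    by (intro fsums_mult fsums_add fsums_one fsums_X A)
  then have a: "(1 + x) * a = 1" using fsums_unique fsums_one unfolding alt_eq by blast
  have XX: "fsums (fps_X * fps_X) x (x * x)" by (intro fsums_mult fsums_X)
  have m1: "fsums (- 1) x (- 1)" using fsums_finite[of "{0}" "- 1" x] by simp
  have "fsums ((1 + (- 1) * (fps_X * fps_X)) * evens) x ((1 + (- 1) * (x * x)) * e)"
    by (intro fsums_mult fsums_add fsums_one fsums_X E m1)
  then have "fsums (fps_X * fps_X) x ((1 - x * x) * e)" using evens_eq by simp
  then have e: "(1 - x * x) * e = x * x" using fsums_unique XX by blast
  have "x * x < 1 * 1" using x by (intro mult_strict_mono) auto
  then have "e = x\<^sup>2 / (1 - x\<^sup>2)" using e by (simp add: power2_eq_square field_simps)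
  moreover have "a = 1 / (1 + x)" using a x by (simp add: field_simps)
  moreover have "fsums odd_cycle_ser x (e * a * exp (- 1 * x))"
    unfolding odd_cycle_ser_def by (intro fsums_mult E A fsums_exp)
  ultimately show ?thesis by simp
qed

text \<open>A crude bound: any polynomial growth is absorbed by the factor 2^(-k) of
  \<open>Rser_power_le\<close>.\<close>

lemma odd_cycle_ser_bound: "\<bar>odd_cycle_ser $ k\<bar> \<le> (real k + 1) ^ 2"
proof -
  have e: "\<bar>evens $ k\<bar> \<le> 1" "\<bar>alt $ k\<bar> \<le> 1" "\<bar>fps_exp (- 1 :: real) $ k\<bar> \<le> 1" for k
    by (auto simp: evens_def alt_def power_abs abs_mult fact_ge_1)
  have "\<bar>(evens * alt) $ k\<bar> \<le> real k + 1" for k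
  proof -
    have "\<bar>(evens * alt) $ k\<bar> \<le> (\<Sum>i=0..k. 1)"
      unfolding fps_mult_nth
    proof (rule order_trans[OF sum_abs], rule sum_mono)
      fix i show "\<bar>evens $ i * alt $ (k - i)\<bar> \<le> 1"
        using mult_mono[OF e(1)[of i] e(2)[of "k - i"]] by (simp add: abs_mult)
    qed
    then show ?thesis by simp
  qed
  note ea = this
  have "\<bar>odd_cycle_ser $ k\<bar> \<le> (\<Sum>i=0..k. real k + 1)"
    unfolding odd_cycle_ser_def fps_mult_nth[of "evens * alt"]
  proof (rule order_trans[OF sum_abs], rule sum_mono)
    fix i assume "i \<in> {0..k}"
    then have "\<bar>(evens * alt) $ i\<bar> \<le> real k + 1" using ea[of i] by simp
    then show "\<bar>(evens * alt) $ i * fps_exp (- 1) $ (k - i)\<bar> \<le> real k + 1"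
      using mult_mono[OF _ e(3)[of "k - i"], of "\<bar>(evens * alt) $ i\<bar>" "real k + 1"] by (simp only: abs_mult) simp
  qed
  then show ?thesis by (simp add: power2_eq_square algebra_simps)
qed

section \<open>Asymptotics\<close>

definition Sser :: "real fps" where "Sser = odd_cycle_ser oo Rser"

text \<open>The bounds of \<open>Rser_power_le\<close> are summed over k; \<open>D\<close> is the
  sum of (k + 1)^2 k / 2^k. The resulting decay of order n^(-3/2) is what
  \<open>qseq_convolution\<close> requires.\<close>

lemma Sser_bound:
  "\<exists>D\<ge>0. \<forall>n>0. \<bar>Sser $ n * \<rho> ^ n\<bar> \<le> D * qseq n / real n"
proof -
  define d where "d k = (real k + 1) ^ 2 * (real k / 2 ^ k)" for k
  have d0: "0 \<le> d k" for k by (simp add: d_def)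
  have "summable d"
  proof (rule summable_comparison_test_bigo)
    show "summable (\<lambda>k. norm (inverse (real k ^ 2)))" using inverse_power_summable[of 2, where 'a = real] by simp
    show "d \<in> O(\<lambda>k. inverse (real k ^ 2))" unfolding d_def by real_asymp
  qed
  then have sd: "sum d {..n} \<le> suminf d" for n using d0 by (intro sum_le_suminf) auto
  have "\<bar>Sser $ n * \<rho> ^ n\<bar> \<le> suminf d * qseq n / real n" if n: "0 < n" for n
  proof -
    have "\<bar>Sser $ n * \<rho> ^ n\<bar> = \<bar>\<Sum>k\<le>n. odd_cycle_ser $ k * ((Rser ^ k) $ n * \<rho> ^ n)\<bar>"
      by (simp add: Sser_def fps_compose_nth atLeast0AtMost sum_distrib_right mult.assoc)
    also have "\<dots> \<le> (\<Sum>k\<le>n. d k * (qseq n / real n))"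
    proof (rule order_trans[OF sum_abs], rule sum_mono)
      fix k
      have p: "0 \<le> (Rser ^ k) $ n * \<rho> ^ n" using Rser_power_bounds \<rho>_pos by simp
      have "\<bar>odd_cycle_ser $ k * ((Rser ^ k) $ n * \<rho> ^ n)\<bar> = \<bar>odd_cycle_ser $ k\<bar> * ((Rser ^ k) $ n * \<rho> ^ n)"
        by (simp only: abs_mult[of "odd_cycle_ser $ k"] abs_of_nonneg[OF p])
      also have "\<dots> \<le> (real k + 1) ^ 2 * (real k / 2 ^ k * qseq n / real n)"
        using p by (intro mult_mono odd_cycle_ser_bound Rser_power_le n) auto
      finally show "\<bar>odd_cycle_ser $ k * ((Rser ^ k) $ n * \<rho> ^ n)\<bar> \<le> d k * (qseq n / real n)"
        by (simp add: d_def)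
    qed
    also have "\<dots> = sum d {..n} * (qseq n / real n)" by (rule sum_distrib_right[symmetric])
    also have "\<dots> \<le> suminf d * (qseq n / real n)"
      using qseq_pos[OF n] by (intro mult_right_mono sd) auto
    finally show ?thesis by simp
  qed
  moreover have "0 \<le> suminf d" using \<open>summable d\<close> d0 by (intro suminf_nonneg) auto
  ultimately show ?thesis by blast
qed

text \<open>Differentiating T = R exp(R) gives T' = R' (1 + R) exp(R), and the last two factors are
  cancelled by \<open>alt\<close> and the exponential in \<open>odd_cycle_ser\<close>.\<close>

lemma deriv_Rser: "fps_deriv Rser * (evens oo Rser) = fps_deriv Tser * Sser"
proof -
  have R0: "Rser $ 0 = 0" by simp
  have "fps_const (- 1) * Rser = - Rser" by (rule fps_ext) simp
  then have ex: "fps_exp (- 1) oo Rser = fexp (- Rser)"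
    using fps_exp_compose_eq[OF R0, of "- 1"] by (simp only:)
  have S: "Sser = (evens oo Rser) * (alt oo Rser) * fexp (- Rser)"
    unfolding Sser_def odd_cycle_ser_def by (simp add: fps_compose_mult_distrib[OF R0] ex)
  have al: "(1 + Rser) * (alt oo Rser) = 1"
  proof -
    have "((1 + fps_X) * alt) oo Rser = 1" unfolding alt_eq by simp
    then show ?thesis by (simp add: fps_compose_mult_distrib[OF R0] fps_compose_add_distrib)
  qed
  have T': "fps_deriv Tser = fps_deriv Rser * (1 + Rser) * fexp Rser"
    by (subst Rser_eq[symmetric]) (simp add: fexp_deriv algebra_simps)
  have "fps_deriv Tser * Sser
    = fps_deriv Rser * (evens oo Rser) * ((1 + Rser) * (alt oo Rser)) * (fexp Rser * fexp (- Rser))"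
    unfolding T' S by (simp only: mult_ac)
  then show ?thesis by (simp add: al fexp_inverse)
qed

text \<open>Multiplication by n is differentiation, which removes the 1/k and leaves the even powers
  i = k - 1 >= 2 of R; the index i = 0 can be added since \<open>evens\<close> vanishes
  there.\<close>

lemma kernelless_coeff:
  assumes n: "0 < n"
  shows "real n * (\<Sum>k=2..n. if odd k then (Rser ^ k) $ n / real k else 0) = (fps_deriv Tser * Sser) $ (n - 1)"
proof -
  have "real n * (\<Sum>k=2..n. if odd k then (Rser ^ k) $ n / real k else 0)
    = (\<Sum>k=2..n. if odd k then (fps_deriv Rser * Rser ^ (k - 1)) $ (n - 1) else 0)"
    unfolding sum_distrib_left
  proof (rule sum.cong[OF refl])
    fix k assume k: "k \<in> {2..n}"
    have "fps_deriv (Rser ^ k) $ (n - 1) = real n * (Rser ^ k) $ n" using n by simp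
    moreover have "fps_deriv (Rser ^ k) = fps_const (real k) * (fps_deriv Rser * Rser ^ (k - 1))"
      by (simp add: fps_deriv_power mult.assoc)
    ultimately have "real n * (Rser ^ k) $ n = real k * (fps_deriv Rser * Rser ^ (k - 1)) $ (n - 1)"
      by (metis fps_mult_left_const_nth)
    then show "real n * (if odd k then (Rser ^ k) $ n / real k else 0)
      = (if odd k then (fps_deriv Rser * Rser ^ (k - 1)) $ (n - 1) else 0)"
      using k by (auto simp: field_simps)
  qed
  also have "\<dots> = (\<Sum>i=1..n-1. if even i then (fps_deriv Rser * Rser ^ i) $ (n - 1) else 0)"
    by (rule sum.reindex_bij_witness[where i = Suc and j = "\<lambda>k. k - 1"]) auto
  also have "\<dots> = (\<Sum>i=1..n-1. evens $ i * (fps_deriv Rser * Rser ^ i) $ (n - 1))"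
    by (intro sum.cong refl) (auto simp: evens_def elim!: evenE)
  also have "\<dots> = (\<Sum>i\<le>n-1. evens $ i * (fps_deriv Rser * Rser ^ i) $ (n - 1))"
    by (intro sum.mono_neutral_left) (auto simp: evens_def)
  also have "\<dots> = (fps_deriv Rser * (evens oo Rser)) $ (n - 1)"
    by (rule mult_compose_nth[symmetric]) simp
  finally show ?thesis unfolding deriv_Rser .
qed

text \<open>The coefficients n T_n, rescaled by \<rho>^n, equal q(n) / 2, and the normalising g =
  2^(n-1) n^(n-1) satisfies n g \<rho>^n = n! q(n) / 2; factorial and factor 1/2 cancel.\<close>

lemma kernelless_ratio:
  assumes n: "0 < n"
  shows "real (card (kernelless {1..n})) / (2 ^ (n - 1) * real n ^ (n - 1))
    = (\<Sum>j<n. (Sser $ j * \<rho> ^ j) * qseq (n - j)) / qseq n"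
proof -
  define N where "N = real (card (kernelless {1..n}))"
  define g where "g = 2 ^ (n - 1) * real n ^ (n - 1)"
  have "N = fact n * (\<Sum>k=2..n. if odd k then (Rser ^ k) $ n / real k else 0)"
    unfolding N_def using card_kernelless[of "{1..n}"] by (simp add: sum_distrib_left if_distrib cong: if_cong)
  then have "real n * N = fact n * (real n * (\<Sum>k=2..n. if odd k then (Rser ^ k) $ n / real k else 0))" by simp
  also have "\<dots> = fact n * (fps_deriv Tser * Sser) $ (n - 1)" by (simp only: kernelless_coeff[OF n])
  also have "(fps_deriv Tser * Sser) $ (n - 1) = (\<Sum>j<n. Sser $ j * (real (n - j) * Tser $ (n - j)))"
  proof -
    have "(fps_deriv Tser * Sser) $ (n - 1) = (\<Sum>j=0..n-1. Sser $ j * fps_deriv Tser $ (n - 1 - j))"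
      by (subst mult.commute) (rule fps_mult_nth)
    also have "\<dots> = (\<Sum>j<n. Sser $ j * (real (n - j) * Tser $ (n - j)))"
    proof (rule sum.cong)
      show "{0..n - 1} = {..<n}" using n by auto
      fix j assume "j \<in> {..<n}"
      then have "n - 1 - j + 1 = n - j" by auto
      then show "Sser $ j * fps_deriv Tser $ (n - 1 - j) = Sser $ j * (real (n - j) * Tser $ (n - j))"
        by (simp only: fps_deriv_nth)
    qed
    finally show ?thesis .
  qed
  finally have "real n * N * \<rho> ^ n = fact n * (\<Sum>j<n. Sser $ j * (real (n - j) * Tser $ (n - j)) * \<rho> ^ n)"
    by (simp add: sum_distrib_right mult.assoc)
  also have "(\<Sum>j<n. Sser $ j * (real (n - j) * Tser $ (n - j)) * \<rho> ^ n) = (\<Sum>j<n. (Sser $ j * \<rho> ^ j) * qseq (n - j) / 2)"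
  proof (rule sum.cong[OF refl])
    fix j assume j: "j \<in> {..<n}"
    then have "\<rho> ^ n = \<rho> ^ j * \<rho> ^ (n - j)" by (simp flip: power_add)
    then have "Sser $ j * (real (n - j) * Tser $ (n - j)) * \<rho> ^ n
      = (Sser $ j * \<rho> ^ j) * (real (n - j) * (Tser $ (n - j) * \<rho> ^ (n - j)))" by simp
    also have "real (n - j) * (Tser $ (n - j) * \<rho> ^ (n - j)) = qseq (n - j) / 2"
    proof -
      have "real (n - j) \<noteq> 0" using j by simp
      then show ?thesis unfolding Tser_nth by (simp del: of_nat_diff)
    qed
    finally show "Sser $ j * (real (n - j) * Tser $ (n - j)) * \<rho> ^ n = (Sser $ j * \<rho> ^ j) * qseq (n - j) / 2" by simp
  qed
  finally have A: "real n * N * \<rho> ^ n = fact n * ((\<Sum>j<n. (Sser $ j * \<rho> ^ j) * qseq (n - j)) / 2)"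
    by (simp add: sum_divide_distrib)
  have "exp (- 1 :: real) ^ n = exp (- real n)" by (simp flip: exp_of_nat_mult)
  then have r: "\<rho> ^ n = exp (- real n) / 2 ^ n" by (simp add: \<rho>_def power_divide)
  have p2: "(2::real) ^ n = 2 * 2 ^ (n - 1)" and pn: "real n ^ n = real n * real n ^ (n - 1)"
    using n by (cases n, simp_all)+
  have B: "real n * g * \<rho> ^ n = fact n * (qseq n / 2)"
    unfolding r g_def qseq_def p2 pn by simp
  have pos: "0 < real n" "0 < \<rho> ^ n" "0 < qseq n" using n \<rho>_pos qseq_pos by auto
  have "N / g = (real n * N * \<rho> ^ n) / (real n * g * \<rho> ^ n)" using pos \<rho>_pos by simp
  also have "\<dots> = (\<Sum>j<n. (Sser $ j * \<rho> ^ j) * qseq (n - j)) / qseq n" unfolding A B by simp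
  finally show ?thesis unfolding N_def g_def .
qed

lemma kernelless_asymp:
  assumes l: "\<And>x::real. 2 * x = exp (- x) \<longleftrightarrow> x = l" and l01: "0 < l" "l < 1"
  shows "(\<lambda>n. real (card (kernelless {1..n})) / (2 ^ (n - 1) * real n ^ (n - 1)))
    \<longlonglongrightarrow> 2 * l ^ 3 / ((1 + l)\<^sup>2 * (1 - l))"
proof -
  have Rn: "0 \<le> Rser $ n" for n using Rser_power_bounds[of 1 n] by simp
  have S: "fsums Sser \<rho> (l\<^sup>2 / ((1 - l\<^sup>2) * (1 + l)) * exp (- l))"
    unfolding Sser_def using \<rho>_pos Rn by (intro fsums_compose[OF fsums_Rser[OF l]] fsums_odd_cycle_ser l01) auto
  obtain D where D: "0 \<le> D" "\<And>n. 0 < n \<Longrightarrow> \<bar>Sser $ n * \<rho> ^ n\<bar> \<le> D * qseq n / real n"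
    using Sser_bound by blast
  have "(\<lambda>n. (\<Sum>j<n. (Sser $ j * \<rho> ^ j) * qseq (n - j)) / qseq n) \<longlonglongrightarrow> (\<Sum>j. Sser $ j * \<rho> ^ j)"
    using S D by (intro qseq_convolution) (auto simp: fsums_def)
  also have "(\<Sum>j. Sser $ j * \<rho> ^ j) = l\<^sup>2 / ((1 - l\<^sup>2) * (1 + l)) * exp (- l)"
    using S by (simp add: fsums_def sums_iff)
  \<comment> \<open>Here the equation for \<open>l\<close> enters: it turns l^2 exp(-l) into the 2
    l^3 of the result.\<close>
  also have "exp (- l) = 2 * l" using l[of l] by simp
  also have "l\<^sup>2 / ((1 - l\<^sup>2) * (1 + l)) * (2 * l) = 2 * l ^ 3 / ((1 + l)\<^sup>2 * (1 - l))"
  proof -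
    have "(1 - l\<^sup>2) * (1 + l) = (1 + l)\<^sup>2 * (1 - l)" by (simp add: power2_eq_square algebra_simps)
    then show ?thesis by (simp only:) (simp add: power2_eq_square power3_eq_cube)
  qed
  finally have L: "(\<lambda>n. (\<Sum>j<n. (Sser $ j * \<rho> ^ j) * qseq (n - j)) / qseq n) \<longlonglongrightarrow> 2 * l ^ 3 / ((1 + l)\<^sup>2 * (1 - l))" .
  have "eventually (\<lambda>n. (\<Sum>j<n. (Sser $ j * \<rho> ^ j) * qseq (n - j)) / qseq n
    = real (card (kernelless {1..n})) / (2 ^ (n - 1) * real n ^ (n - 1))) sequentially"
    using eventually_gt_at_top[of 0] by eventually_elim (rule kernelless_ratio[symmetric])
  then show ?thesis by (rule Lim_transform_eventually[OF L])
qed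

text \<open>After normalisation only \<open>Qsum\<close> survives: its terms k = 0, 1, 2, absent
  from the exact count, are at most 1 each, and so are the contributions of trees and of 2-cycles;
  all this is negligible against sqrt n.\<close>

lemma unicycles_asymp:
  "(\<lambda>n. real (card (unicycles {1..n})) / (2 ^ (n - 1) * real n ^ (n - 1)) / sqrt (real n)) \<longlonglongrightarrow> sqrt (pi / 2)"
proof -
  define G where "G n = real (card (unicycles {1..n})) / (2 ^ (n - 1) * real n ^ (n - 1))" for n
  have b: "Qsum n - 3 \<le> G n \<and> G n \<le> Qsum n + 2" if n: "2 \<le> n" for n
  proof -
    define g where "g = 2 ^ (n - 1) * real n ^ (n - 1)"
    define t where "t k = fact n / fact (n - k) / real n ^ k" for k
    have g: "0 < g" using n by (simp add: g_def)
    have t: "0 \<le> t k" for k by (simp add: t_def)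
    have t1: "t k \<le> 1" if "k \<le> n" for k
    proof -
      have "fact n div fact (n - k) \<le> n ^ k" by (rule fact_div_fact_le_pow[OF that])
      then have "real (fact n div fact (n - k)) \<le> real n ^ k" by (metis of_nat_le_iff of_nat_power)
      then show ?thesis using n by (simp add: t_def real_of_nat_div fact_dvd divide_le_eq mult.commute)
    qed
    have "{..n} = {..2} \<union> {3..n}" using n by auto
    then have "Qsum n = sum t {..2} + sum t {3..n}"
      unfolding Qsum_def t_def[symmetric] by (simp only:) (rule sum.union_disjoint, auto)
    moreover have "sum t {..2} \<le> (\<Sum>k\<le>(2::nat). 1)" using n by (intro sum_mono t1) auto
    moreover have "0 \<le> sum t {..2}" by (intro sum_nonneg t)
    ultimately have Q: "Qsum n - 3 \<le> sum t {3..n}" "sum t {3..n} \<le> Qsum n" by auto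
    have "g * sum t {3..n} \<le> real (card (unicycles {1..n}))" "real (card (unicycles {1..n})) \<le> g * sum t {3..n} + 2 * g"
      using card_unicycles_bounds[of "{1..n}"] n unfolding g_def t_def by auto
    then have "sum t {3..n} \<le> G n" "G n \<le> sum t {3..n} + 2"
      unfolding G_def g_def[symmetric] using g by (simp_all add: field_simps)
    then show ?thesis using Q by auto
  qed
  have "(\<lambda>n. G n / sqrt (real n) - Qsum n / sqrt (real n)) \<longlonglongrightarrow> 0"
  proof (rule Lim_null_comparison)
    show "(\<lambda>n. 3 / sqrt (real n)) \<longlonglongrightarrow> 0" by real_asymp
    show "eventually (\<lambda>n. norm (G n / sqrt (real n) - Qsum n / sqrt (real n)) \<le> 3 / sqrt (real n)) sequentially"
      using eventually_ge_at_top[of 2]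
    proof eventually_elim
      case (elim n)
      have "\<bar>G n - Qsum n\<bar> / sqrt (real n) \<le> 3 / sqrt (real n)"
        using b[OF elim] by (intro divide_right_mono) auto
      then show ?case by (simp add: diff_divide_distrib[symmetric] abs_divide)
    qed
  qed
  from tendsto_add[OF this Qsum_asymp] show ?thesis unfolding G_def by simp
qed

text \<open>Both counts are normalised by 2^(n-1) n^(n-1), that of all unicycle digraphs
  additionally by sqrt n; the quotient of the limits is the constant, as 2 / sqrt(pi/2) = 2 sqrt 2 /
  sqrt pi.\<close>

theorem theorem8:
  shows "\<exists>l::real.
    (\<forall>x::real. 2 * x = exp (- x) \<longleftrightarrow> x = l) \<and>
    \<bar>l - 0.351733\<bar> < 1 / 10 ^ 6 \<and>
    (\<lambda>n. real (num_unicycle_kernel n) / real (num_unicycle n)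
       - (1 - 2 * sqrt 2 * l ^ 3 / ((1 + l)\<^sup>2 * (1 - l) * sqrt pi) * (1 / sqrt (real n))))
     \<in> o(\<lambda>n. 1 / sqrt (real n))"
proof -
  obtain l :: real where l: "\<forall>x::real. 2 * x = exp (- x) \<longleftrightarrow> x = l" "0 < l" "l < 1" "\<bar>l - 0.351733\<bar> < 1 / 10 ^ 6"
    using two_x_eq_exp_root by blast
  define c where "c = 2 * sqrt 2 * l ^ 3 / ((1 + l)\<^sup>2 * (1 - l) * sqrt pi)"
  define g where "g n = 2 ^ (n - 1) * real n ^ (n - 1)" for n
  define N where "N n = real (card (kernelless {1..n})) / g n" for n
  define U where "U n = real (card (unicycles {1..n})) / g n / sqrt (real n)" for n
  have N: "N \<longlonglongrightarrow> 2 * l ^ 3 / ((1 + l)\<^sup>2 * (1 - l))"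
    unfolding N_def g_def by (rule kernelless_asymp) (use l in auto)
  have U: "U \<longlonglongrightarrow> sqrt (pi / 2)" unfolding U_def g_def by (rule unicycles_asymp)
  have "(\<lambda>n. N n / U n) \<longlonglongrightarrow> (2 * l ^ 3 / ((1 + l)\<^sup>2 * (1 - l))) / sqrt (pi / 2)"
    by (rule tendsto_divide[OF N U]) simp
  also have "(2 * l ^ 3 / ((1 + l)\<^sup>2 * (1 - l))) / sqrt (pi / 2) = c"
    by (simp add: c_def real_sqrt_divide)
  finally have "(\<lambda>n. c - N n / U n) \<longlonglongrightarrow> 0" using tendsto_diff[OF tendsto_const[of c]] by fastforce
  moreover have "eventually (\<lambda>n. c - N n / U n = (real (num_unicycle_kernel n) / real (num_unicycle n)
      - (1 - c * (1 / sqrt (real n)))) / (1 / sqrt (real n))) sequentially"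
  proof -
    \<comment> \<open>Ensures that the number of unicycle digraphs is nonzero, so that all the
      divisions below are genuine.\<close>
    have "eventually (\<lambda>n. 0 < U n) sequentially" using U by (rule order_tendstoD) simp
    then show ?thesis using eventually_gt_at_top[of 0]
    proof eventually_elim
      case (elim n)
      then have p: "0 < g n" "0 < sqrt (real n)" by (auto simp: g_def)
      then have u: "0 < real (card (unicycles {1..n}))" using elim by (auto simp: U_def zero_less_divide_iff)
      have "real (num_unicycle_kernel n) = real (card (unicycles {1..n})) - real (card (kernelless {1..n}))"
        using num_unicycle_kernel_eq[of n] num_unicycle_eq[of n] by simp
      then have e1: "real (num_unicycle_kernel n) / real (num_unicycle n) = 1 - real (card (kernelless {1..n})) / real (card (unicycles {1..n}))"
        using u by (simp add: num_unicycle_eq diff_divide_distrib)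
      have e2: "N n / U n = real (card (kernelless {1..n})) / real (card (unicycles {1..n})) * sqrt (real n)"
        using p u by (simp add: N_def U_def)
      show ?case unfolding e1 e2 using p by (simp add: divide_simps) (simp add: algebra_simps)
    qed
  qed
  ultimately have "(\<lambda>n. (real (num_unicycle_kernel n) / real (num_unicycle n)
      - (1 - c * (1 / sqrt (real n)))) / (1 / sqrt (real n))) \<longlonglongrightarrow> 0"
    by (rule Lim_transform_eventually)
  then have "(\<lambda>n. real (num_unicycle_kernel n) / real (num_unicycle n) - (1 - c * (1 / sqrt (real n)))) \<in> o(\<lambda>n. 1 / sqrt (real n))"
    by (rule smalloI_tendsto) (use eventually_gt_at_top[of 0] in \<open>eventually_elim, simp\<close>)
  then show ?thesis unfolding c_def using l by (intro exI[of _ l]) auto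
qed

end
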